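(* Let $K$ be a field of characteristic $0$, complete with respect to a non-trivial non-archimedean absolute value $|\cdot|$, let $J\neq\emptyset$ be a set, and let $\{\partial_j\}_{j\in J}$ be a family of pairwise commuting, non-zero, bounded derivations of $K$. Let $V$ be a finite differential module over $(K,\partial_J)$. Then: (1) there exist only finitely many $r_J=(r_j)_{j\in J}\in\prod_{j\in J}(0,r(K,\partial_j)]$ such that $V_{r_J}\neq 0$; (2) the natural morphism $\bigoplus_{r_J\in\prod_{j\in J}(0,r(K,\partial_j)]}V_{r_J}\to V$ (induced by the inclusions) is an isomorphism.
   Context: Let $p(K)$ be the characteristic of the residue field of $K$; put $\omega(K)=|p(K)|^{1/(p(K)-1)}$ if $p(K)>0$ and $\omega(K)=1$ if $p(K)=0$. A derivation $\partial$ is bounded if $|\partial|_{op}=\sup_{x\neq0}|\partial(x)|/|x|<\infty$; its spectral norm is $|\partial|_{sp,K}=\inf_{i\ge1}|\partial^i|_{op}^{1/i}$, and $r(K,\partial_j)=\omega(K)/|\partial_j|_{sp,K}$. A finite differential module over $(K,\partial_J)$ is a finite-dimensional $K$-vector space $V$ with pairwise commuting additive maps $\nabla_j:V\to V$ ($j\in J$) satisfying $\nabla_j(cv)=\partial_j(c)v+c\nabla_j(v)$. For fixed $j$ and a finite differential module $W$ over $(K,\partial_j)$ (one operator $\nabla_j$), define $m_j(W):(0,r(K,\partial_j)]\to\mathbb N$ as follows: if $W$ is irreducible (no non-zero proper $\nabla_j$-stable subspace), choose any norm on the $K$-vector space $W$ compatible with $|\cdot|$ and put $m_j(W)(r)=\dim_K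 W$ if $r=\omega(K)/|\nabla_j|_{sp,W}$ (spectral norm of $\nabla_j$ on $W$) and $m_j(W)(r)=0$ otherwise; in general $m_j(W)$ is the sum of $m_j$ over the Jordan–Hölder factors of $W$. This is well defined, and the extrinsic subsidiary $\partial_j$-generic radii of convergence of $W$ are the numbers $r$ counted with multiplicity $m_j(W)(r)$. For $r_J\in\prod_{j}(0,r(K,\partial_j)]$, $V_{r_J}$ denotes the largest $K$-subspace of $V$ stable under all $\nabla_j$ such that, for every $j\in J$, all extrinsic subsidiary $\partial_j$-generic radii of convergence of $V_{r_J}$ (viewed as a differential module over $(K,\partial_j)$) equal $r_j$; such a largest subspace exists. *)

theory Defs
  imports "HOL-Analysis.Analysis"
begin

section \<open>Valued fields and derivations\<close>

locale complete_nonarch_field =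
  fixes av :: "'k::field_char_0 \<Rightarrow> real"
  assumes av_nonneg: "0 \<le> av x"
    and av_eq_0_iff: "av x = 0 \<longleftrightarrow> x = 0"
    and av_mult: "av (x * y) = av x * av y"
    and av_ultra: "av (x + y) \<le> max (av x) (av y)"
    and av_nontrivial: "\<exists>x. x \<noteq> 0 \<and> av x \<noteq> 1"
    and av_complete: "Metric_space.mcomplete UNIV (\<lambda>x y. av (x - y))"

definition vcoset :: "'a::ab_group_add set \<Rightarrow> 'a \<Rightarrow> 'a set" where
  "vcoset U x = (+) x ` U"

definition maximal_ideal :: "('k::field_char_0 \<Rightarrow> real) \<Rightarrow> 'k set" where
  "maximal_ideal av = {x. av x < 1}"

text \<open>The residue field is the quotient of the ring of elements of absolute value at most 1 by
  the maximal ideal; it contains all integers.  Its characteristic is the non-negative generator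
  of the ideal of integers whose class is zero, as for \<open>CHAR\<close> on type classes.\<close>

definition residue_char :: "('k::field_char_0 \<Rightarrow> real) \<Rightarrow> nat" where
  "residue_char av = Gcd {n. vcoset (maximal_ideal av) (of_nat n) = vcoset (maximal_ideal av) 0}"

definition omega :: "('k::field_char_0 \<Rightarrow> real) \<Rightarrow> real" where
  "omega av =
    (if residue_char av > 0
     then av (of_nat (residue_char av)) powr (1 / (real (residue_char av) - 1)) else 1)"

text \<open>In the next two definitions \<open>S\<close> is the set of (representatives of) non-zero vectors.
  They are only meaningful for operators that are bounded with respect to \<open>N\<close>.\<close>

definition op_norm :: "'a set \<Rightarrow> ('a \<Rightarrow> real) \<Rightarrow> ('a \<Rightarrow> 'a) \<Rightarrow> real" where
  "op_norm S N T = (SUP x\<in>S. N (T x) / N x)"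

definition sp_norm :: "'a set \<Rightarrow> ('a \<Rightarrow> real) \<Rightarrow> ('a \<Rightarrow> 'a) \<Rightarrow> real" where
  "sp_norm S N T = (INF i\<in>{1::nat..}. op_norm S N (T ^^ i) powr (1 / real i))"

locale bounded_derivation =
  fixes av :: "'k::field_char_0 \<Rightarrow> real" and d :: "'k \<Rightarrow> 'k"
  assumes d_add: "d (x + y) = d x + d y"
    and d_mult: "d (x * y) = d x * y + x * d y"
    and d_bounded: "bdd_above ((\<lambda>x. av (d x) / av x) ` (UNIV - {0}))"

definition field_radius :: "('k::field_char_0 \<Rightarrow> real) \<Rightarrow> ('k \<Rightarrow> 'k) \<Rightarrow> real" where
  "field_radius av d = omega av / sp_norm (UNIV - {0}) av d"

definition radius_tuples ::
    "('k::field_char_0 \<Rightarrow> real) \<Rightarrow> 'j set \<Rightarrow> ('j \<Rightarrow> 'k \<Rightarrow> 'k) \<Rightarrow> ('j \<Rightarrow> real) set" where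
  "radius_tuples av J d = (\<Pi>\<^sub>E j\<in>J. {0 <.. field_radius av (d j)})"

section \<open>Finite differential modules\<close>

locale finite_differential_module = vector_space smul
  for smul :: "'k::field_char_0 \<Rightarrow> 'v::ab_group_add \<Rightarrow> 'v" +
  fixes J :: "'j set" and d :: "'j \<Rightarrow> 'k \<Rightarrow> 'k" and nabla :: "'j \<Rightarrow> 'v \<Rightarrow> 'v"
  assumes finite_dim: "\<exists>B. finite B \<and> span B = UNIV"
    and nabla_add: "j \<in> J \<Longrightarrow> nabla j (v + w) = nabla j v + nabla j w"
    and nabla_scale: "j \<in> J \<Longrightarrow> nabla j (smul c v) = smul (d j c) v + smul c (nabla j v)"
    and nabla_commute: "i \<in> J \<Longrightarrow> j \<in> J \<Longrightarrow> nabla i (nabla j v) = nabla j (nabla i v)"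

definition stable_subspace ::
    "('k::field_char_0 \<Rightarrow> 'v::ab_group_add \<Rightarrow> 'v) \<Rightarrow> ('v \<Rightarrow> 'v) \<Rightarrow> 'v set \<Rightarrow> bool" where
  "stable_subspace smul D X \<longleftrightarrow> module.subspace smul X \<and> D ` X \<subseteq> X"

text \<open>A subquotient \<open>W/U\<close> is represented by the pair \<open>U \<subseteq> W\<close>; its vectors are the cosets
  \<open>vcoset U x\<close> with \<open>x \<in> W\<close>, and its stable subspaces are the \<open>X/U\<close> with \<open>U \<subseteq> X \<subseteq> W\<close>
  and \<open>X\<close> stable.\<close>

definition irreducible_quotient ::
    "('k::field_char_0 \<Rightarrow> 'v::ab_group_add \<Rightarrow> 'v) \<Rightarrow> ('v \<Rightarrow> 'v) \<Rightarrow> 'v set \<Rightarrow> 'v set \<Rightarrow> bool" where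
  "irreducible_quotient smul D W U \<longleftrightarrow>
     stable_subspace smul D U \<and> stable_subspace smul D W \<and> U \<subset> W \<and>
     (\<forall>X. stable_subspace smul D X \<and> U \<subseteq> X \<and> X \<subseteq> W \<longrightarrow> X = U \<or> X = W)"

definition quotient_norm ::
    "('k::field_char_0 \<Rightarrow> real) \<Rightarrow> ('k \<Rightarrow> 'v::ab_group_add \<Rightarrow> 'v) \<Rightarrow> 'v set \<Rightarrow> 'v set \<Rightarrow>
     ('v set \<Rightarrow> real) \<Rightarrow> bool" where
  "quotient_norm av smul W U N \<longleftrightarrow>
     (\<forall>x\<in>W. 0 \<le> N (vcoset U x)) \<and>
     (\<forall>x\<in>W. N (vcoset U x) = 0 \<longleftrightarrow> vcoset U x = vcoset U 0) \<and>
     (\<forall>x\<in>W. \<forall>y\<in>W. N (vcoset U (x + y)) \<le> max (N (vcoset U x)) (N (vcoset U y))) \<and>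
     (\<forall>c. \<forall>x\<in>W. N (vcoset U (smul c x)) = av c * N (vcoset U x))"

text \<open>The spectral norm does not depend on the chosen norm.\<close>

definition quotient_radius ::
    "('k::field_char_0 \<Rightarrow> real) \<Rightarrow> ('k \<Rightarrow> 'v::ab_group_add \<Rightarrow> 'v) \<Rightarrow> ('v \<Rightarrow> 'v) \<Rightarrow>
     'v set \<Rightarrow> 'v set \<Rightarrow> real" where
  "quotient_radius av smul D W U =
     (let N = (SOME N. quotient_norm av smul W U N)
      in omega av / sp_norm (W - U) (\<lambda>x. N (vcoset U x)) D)"

definition composition_series ::
    "('k::field_char_0 \<Rightarrow> 'v::ab_group_add \<Rightarrow> 'v) \<Rightarrow> ('v \<Rightarrow> 'v) \<Rightarrow> 'v set \<Rightarrow> 'v set list \<Rightarrow> bool" where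
  "composition_series smul D W Ws \<longleftrightarrow>
     Ws \<noteq> [] \<and> hd Ws = {0} \<and> last Ws = W \<and>
     (\<forall>i. Suc i < length Ws \<longrightarrow> irreducible_quotient smul D (Ws ! Suc i) (Ws ! i))"

text \<open>By the Jordan--Hoelder theorem the following does not depend on the chosen series.
  The difference of dimensions is the dimension of the factor.\<close>

definition radius_mult ::
    "('k::field_char_0 \<Rightarrow> real) \<Rightarrow> ('k \<Rightarrow> 'v::ab_group_add \<Rightarrow> 'v) \<Rightarrow> ('v \<Rightarrow> 'v) \<Rightarrow>
     'v set \<Rightarrow> real \<Rightarrow> nat" where
  "radius_mult av smul D W r =
     (let Ws = (SOME Ws. composition_series smul D W Ws)
      in \<Sum>i<length Ws - 1.
           if r = quotient_radius av smul D (Ws ! Suc i) (Ws ! i)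
           then vector_space.dim smul (Ws ! Suc i) - vector_space.dim smul (Ws ! i) else 0)"

definition generic_radii ::
    "('k::field_char_0 \<Rightarrow> real) \<Rightarrow> ('k \<Rightarrow> 'v::ab_group_add \<Rightarrow> 'v) \<Rightarrow> ('v \<Rightarrow> 'v) \<Rightarrow>
     'v set \<Rightarrow> real set" where
  "generic_radii av smul D W = {r. radius_mult av smul D W r > 0}"

definition radius_part ::
    "('k::field_char_0 \<Rightarrow> real) \<Rightarrow> ('k \<Rightarrow> 'v::ab_group_add \<Rightarrow> 'v) \<Rightarrow> 'j set \<Rightarrow> ('j \<Rightarrow> 'v \<Rightarrow> 'v) \<Rightarrow>
     ('j \<Rightarrow> real) \<Rightarrow> 'v set" where
  "radius_part av smul J nabla r =
     (GREATEST X. module.subspace smul X \<and>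
        (\<forall>j\<in>J. nabla j ` X \<subseteq> X \<and> (\<forall>s\<in>generic_radii av smul (nabla j) X. s = r j)))"

section \<open>External direct sums of subspaces\<close>

definition direct_sum :: "'i set \<Rightarrow> ('i \<Rightarrow> 'v::ab_group_add set) \<Rightarrow> ('i \<Rightarrow> 'v) set" where
  "direct_sum I A =
     {f. (\<forall>i\<in>I. f i \<in> A i) \<and> (\<forall>i. i \<notin> I \<longrightarrow> f i = 0) \<and> finite {i. f i \<noteq> 0}}"

definition sum_map :: "('i \<Rightarrow> 'v::ab_group_add) \<Rightarrow> 'v" where
  "sum_map f = (\<Sum>i | f i \<noteq> 0. f i)"

text \<open>Isomorphisms of differential modules from a set \<open>M\<close> of families, with pointwise
  operations, onto the whole module \<open>'v\<close>.\<close>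

definition differential_module_iso ::
    "('k::field_char_0 \<Rightarrow> 'v::ab_group_add \<Rightarrow> 'v) \<Rightarrow> 'j set \<Rightarrow> ('j \<Rightarrow> 'v \<Rightarrow> 'v) \<Rightarrow>
     ('i \<Rightarrow> 'v) set \<Rightarrow> (('i \<Rightarrow> 'v) \<Rightarrow> 'v) \<Rightarrow> bool" where
  "differential_module_iso smul J nabla M h \<longleftrightarrow>
     (\<forall>f\<in>M. \<forall>g\<in>M. h (\<lambda>i. f i + g i) = h f + h g) \<and>
     (\<forall>c. \<forall>f\<in>M. h (\<lambda>i. smul c (f i)) = smul c (h f)) \<and>
     (\<forall>j\<in>J. \<forall>f\<in>M. h (\<lambda>i. nabla j (f i)) = nabla j (h f)) \<and>
     bij_betw h M UNIV"

end

theory Submission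
  imports Defs
begin

text \<open>
  Fix one derivation and let \<open>s\<close> be at least its spectral norm on the field. Call a vector \<open>s\<close>-slow if its
  iterates under \<open>D\<close> grow at most like \<open>s ^ n\<close>. Slow vectors form a submodule; slowness of functionals is
  defined in the same way, and the fast part is the common kernel of the slow functionals. The fast part \<open>G\<close>
  has no non-zero slow quotient, hence each of its vectors is a sum of terms \<open>a D\<^sup>i e\<close>, \<open>e\<close> in a basis, with
  all \<open>|a| l\<^sup>i\<close> arbitrarily small, for some \<open>l > s\<close>: otherwise the infimum of \<open>max |a| l\<^sup>i\<close> over all such
  expressions would be the norm of a slow quotient. For a slow functional \<open>\<phi>\<close> vanishing on \<open>G\<close>, integration
  by parts turns \<open>\<phi> \<otimes> a D\<^sup>i e\<close> into \<open>\<plusminus> D\<^sup>i (a \<phi>) \<otimes> e\<close> modulo commutators with \<open>D\<close>, and this is small.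
  So, by completeness, every linear map from the module modulo \<open>G\<close> to \<open>G\<close> is a commutator with \<open>D\<close>, and a
  linear projection onto \<open>G\<close> can be corrected to a horizontal one. Thus every module is the sum of its slow and
  fast parts, and the same statement for the dual module shows that the sum is direct. The parts are stable under
  every operator commuting with \<open>D\<close>, so splitting repeatedly gives the simultaneous decomposition.
\<close>

section \<open>Complete non-archimedean fields\<close>

text \<open>Level \<open>s\<close> stands for radius \<open>omega av / s\<close>. Slowness is
  compatible with scalars only for \<open>s\<close> at least the spectral norm of the derivation,
  because the iterates of \<open>D\<close> on \<open>c x\<close> involve the iterates of
  \<open>d\<close> on \<open>c\<close>. No radius is lost by this: a non-zero quotient never has a
  smaller spectral norm than the field. Fastness cannot be a lower growth bound on single vectors,
  as such a bound does not survive addition; hence the definition by functionals. The price is that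
  uniqueness of the splitting has no direct growth argument and goes through the dual. The delicate
  point of the contraction is uniformity: the seminorm must vanish for one \<open>l > s\<close>,
  while a quotient is slow only if it is so for all \<open>l > s\<close>. The kernels of the
  seminorms increase as \<open>l\<close> decreases to \<open>s\<close>, so in finite dimension they
  are constant near \<open>s\<close>, and the seminorms for all small \<open>l\<close> live on the
  same quotient. Characteristic 0 enters through the factorials: it makes the spectral norm of a
  non-zero derivation positive, so that levels and radii correspond bijectively.\<close>

context complete_nonarch_field
begin

lemma av_0 [simp]: "av 0 = 0"
  using av_eq_0_iff by blast

lemma av_1 [simp]: "av 1 = 1"
proof -
  have "av 1 * av 1 = av 1" using av_mult[of 1 1] by simp
  moreover have "av 1 \<noteq> 0" using av_eq_0_iff by simp
  ultimately show ?thesis by simp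
qed

lemma av_pos: "x \<noteq> 0 \<Longrightarrow> 0 < av x"
  using av_nonneg[of x] av_eq_0_iff[of x] by linarith

lemma av_minus [simp]: "av (- x) = av x"
proof -
  have "av (-1) * av (-1) = 1" using av_mult[of "-1" "-1"] by simp
  then have "av (-1) = 1"
    using av_nonneg[of "-1"] by (metis abs_of_nonneg power2_eq_square real_sqrt_abs real_sqrt_one)
  then show ?thesis using av_mult[of "-1" x] by simp
qed

lemma av_diff: "av (x - y) \<le> max (av x) (av y)"
  using av_ultra[of x "- y"] by simp

lemma av_add_le: "av x \<le> M \<Longrightarrow> av y \<le> M \<Longrightarrow> av (x + y) \<le> M"
  using av_ultra[of x y] by linarith

lemma av_diff_le: "av x \<le> M \<Longrightarrow> av y \<le> M \<Longrightarrow> av (x - y) \<le> M"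
  using av_diff[of x y] by linarith

lemma av_sum_le:
  assumes "0 \<le> M" "\<And>i. i \<in> A \<Longrightarrow> av (f i) \<le> M"
  shows "av (\<Sum>i\<in>A. f i) \<le> M"
  using assms
proof (induction A rule: infinite_finite_induct)
  case (insert i A)
  then show ?case by (simp add: av_add_le)
qed simp_all

lemma av_power: "av (x ^ n) = av x ^ n"
  by (induction n) (simp_all add: av_mult)

lemma av_inverse: "av (inverse x) = inverse (av x)"
proof (cases "x = 0")
  case False
  then have "av x * av (inverse x) = 1" using av_mult[of x "inverse x"] by simp
  then show ?thesis using False av_pos[of x] by (simp add: field_simps)
qed simp

lemma av_of_nat_le_1: "av (of_nat n) \<le> 1"
  by (induction n) (simp_all add: av_add_le)

lemma vanishing_if_av_le_small:
  assumes "\<And>n. av x \<le> M * (1 / 2) ^ n"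
  shows "x = 0"
proof -
  have "(\<lambda>n. M * (1 / 2) ^ n) \<longlonglongrightarrow> M * 0"
    by (intro tendsto_mult_left LIMSEQ_power_zero) simp
  then have "av x \<le> M * 0"
    by (rule Lim_bounded2) (use assms in auto)
  then show ?thesis using av_nonneg[of x] av_eq_0_iff[of x] by simp
qed

text \<open>By the ultrametric inequality a tail of increments is bounded by the bound for its first
  term, so the limit inherits the error estimate with the same constant \<open>M\<close>.\<close>

lemma geometric_sequence_converges:
  assumes step: "\<And>n. av (f (Suc n) - f n) \<le> M * (1 / 2) ^ n"
  shows "\<exists>L. \<forall>n. av (L - f n) \<le> M * (1 / 2) ^ n"
proof -
  interpret MS: Metric_space UNIV "\<lambda>x y. av (x - y)"
  proof
    show "av (x - y) = av (y - x)" for x y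
      using av_minus[of "x - y"] by simp
    show "av (x - z) \<le> av (x - y) + av (y - z)" for x y z
      using av_ultra[of "x - y" "y - z"] av_nonneg[of "x - y"] av_nonneg[of "y - z"] by simp
  qed (simp_all add: av_nonneg av_eq_0_iff)
  have M: "0 \<le> M" using order_trans[OF av_nonneg step[of 0]] by simp
  have tail: "av (f (n + k) - f n) \<le> M * (1 / 2) ^ n" for n k
  proof (induction k)
    case (Suc k)
    have "av (f (Suc (n + k)) - f (n + k)) \<le> M * (1 / 2) ^ n"
      by (rule order_trans[OF step]) (use M in \<open>auto intro!: mult_left_mono power_decreasing\<close>)
    from av_add_le[OF this Suc] show ?case by simp
  qed (use M in simp)
  have lim0: "(\<lambda>n. M * (1 / 2) ^ n) \<longlonglongrightarrow> 0"
    using tendsto_mult_left[OF LIMSEQ_power_zero[of "1 / 2 :: real"], of M] by simp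
  have "MS.MCauchy f"
    unfolding MS.MCauchy_def
  proof (intro conjI allI impI)
    fix e :: real assume "0 < e"
    then obtain N where N: "M * (1 / 2) ^ N < e"
      using order_tendstoD(2)[OF lim0, of e] by (auto simp: eventually_sequentially)
    have "av (f m - f n) < e" if "N \<le> m" "N \<le> n" for m n
    proof -
      have "av (f m - f N) \<le> M * (1 / 2) ^ N" "av (f n - f N) \<le> M * (1 / 2) ^ N"
        using tail[of N "m - N"] tail[of N "n - N"] that by simp_all
      from av_diff_le[OF this] show ?thesis using N by simp
    qed
    then show "\<exists>N. \<forall>n n'. N \<le> n \<longrightarrow> N \<le> n' \<longrightarrow> av (f n - f n') < e" by blast
  qed simp
  then obtain L where L: "limitin MS.mtopology f L sequentially"
    using av_complete unfolding MS.mcomplete_def by blast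
  have "av (L - f n) \<le> M * (1 / 2) ^ n" for n
  proof (rule field_le_epsilon)
    fix e :: real assume "0 < e"
    then obtain m where "m \<ge> n" "av (f m - L) < e"
      using L unfolding MS.limitin_metric eventually_sequentially
      by (metis nle_le)
    then have "av (f m - f n) \<le> M * (1 / 2) ^ n + e" "av (f m - L) \<le> M * (1 / 2) ^ n + e"
      using tail[of n "m - n"] M \<open>0 < e\<close> by (simp_all add: add_increasing)
    from av_diff_le[OF this] show "av (L - f n) \<le> M * (1 / 2) ^ n + e" by simp
  qed
  then show ?thesis by blast
qed

text \<open>If every positive integer is a unit the constant is 1. Otherwise only the multiples of
  the residue characteristic \<open>p\<close> contribute to |n!|: one factor |p| each, and then
  recursively \<open>fact (n div p)\<close>. The crude constant |p| is enough to show later that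
  non-zero derivations have positive spectral norm.\<close>

lemma av_fact_ge: "\<exists>c>0. \<forall>n. c ^ n \<le> av (fact n)"
proof (cases "\<exists>m>0. av (of_nat m) < 1")
  case False
  then have one: "av (of_nat m) = 1" if "m > 0" for m
    using av_of_nat_le_1[of m] that by (meson order_le_less)
  have "av (fact n) = 1" for n
  proof (induction n)
    case (Suc n)
    then show ?case using one[of "Suc n"] by (simp only: fact_Suc av_mult)
  qed simp
  then show ?thesis by (intro exI[of _ 1]) simp
next
  case True
  define p where "p = (LEAST m. m > 0 \<and> av (of_nat m) < 1)"
  have p: "p > 0" "av (of_nat p) < 1"
    using LeastI_ex[OF True] unfolding p_def by auto
  have least: "av (of_nat r) = 1" if "0 < r" "r < p" for r
  proof -
    have "\<not> (0 < r \<and> av (of_nat r) < 1)"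
      by (rule not_less_Least) (use that in \<open>simp add: p_def\<close>)
    then show ?thesis using that av_of_nat_le_1[of r] by linarith
  qed
  have p2: "2 \<le> p"
  proof (rule ccontr)
    assume "\<not> 2 \<le> p"
    then have "p = 1" using p(1) by linarith
    then show False using p(2) by simp
  qed
  define c where "c = av (of_nat p)"
  have c: "0 < c" "c < 1"
    using p av_pos[of "of_nat p"] by (simp_all add: c_def)
  \<comment> \<open>An integer not divisible by \<open>p\<close> differs from its remainder, a unit
    by minimality of \<open>p\<close>, by an element of absolute value less than 1.\<close>
  have unit: "av (of_nat k) = 1" if "\<not> p dvd k" for k
  proof (rule ccontr)
    assume "av (of_nat k) \<noteq> 1"
    then have lt: "av (of_nat k) < 1" using av_of_nat_le_1[of k] by simp
    have "(of_nat (k mod p) :: 'k) = of_nat k - of_nat p * of_nat (k div p)"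
      by (simp only: eq_diff_eq of_nat_mult[symmetric] of_nat_add[symmetric] mod_mult_div_eq)
    moreover have "av (of_nat p * of_nat (k div p)) < 1"
      using p(2) mult_left_le[OF av_of_nat_le_1[of "k div p"] av_nonneg[of "of_nat p"]]
      by (simp only: av_mult)
    ultimately have "av (of_nat (k mod p)) < 1"
      using lt av_diff[of "of_nat k" "of_nat p * of_nat (k div p)"] by (simp add: max_def split: if_splits)
    moreover have "0 < k mod p" "k mod p < p" using that p by (auto simp: dvd_eq_mod_eq_0)
    ultimately show False using least[of "k mod p"] by simp
  qed
  have rec: "av (fact n) = c ^ (n div p) * av (fact (n div p))" for n
  proof (induction n)
    case (Suc n)
    have f: "av (fact (Suc m)) = av (of_nat (Suc m)) * av (fact m)" for m
      by (simp only: fact_Suc av_mult)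
    show ?case
    proof (cases "p dvd Suc n")
      case True
      then have q: "Suc n div p = Suc (n div p)"
        by (simp add: div_Suc dvd_eq_mod_eq_0)
      have "Suc n = p * Suc (n div p)" using dvd_mult_div_cancel[OF True] by (simp only: q)
      then have "(of_nat (Suc n) :: 'k) = of_nat p * of_nat (Suc (n div p))"
        by (simp only: of_nat_mult)
      then have "av (of_nat (Suc n)) = c * av (of_nat (Suc (n div p)))"
        by (simp only: av_mult c_def)
      then show ?thesis using Suc by (simp only: f q) (simp add: mult_ac)
    next
      case False
      then have "Suc n div p = n div p" by (simp add: div_Suc dvd_eq_mod_eq_0)
      then show ?thesis using Suc unit[OF False] by (simp only: f)
    qed
  qed simp
  have "c ^ n \<le> av (fact n)" for n
  proof (induction n rule: less_induct)
    case (less n)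
    show ?case
    proof (cases "n = 0")
      case False
      let ?q = "n div p"
      have "?q < n" using False p2 by simp
      \<comment> \<open>As \<open>p\<close> is at least 2, the exponent \<open>?q\<close> from the
        multiples of \<open>p\<close> and the exponent \<open>?q\<close> from the induction
        hypothesis add up to at most \<open>n\<close>.\<close>
      have "p * ?q \<le> n" by simp
      moreover have "2 * ?q \<le> p * ?q" using p2 by (rule mult_right_mono) simp
      ultimately have "2 * ?q \<le> n" by linarith
      then have "c ^ n \<le> c ^ (2 * ?q)" using c by (intro power_decreasing) auto
      also have "\<dots> = c ^ ?q * c ^ ?q" by (simp add: mult_2 power_add)
      also have "\<dots> \<le> c ^ ?q * av (fact ?q)"
        using less[OF \<open>?q < n\<close>] c by (intro mult_left_mono) auto
      also have "\<dots> = av (fact n)" using rec[of n] by simp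
      finally show ?thesis .
    qed simp
  qed
  then show ?thesis using c by blast
qed

text \<open>In characteristic 0 a positive residue characteristic is a non-zero element of the
  field, so \<open>powr\<close> is not taken at 0.\<close>

lemma omega_pos: "0 < omega av"
  unfolding omega_def by (auto simp: av_eq_0_iff)

end

section \<open>Spectral norms\<close>

text \<open>The vectors of \<open>W\<close> on which \<open>N\<close> vanishes are those excluded from the supremum; they must
  be allowed in the hypothesis because \<open>T\<close> need not preserve the set of non-zero vectors.\<close>

lemma op_norm_bound:
  assumes S: "S = {x \<in> W. N x \<noteq> 0}" and nn: "\<And>x. x \<in> W \<Longrightarrow> 0 \<le> N x"
    and b: "\<And>x. x \<in> W \<Longrightarrow> N (T x) \<le> M * N x" and "x \<in> W"
  shows "N (T x) \<le> op_norm S N T * N x"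
\<comment> \<open>Such an \<open>x\<close> is outside the supremum; the a priori bound by
  \<open>M\<close> covers it.\<close>
proof (cases "N x = 0")
  case True
  then show ?thesis using b[OF \<open>x \<in> W\<close>] by simp
next
  case False
  have "bdd_above ((\<lambda>x. N (T x) / N x) ` S)"
  proof (rule bdd_aboveI2)
    fix y assume "y \<in> S"
    then show "N (T y) / N y \<le> M"
      using b[of y] nn[of y] by (auto simp: S divide_simps)
  qed
  then have "N (T x) / N x \<le> op_norm S N T"
    unfolding op_norm_def using False \<open>x \<in> W\<close> by (intro cSUP_upper) (auto simp: S)
  then show ?thesis using False nn[OF \<open>x \<in> W\<close>] by (simp add: divide_simps split: if_splits)
qed

lemma op_norm_le:
  assumes S: "S = {x \<in> W. N x \<noteq> 0}" "S \<noteq> {}" and nn: "\<And>x. x \<in> W \<Longrightarrow> 0 \<le> N x"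
    and b: "\<And>x. x \<in> W \<Longrightarrow> N (T x) \<le> M * N x"
  shows "op_norm S N T \<le> M"
  unfolding op_norm_def
proof (rule cSUP_least[OF S(2)])
  fix y assume "y \<in> S"
  then show "N (T y) / N y \<le> M"
    using b[of y] nn[of y] by (auto simp: S(1) divide_simps)
qed

lemma op_norm_nonneg:
  assumes S: "S = {x \<in> W. N x \<noteq> 0}" "S \<noteq> {}" and nn: "\<And>x. x \<in> W \<Longrightarrow> 0 \<le> N x"
    and b: "\<And>x. x \<in> W \<Longrightarrow> N (T x) \<le> M * N x" and T: "\<And>x. x \<in> W \<Longrightarrow> T x \<in> W"
  shows "0 \<le> op_norm S N T"
proof -
  obtain x where x: "x \<in> W" "N x \<noteq> 0" using S by auto
  have "0 \<le> op_norm S N T * N x"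
    using op_norm_bound[OF S(1) nn b x(1)] nn[OF T[OF x(1)]] by simp
  then show ?thesis using x nn[OF x(1)] by (simp add: zero_le_mult_iff)
qed

lemma funpow_closed: "(\<And>x. x \<in> W \<Longrightarrow> T x \<in> W) \<Longrightarrow> x \<in> W \<Longrightarrow> (T ^^ n) x \<in> W"
  by (induction n) auto

lemma funpow_bound:
  fixes N :: "'a \<Rightarrow> real"
  assumes T: "\<And>x. x \<in> W \<Longrightarrow> T x \<in> W" and b: "\<And>x. x \<in> W \<Longrightarrow> N (T x) \<le> M * N x"
    and "0 \<le> M" "x \<in> W"
  shows "N ((T ^^ n) x) \<le> M ^ n * N x"
proof (induction n)
  case (Suc n)
  have "N (T ((T ^^ n) x)) \<le> M * N ((T ^^ n) x)"
    using b funpow_closed[of W T, OF T] \<open>x \<in> W\<close> by blast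
  also have "\<dots> \<le> M * (M ^ n * N x)" using Suc \<open>0 \<le> M\<close> by (rule mult_left_mono)
  finally show ?case by (simp add: mult_ac)
qed simp

text \<open>One power \<open>T ^^ i\<close> with operator norm at most \<open>l ^ i\<close> controls
  all iterates: divide \<open>n\<close> by \<open>i\<close> and let the constant absorb the
  remaining fewer than \<open>i\<close> applications.\<close>

lemma sp_norm_lessD:
  assumes S: "S = {x \<in> W. N x \<noteq> 0}" "S \<noteq> {}" and nn: "\<And>x. x \<in> W \<Longrightarrow> 0 \<le> N x"
    and b: "\<And>x. x \<in> W \<Longrightarrow> N (T x) \<le> M * N x" and T: "\<And>x. x \<in> W \<Longrightarrow> T x \<in> W"
    and lt: "sp_norm S N T < l"
  shows "\<exists>C>0. \<forall>n. \<forall>x\<in>W. N ((T ^^ n) x) \<le> C * l ^ n * N x"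
proof -
  define K where "K = max M 1"
  have K: "1 \<le> K" by (simp add: K_def)
  have bK: "N (T x) \<le> K * N x" if "x \<in> W" for x
    using b[OF that] mult_right_mono[OF _ nn[OF that], of M K] by (simp add: K_def)
  note pow = funpow_bound[of W T N K, OF T bK] 
  have powK: "N ((T ^^ n) x) \<le> K ^ n * N x" if "x \<in> W" for n x
    using pow[OF _ _ _ that] K by simp
  obtain i where i: "1 \<le> i" "op_norm S N (T ^^ i) powr (1 / real i) < l"
    using lt unfolding sp_norm_def
    by (subst (asm) cINF_less_iff) (auto intro!: bdd_belowI[of _ 0])
  let ?a = "op_norm S N (T ^^ i)"
  have a0: "0 \<le> ?a"
    by (rule op_norm_nonneg[OF S nn powK]) (auto intro: funpow_closed[of W T, OF T])
  have l: "0 < l" using i(2) powr_ge_zero[of ?a "1 / real i"] by linarith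
  have "?a \<le> l ^ i"
  proof (cases "?a = 0")
    case False
    then have "?a = (?a powr (1 / real i)) ^ i"
      using a0 i(1) by (simp add: powr_realpow[symmetric] powr_powr)
    also have "\<dots> \<le> l ^ i" using i(2) by (intro power_mono) auto
    finally show ?thesis .
  qed (use l in simp)
  then have bi: "N ((T ^^ i) x) \<le> l ^ i * N x" if "x \<in> W" for x
    using op_norm_bound[OF S(1) nn powK that, of i] nn[OF that]
    by (meson mult_right_mono order_trans)
  \<comment> \<open>This bounds \<open>K ^ r / l ^ r\<close> for all remainders \<open>r < i\<close>
    at once: the denominator is at most \<open>l ^ r\<close> whether \<open>l\<close> is below or
    above 1.\<close>
  define C where "C = K ^ i / min 1 (l ^ i)"
  have m0: "0 < min 1 (l ^ i)" using l by simp
  have C: "0 < C" using K l by (simp add: C_def)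
  have "N ((T ^^ n) x) \<le> C * l ^ n * N x" if x: "x \<in> W" for n x
  proof -
    let ?q = "n div i" and ?r = "n mod i"
    have "(T ^^ n) x = ((T ^^ i) ^^ ?q) ((T ^^ ?r) x)"
      by (simp add: funpow_mult flip: funpow_add[THEN fun_cong, unfolded comp_def])
    also have "N \<dots> \<le> (l ^ i) ^ ?q * N ((T ^^ ?r) x)"
      by (rule funpow_bound[of W]) (use bi l x funpow_closed[of W T, OF T] in auto)
    also have "\<dots> \<le> (l ^ i) ^ ?q * (K ^ ?r * N x)"
      using powK[OF x] l by (intro mult_left_mono) auto
    also have "\<dots> \<le> (l ^ i) ^ ?q * (C * l ^ ?r * N x)"
    proof -
      have r: "?r < i" using i(1) by simp
      have "min 1 (l ^ i) \<le> l ^ ?r"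
      proof (cases "l \<le> 1")
        case True
        then have "l ^ i \<le> l ^ ?r" using r l by (intro power_decreasing) auto
        then show ?thesis by simp
      qed (simp add: one_le_power min.coboundedI1)
      moreover have "K ^ ?r \<le> K ^ i" using r K by (intro power_increasing) auto
      moreover have "K ^ i = C * min 1 (l ^ i)" using m0 by (simp add: C_def)
      ultimately have "K ^ ?r \<le> C * l ^ ?r"
        using C by (metis mult_left_mono less_imp_le order_trans)
      then show ?thesis using l nn[OF x] by (intro mult_left_mono mult_right_mono) auto
    qed
    also have "\<dots> = C * l ^ n * N x"
    proof -
      have "l ^ n = l ^ (i * ?q + ?r)" by simp
      then show ?thesis by (simp only: power_add power_mult mult_ac)
    qed
    finally show ?thesis .
  qed
  then show ?thesis using C by blast
qed

text \<open>Take \<open>n\<close>-th roots: the root of the constant, enlarged to be positive, tends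
  to 1.\<close>

lemma sp_norm_leI:
  assumes S: "S = {x \<in> W. N x \<noteq> 0}" "S \<noteq> {}" and nn: "\<And>x. x \<in> W \<Longrightarrow> 0 \<le> N x"
    and T: "\<And>x. x \<in> W \<Longrightarrow> T x \<in> W" and l: "0 < l"
    and b: "\<And>n x. x \<in> W \<Longrightarrow> N ((T ^^ n) x) \<le> C * l ^ n * N x"
  shows "sp_norm S N T \<le> l"
proof -
  define C' where "C' = max C 1"
  have C': "0 < C'" by (simp add: C'_def)
  have b': "N ((T ^^ n) x) \<le> C' * l ^ n * N x" if "x \<in> W" for n x
  proof -
    have "C * l ^ n * N x \<le> C' * l ^ n * N x"
      using nn[OF that] l by (intro mult_right_mono) (auto simp: C'_def)
    then show ?thesis using b[OF that, of n] by linarith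
  qed
  have "sp_norm S N T \<le> C' powr (1 / real (Suc n)) * l" for n
  proof -
    let ?a = "op_norm S N (T ^^ Suc n)"
    have "?a \<le> C' * l ^ Suc n" by (rule op_norm_le[OF S nn b'])
    moreover have "0 \<le> ?a"
      by (rule op_norm_nonneg[OF S nn b']) (auto intro!: T funpow_closed[of W T, OF T])
    ultimately have "?a powr (1 / real (Suc n)) \<le> (C' * l ^ Suc n) powr (1 / real (Suc n))"
      by (intro powr_mono2) auto
    also have "\<dots> = C' powr (1 / real (Suc n)) * (l ^ Suc n) powr (1 / real (Suc n))"
      by (rule powr_mult)
    also have "(l ^ Suc n) powr (1 / real (Suc n)) = l"
      using l by (simp only: powr_realpow[symmetric] powr_powr) simp
    finally have "?a powr (1 / real (Suc n)) \<le> C' powr (1 / real (Suc n)) * l" .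
    moreover have "sp_norm S N T \<le> ?a powr (1 / real (Suc n))"
      unfolding sp_norm_def by (rule cINF_lower) (auto intro!: bdd_belowI[of _ 0])
    ultimately show ?thesis by linarith
  qed
  moreover have "(\<lambda>n. C' powr (1 / real (Suc n)) * l) \<longlonglongrightarrow> C' powr 0 * l"
    using C' by (intro tendsto_intros LIMSEQ_Suc[OF lim_1_over_n]) auto
  ultimately show ?thesis
    using C' by (intro Lim_bounded2[of _ l]) auto
qed

section \<open>Bounded derivations\<close>

locale complete_differential_field =
  complete_nonarch_field av + bounded_derivation av d for av :: "'k::field_char_0 \<Rightarrow> real" and d
begin

abbreviation sp :: real where "sp \<equiv> sp_norm (UNIV - {0}) av d"

lemma d_0 [simp]: "d 0 = 0"
  using d_add[of 0 0] by simp

lemma d_minus: "d (- x) = - d x"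
  using d_add[of x "- x"] by (simp add: eq_neg_iff_add_eq_0 add.commute)

lemma d_diff: "d (x - y) = d x - d y"
  using d_add[of x "- y"] by (simp add: d_minus)

lemma d_bound: "\<exists>M>0. \<forall>x. av (d x) \<le> M * av x"
proof -
  obtain M where M: "\<And>x. x \<noteq> 0 \<Longrightarrow> av (d x) / av x \<le> M"
    using d_bounded unfolding bdd_above_def by auto
  have "av (d x) \<le> max M 1 * av x" for x
  proof (cases "x = 0")
    case False
    have "av (d x) \<le> M * av x" using M[OF False] av_pos[OF False] by (simp add: divide_simps)
    also have "\<dots> \<le> max M 1 * av x" by (intro mult_right_mono av_nonneg) simp
    finally show ?thesis .
  qed simp
  then show ?thesis by (intro exI[of _ "max M 1"]) auto
qed

lemma nonzero_eq: "UNIV - {0} = {x \<in> UNIV. av x \<noteq> 0}"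
  by (auto simp: av_eq_0_iff)

lemma sp_nonneg: "0 \<le> sp"
  unfolding sp_norm_def by (rule cINF_greatest) auto

lemma d_funpow_bound: "sp < l \<Longrightarrow> \<exists>C>0. \<forall>n x. av ((d ^^ n) x) \<le> C * l ^ n * av x"
proof -
  assume l: "sp < l"
  obtain M where "\<And>x. av (d x) \<le> M * av x" using d_bound by blast
  moreover have "UNIV - {0::'k} \<noteq> {}" using one_neq_zero by blast
  ultimately show ?thesis
    using sp_norm_lessD[OF nonzero_eq _ av_nonneg _ UNIV_I l, of M] by simp
qed

text \<open>Taking commutators with multiplication by \<open>x\<close> lowers the order of a differential operator:
  \<open>n\<close> commutators turn \<open>d ^^ n\<close> into multiplication by \<open>n! (d x)\<^sup>n\<close>.\<close>

definition mult_comm :: "'k \<Rightarrow> ('k \<Rightarrow> 'k) \<Rightarrow> 'k \<Rightarrow> 'k" where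
  "mult_comm x P c = P (x * c) - x * P c"

text \<open>The commutator of \<open>d\<close> with \<open>x\<close> is multiplication by
  \<open>d x\<close>, which commutes with \<open>x\<close>. So in the Leibniz expansion of iterated
  commutators of a composite with \<open>d\<close> only two terms survive.\<close>

lemma mult_comm_funpow_d_comp:
  "(mult_comm x ^^ Suc k) (\<lambda>c. d (P c)) c =
    of_nat (Suc k) * (d x * (mult_comm x ^^ k) P c) + d ((mult_comm x ^^ Suc k) P c)"
proof (induction k arbitrary: c)
  case 0
  show ?case by (simp add: mult_comm_def d_diff d_mult algebra_simps)
next
  case (Suc k)
  have "(mult_comm x ^^ Suc (Suc k)) (\<lambda>c. d (P c)) c =
      mult_comm x ((mult_comm x ^^ Suc k) (\<lambda>c. d (P c))) c" by simp
  also have "\<dots> = of_nat (Suc k) * (d x * (mult_comm x ^^ Suc k) P c)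
      + (d ((mult_comm x ^^ Suc k) P (x * c)) - x * d ((mult_comm x ^^ Suc k) P c))"
    unfolding mult_comm_def[of x "(mult_comm x ^^ Suc k) (\<lambda>c. d (P c))"] Suc
    by (simp add: mult_comm_def[of x "(mult_comm x ^^ k) P"] algebra_simps)
  also have "d ((mult_comm x ^^ Suc k) P (x * c)) - x * d ((mult_comm x ^^ Suc k) P c) =
      d x * (mult_comm x ^^ Suc k) P c + d ((mult_comm x ^^ Suc (Suc k)) P c)"
    by (simp add: mult_comm_def[of x "mult_comm x ((mult_comm x ^^ k) P)"] d_diff d_mult)
  finally show ?case by (simp add: algebra_simps)
qed

text \<open>The second conjunct is what makes the term with an outer \<open>d\<close> vanish in the
  inductive step for the first.\<close>

lemma mult_comm_funpow_d:
  "(mult_comm x ^^ n) (d ^^ n) c = fact n * d x ^ n * c \<and> (mult_comm x ^^ Suc n) (d ^^ n) c = 0"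
proof (induction n arbitrary: c)
  case 0
  show ?case by (simp add: mult_comm_def)
next
  case (Suc n)
  have e: "d ^^ Suc n = (\<lambda>c. d ((d ^^ n) c))" by (simp add: comp_def)
  have z: "(mult_comm x ^^ Suc n) (d ^^ n) = (\<lambda>_. 0)" using Suc by blast
  have z': "(mult_comm x ^^ Suc (Suc n)) (d ^^ n) = (\<lambda>_. 0)"
  proof -
    have "(mult_comm x ^^ Suc (Suc n)) (d ^^ n) = mult_comm x (\<lambda>_. 0)"
      unfolding z[symmetric] by simp
    then show ?thesis by (simp add: mult_comm_def fun_eq_iff)
  qed
  show ?case
    unfolding e mult_comm_funpow_d_comp z z' using Suc[of c] by (simp add: algebra_simps)
qed

lemma mult_comm_funpow_bound:
  assumes "\<And>c. av (P c) \<le> M * av c"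
  shows "av ((mult_comm x ^^ n) P c) \<le> av x ^ n * M * av c"
proof (induction n arbitrary: c)
  case (Suc n)
  show ?case
    using av_diff_le[of "(mult_comm x ^^ n) P (x * c)" "av x ^ Suc n * M * av c" "x * (mult_comm x ^^ n) P c"]
      Suc[of "x * c"] mult_left_mono[OF Suc[of c] av_nonneg[of x]]
    by (simp add: mult_comm_def[of x "(mult_comm x ^^ n) P"] av_mult mult_ac)
qed (use assms in simp)

text \<open>If the spectral norm were 0, the iterates of \<open>d\<close> would decay faster than
  any geometric sequence. Taking \<open>n\<close> commutators with \<open>x\<close> costs only a
  factor |x|^n, yet produces n! (d x)^n, which decays at most geometrically.\<close>

lemma sp_pos:
  assumes "d x \<noteq> 0"
  shows "0 < sp"
proof (rule ccontr)
  assume "\<not> 0 < sp"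
  then have sp0: "sp = 0" using sp_nonneg by simp
  have x: "0 < av x" "0 < av (d x)" using assms by (auto intro!: av_pos)
  obtain c where c: "c > 0" "\<And>n. c ^ n \<le> av (fact n)" using av_fact_ge by blast
  \<comment> \<open>\<open>b\<close> bounds from below the \<open>n\<close>-th root of |n! (d x)^n|
    / |x|^n, so growth of \<open>d ^^ n\<close> like powers of \<open>b / 2\<close> is a
    contradiction.\<close>
  define b where "b = c * (av (d x) / av x)"
  have b: "0 < b" using c x by (simp add: b_def)
  obtain C where C: "\<And>n y. av ((d ^^ n) y) \<le> C * (b / 2) ^ n * av y"
    using d_funpow_bound[of "b / 2"] sp0 b by auto
  have "2 ^ n \<le> C" for n
  proof -
    have "c ^ n * av (d x) ^ n \<le> av (fact n) * av (d x) ^ n"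
      using c x by (intro mult_right_mono) auto
    also have "\<dots> \<le> av x ^ n * (C * (b / 2) ^ n)"
      using mult_comm_funpow_bound[where P = "d ^^ n" and M = "C * (b / 2) ^ n" and x = x and n = n and c = 1] C mult_comm_funpow_d[where x = x and n = n and c = 1]
      by (simp add: av_mult av_power)
    finally have "b ^ n \<le> C * (b / 2) ^ n"
      using x by (simp add: b_def power_mult_distrib power_divide divide_simps mult_ac)
    then show ?thesis using b by (simp add: power_divide divide_simps)
  qed
  moreover obtain n where "C < 2 ^ n" using real_arch_pow[of 2 C] by auto
  ultimately show False using leD by blast
qed

end

section \<open>Linear functionals and ultrametric seminorms\<close>

definition functional :: "('k::field \<Rightarrow> 'v::ab_group_add \<Rightarrow> 'v) \<Rightarrow> ('v \<Rightarrow> 'k) \<Rightarrow> bool" where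
  "functional smul \<phi> \<longleftrightarrow> (\<forall>x y. \<phi> (x + y) = \<phi> x + \<phi> y) \<and> (\<forall>c x. \<phi> (smul c x) = c * \<phi> x)"

lemma functional_add: "functional smul \<phi> \<Longrightarrow> \<phi> (x + y) = \<phi> x + \<phi> y"
  by (simp add: functional_def)

lemma functional_scale: "functional smul \<phi> \<Longrightarrow> \<phi> (smul c x) = c * \<phi> x"
  by (simp add: functional_def)

lemma functional_0: "functional smul \<phi> \<Longrightarrow> \<phi> 0 = 0"
  using functional_add[of smul \<phi> 0 0] by (metis add_0 add_cancel_right_right)

lemma functional_diff: "functional smul \<phi> \<Longrightarrow> \<phi> (x - y) = \<phi> x - \<phi> y"
  using functional_add[of smul \<phi> "x - y" y] by simp

lemma functional_sum: "functional smul \<phi> \<Longrightarrow> \<phi> (\<Sum>i\<in>A. f i) = (\<Sum>i\<in>A. \<phi> (f i))"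
  by (induction A rule: infinite_finite_induct) (simp_all add: functional_0 functional_add)

lemma functional_add_fun: "functional smul \<phi> \<Longrightarrow> functional smul \<psi> \<Longrightarrow> functional smul (\<lambda>x. \<phi> x + \<psi> x)"
  by (simp add: functional_def algebra_simps)

lemma functional_scale_fun: "functional smul \<phi> \<Longrightarrow> functional smul (\<lambda>x. c * \<phi> x)"
  by (simp add: functional_def algebra_simps)

lemma functional_zero_fun: "functional smul (\<lambda>x. 0)"
  by (simp add: functional_def)

definition ultra_seminorm_on ::
    "('k \<Rightarrow> real) \<Rightarrow> ('k::field \<Rightarrow> 'v::ab_group_add \<Rightarrow> 'v) \<Rightarrow> 'v set \<Rightarrow> ('v \<Rightarrow> real) \<Rightarrow> bool" where
  "ultra_seminorm_on av smul W p \<longleftrightarrow> (\<forall>x\<in>W. 0 \<le> p x) \<and> (\<forall>x\<in>W. \<forall>y\<in>W. p (x + y) \<le> max (p x) (p y)) \<and>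
     (\<forall>c. \<forall>x\<in>W. p (smul c x) = av c * p x)"

locale valued_vector_space =
  complete_nonarch_field av + finite_dimensional_vector_space smul Basis
  for av :: "'k::field_char_0 \<Rightarrow> real" and smul :: "'k \<Rightarrow> 'v::ab_group_add \<Rightarrow> 'v" and Basis
begin

abbreviation "fnl \<equiv> functional smul"

text \<open>Coordinates on \<open>W\<close> modulo \<open>U\<close>: \<open>B\<close> is a basis of
  a complement and \<open>\<psi>\<close> its dual basis. Extending the basis once more to the whole
  space makes the coordinates functionals on all vectors, so quotients never need a type of their
  own.\<close>

lemma quotient_basis:
  assumes "subspace U" "subspace W" "U \<subseteq> W"
  obtains B \<psi> where "finite B" "B \<subseteq> W" "\<And>b. fnl (\<psi> b)" "\<And>b u. b \<in> B \<Longrightarrow> u \<in> U \<Longrightarrow> \<psi> b u = 0"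
    "\<And>x. x \<in> W \<Longrightarrow> x - (\<Sum>b\<in>B. smul (\<psi> b x) b) \<in> U"
    "\<And>b b'. b \<in> B \<Longrightarrow> b' \<in> B \<Longrightarrow> \<psi> b b' = (if b = b' then 1 else 0)"
proof -
  obtain BU where BU: "BU \<subseteq> U" "independent BU" "U \<subseteq> span BU"
    by (rule maximal_independent_subset)
  obtain BW where BW: "BU \<subseteq> BW" "BW \<subseteq> W" "independent BW" "W \<subseteq> span BW"
    using maximal_independent_subset_extend[OF subset_trans[OF BU(1) assms(3)] BU(2)] .
  obtain BV where BV: "BW \<subseteq> BV" "independent BV" "UNIV \<subseteq> span BV"
    using maximal_independent_subset_extend[OF subset_UNIV BW(3)] by metis
  define \<psi> where "\<psi> b x = representation BV x b" for b x
  have repU: "representation BV x = representation BU x" if "x \<in> U" for x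
    by (rule representation_extend[OF BV(2)]) (use BU BW BV that in auto)
  have repW: "representation BV x = representation BW x" if "x \<in> W" for x
    by (rule representation_extend[OF BV(2)]) (use BW BV that in auto)
  have finW: "finite BW" using BW(3) by (rule finiteI_independent)
  have sumU: "(\<Sum>b\<in>BU. smul (c b) b) \<in> U" for c
    using BU(1) assms(1) by (intro subspace_sum subspace_scale) auto
  show ?thesis
  proof (rule that[of "BW - BU" \<psi>])
    show "finite (BW - BU)" using finW by simp
    show "BW - BU \<subseteq> W" using BW by blast
    show "fnl (\<psi> b)" for b
    proof -
      have "v \<in> span BV" for v using BV(3) by blast
      then show ?thesis
        unfolding functional_def \<psi>_def
        using representation_add[OF BV(2)] representation_scale[OF BV(2)] by simp
    qed
    show "\<psi> b u = 0" if "b \<in> BW - BU" "u \<in> U" for b u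
      using that(1) representation_ne_zero[of BU u b] unfolding \<psi>_def repU[OF that(2)] by blast
    show "x - (\<Sum>b\<in>BW - BU. smul (\<psi> b x) b) \<in> U" if "x \<in> W" for x
    proof -
      have "x = (\<Sum>b\<in>BW. smul (\<psi> b x) b)"
        unfolding \<psi>_def repW[OF that]
        using sum_representation_eq[OF BW(3) _ finW subset_refl, of x] BW(4) that
        by (simp add: subset_iff)
      also have "\<dots> = (\<Sum>b\<in>BW - BU. smul (\<psi> b x) b) + (\<Sum>b\<in>BU. smul (\<psi> b x) b)"
        using BW(1) finW by (rule sum.subset_diff)
      finally have "x - (\<Sum>b\<in>BW - BU. smul (\<psi> b x) b) = (\<Sum>b\<in>BU. smul (\<psi> b x) b)"
        by (metis add_diff_cancel_left')
      then show ?thesis using sumU[of "\<lambda>b. \<psi> b x"] by (simp only:)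
    qed
    show "\<psi> b b' = (if b = b' then 1 else 0)" if "b \<in> BW - BU" "b' \<in> BW - BU" for b b'
    proof -
      have "b' \<in> BV" using that BV(1) by blast
      then show ?thesis unfolding \<psi>_def by (simp add: representation_basis[OF BV(2)])
    qed
  qed
qed

lemma separating_functional:
  assumes "subspace U" "x \<notin> U"
  obtains \<phi> where "fnl \<phi>" "\<And>u. u \<in> U \<Longrightarrow> \<phi> u = 0" "\<phi> x = 1"
proof -
  obtain B \<psi> where B: "finite B" "B \<subseteq> UNIV" "\<And>b. fnl (\<psi> b)"
    "\<And>b u. b \<in> B \<Longrightarrow> u \<in> U \<Longrightarrow> \<psi> b u = 0"
    "\<And>x. x \<in> UNIV \<Longrightarrow> x - (\<Sum>b\<in>B. smul (\<psi> b x) b) \<in> U"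
    "\<And>b b'. b \<in> B \<Longrightarrow> b' \<in> B \<Longrightarrow> \<psi> b b' = (if b = b' then 1 else 0)"
    by (rule quotient_basis[OF assms(1) subspace_UNIV subset_UNIV]) (rule that)
  have "\<exists>b\<in>B. \<psi> b x \<noteq> 0"
  proof (rule ccontr)
    assume "\<not> ?thesis"
    then have "(\<Sum>b\<in>B. smul (\<psi> b x) b) = 0" by (intro sum.neutral) simp
    then show False using B(5)[of x] assms(2) by simp
  qed
  then obtain b where b: "b \<in> B" "\<psi> b x \<noteq> 0" by blast
  show ?thesis
    by (rule that[of "\<lambda>y. inverse (\<psi> b x) * \<psi> b y"])
      (use b B(4) functional_scale_fun[OF B(3)] in auto)
qed

lemma subspace_kernel: "subspace W \<Longrightarrow> fnl \<phi> \<Longrightarrow> subspace {x \<in> W. \<phi> x = 0}"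
  by (auto simp: subspace_def functional_add functional_scale functional_0)

lemma dim_less: "subspace X \<Longrightarrow> subspace Y \<Longrightarrow> X \<subset> Y \<Longrightarrow> dim X < dim Y"
  by (metis dim_psubset span_eq_iff)

text \<open>Induct on the dimension of \<open>W\<close>: a member of \<open>\<Phi>\<close> that is
  non-zero on \<open>W\<close> cuts it down to a hyperplane, and a multiple of this member repairs
  the remaining direction. This is what turns vanishing on the fast part back into slowness.\<close>

lemma double_annihilator:
  assumes "subspace W" "fnl \<phi>"
    and \<Phi>: "\<And>\<psi>. \<psi> \<in> \<Phi> \<Longrightarrow> fnl \<psi>" "(\<lambda>x. 0) \<in> \<Phi>" "\<And>\<psi> \<theta> c. \<psi> \<in> \<Phi> \<Longrightarrow> \<theta> \<in> \<Phi> \<Longrightarrow> (\<lambda>x. \<psi> x + c * \<theta> x) \<in> \<Phi>"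
    and kills: "\<And>x. x \<in> W \<Longrightarrow> (\<And>\<psi>. \<psi> \<in> \<Phi> \<Longrightarrow> \<psi> x = 0) \<Longrightarrow> \<phi> x = 0"
  shows "\<exists>\<psi>\<in>\<Phi>. \<forall>x\<in>W. \<phi> x = \<psi> x"
  using assms(1) kills
proof (induction "dim W" arbitrary: W rule: less_induct)
  case less
  show ?case
  proof (cases "\<exists>\<psi>\<in>\<Phi>. \<exists>x\<in>W. \<psi> x \<noteq> 0")
    case False
    then have "\<forall>x\<in>W. \<phi> x = 0" using less.prems(2) by blast
    then show ?thesis using \<Phi>(2) by (intro bexI[of _ "\<lambda>x. 0"]) auto
  next
    case True
    then obtain \<theta> x where \<theta>: "\<theta> \<in> \<Phi>" "x \<in> W" "\<theta> x \<noteq> 0" by blast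
    let ?W = "{y \<in> W. \<theta> y = 0}"
    have sub: "subspace ?W" using less.prems(1) \<Phi>(1)[OF \<theta>(1)] by (rule subspace_kernel)
    have "dim ?W < dim W" using \<theta> by (intro dim_less sub less.prems(1)) auto
    moreover have "\<phi> y = 0" if "y \<in> ?W" "\<And>\<psi>. \<psi> \<in> \<Phi> \<Longrightarrow> \<psi> y = 0" for y
      using less.prems(2) that by blast
    ultimately obtain \<psi> where \<psi>: "\<psi> \<in> \<Phi>" "\<And>y. y \<in> ?W \<Longrightarrow> \<phi> y = \<psi> y"
      using less.hyps[OF _ sub] by blast
    define c where "c = (\<phi> x - \<psi> x) / \<theta> x"
    have "\<phi> y = \<psi> y + c * \<theta> y" if "y \<in> W" for y
    proof -
      let ?z = "y - smul (\<theta> y / \<theta> x) x"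
      have "?z \<in> ?W"
        using that \<theta> less.prems(1) \<Phi>(1)[OF \<theta>(1)]
        by (auto simp: functional_diff functional_scale intro!: subspace_diff subspace_scale)
      then have "\<phi> ?z = \<psi> ?z" by (rule \<psi>)
      then show ?thesis using \<Phi>(1)[OF \<psi>(1)] assms(2) \<theta>(3)
        by (simp add: functional_diff functional_scale c_def field_simps)
    qed
    then show ?thesis
      by (intro bexI[of _ "\<lambda>y. \<psi> y + c * \<theta> y"] \<Phi>(3)[OF \<psi>(1) \<theta>(1)]) auto
  qed
qed

lemma seminorm_0: "ultra_seminorm_on av smul W p \<Longrightarrow> x \<in> W \<Longrightarrow> p 0 = 0"
  unfolding ultra_seminorm_on_def by (metis av_0 mult_zero_left scale_zero_left)

lemma seminorm_diff:
  assumes "ultra_seminorm_on av smul W p" "subspace W" "x \<in> W" "y \<in> W"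
  shows "p (x - y) \<le> max (p x) (p y)"
proof -
  have "smul (-1) y \<in> W" "p (smul (-1) y) = p y"
    using assms(1,4) subspace_scale[OF assms(2,4), of "-1"] av_minus[of 1] av_1
    unfolding ultra_seminorm_on_def by (simp_all del: scale_minus_left)
  moreover have "x - y = x + smul (-1) y" by simp
  ultimately show ?thesis using assms unfolding ultra_seminorm_on_def by metis
qed

lemma seminorm_sum_le:
  assumes "ultra_seminorm_on av smul W p" "subspace W" "0 \<le> M" "\<And>i. i \<in> A \<Longrightarrow> f i \<in> W"
    "\<And>i. i \<in> A \<Longrightarrow> p (f i) \<le> M"
  shows "p (\<Sum>i\<in>A. f i) \<le> M"
  using assms(4,5)
proof (induction A rule: infinite_finite_induct)
  case (insert i A)
  then have "(\<Sum>i\<in>A. f i) \<in> W" using assms(2) by (intro subspace_sum) auto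
  then have "p (f i + (\<Sum>i\<in>A. f i)) \<le> max (p (f i)) (p (\<Sum>i\<in>A. f i))"
    using assms(1) insert.prems(1)[of i] unfolding ultra_seminorm_on_def by blast
  also have "\<dots> \<le> M" using insert by auto
  finally show ?case using insert.hyps by simp
qed (use assms(2,3) seminorm_0[OF assms(1) subspace_0] in auto)

lemma functional_seminorm: "fnl \<phi> \<Longrightarrow> ultra_seminorm_on av smul W (\<lambda>x. av (\<phi> x))"
  by (simp add: ultra_seminorm_on_def av_nonneg functional_add functional_scale av_ultra av_mult)

lemma subspace_seminorm_kernel:
  assumes "ultra_seminorm_on av smul W p" "subspace W"
  shows "subspace {x \<in> W. p x = 0}"
proof -
  have "p (x + y) = 0" if "x \<in> W" "y \<in> W" "p x = 0" "p y = 0" for x y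
  proof -
    have "p (x + y) \<le> max (p x) (p y)" "0 \<le> p (x + y)"
      using that assms subspace_add[OF assms(2)] unfolding ultra_seminorm_on_def by blast+
    then show ?thesis using that by simp
  qed
  then show ?thesis
    using assms seminorm_0[OF assms(1) subspace_0[OF assms(2)]]
    by (auto simp: subspace_def ultra_seminorm_on_def)
qed

text \<open>Completeness shows that the hyperplane \<open>\<phi> = 0\<close> is closed.\<close>

lemma functional_bounded_by_seminorm:
  assumes "ultra_seminorm_on av smul W p" "subspace W" "fnl \<phi>" "\<And>x. x \<in> W \<Longrightarrow> p x = 0 \<Longrightarrow> \<phi> x = 0"
  shows "\<exists>C>0. \<forall>x\<in>W. av (\<phi> x) \<le> C * p x"
  using assms
proof (induction "dim W" arbitrary: W \<phi> rule: less_induct)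
  case less
  note p = less.prems(1) and W = less.prems(2) and \<phi> = less.prems(3) and ker = less.prems(4)
  have p0: "0 \<le> p x" if "x \<in> W" for x using p that unfolding ultra_seminorm_on_def by blast
  have psc: "p (smul c x) = av c * p x" if "x \<in> W" for c x
    using p that unfolding ultra_seminorm_on_def by blast
  show ?case
  proof (cases "\<exists>x\<in>W. \<phi> x \<noteq> 0")
    case False
    then show ?thesis using p0 by (intro exI[of _ 1]) auto
  next
    case True
    then obtain x1 where x1: "x1 \<in> W" "\<phi> x1 \<noteq> 0" by blast
    define x0 where "x0 = smul (inverse (\<phi> x1)) x1"
    have x0: "x0 \<in> W" "\<phi> x0 = 1"
      using x1 W \<phi> by (auto simp: x0_def functional_scale subspace_scale)
    define H where "H = {y \<in> W. \<phi> y = 0}"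
    have HW: "H \<subseteq> W" by (auto simp: H_def)
    have H: "subspace H" unfolding H_def using W \<phi> by (rule subspace_kernel)
    have "x0 \<notin> H" using x0 by (simp add: H_def)
    then have dimH: "dim H < dim W" using x0(1) HW by (intro dim_less H W) blast
    have pH: "ultra_seminorm_on av smul H p" using p HW unfolding ultra_seminorm_on_def by blast
    \<comment> \<open>The core: \<open>x0\<close> has positive \<open>p\<close>-distance from the
      hyperplane \<open>H\<close>. Otherwise some sequence in \<open>H\<close> approaches
      it.\<close>
    have "\<exists>n::nat. \<forall>h\<in>H. (1 / 2) ^ n \<le> p (x0 - h)"
    proof (rule ccontr)
      assume "\<not> ?thesis"
      then have "\<forall>n::nat. \<exists>h\<in>H. p (x0 - h) < (1 / 2) ^ n" by (simp add: not_le)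
      then have "\<forall>n::nat. \<exists>h. h \<in> H \<and> p (x0 - h) < (1 / 2) ^ n" by blast
      from choice[OF this] obtain h
        where h: "\<And>n::nat. h n \<in> H" "\<And>n::nat. p (x0 - h n) < (1 / 2) ^ n" by blast
      let ?K = "{y \<in> H. p y = 0}"
      obtain B \<psi> where B: "finite B" "B \<subseteq> H" "\<And>b. fnl (\<psi> b)" "\<And>b u. b \<in> B \<Longrightarrow> u \<in> ?K \<Longrightarrow> \<psi> b u = 0"
        "\<And>x. x \<in> H \<Longrightarrow> x - (\<Sum>b\<in>B. smul (\<psi> b x) b) \<in> ?K"
        "\<And>b b'. b \<in> B \<Longrightarrow> b' \<in> B \<Longrightarrow> \<psi> b b' = (if b = b' then 1 else 0)"
        by (rule quotient_basis[of ?K H, OF subspace_seminorm_kernel[OF pH H] H Collect_restrict])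
          (rule that)
      \<comment> \<open>Modulo the kernel of \<open>p\<close> on \<open>H\<close> the coordinates
        are \<open>p\<close>-bounded by the induction hypothesis, so those of \<open>h n\<close>
        converge.\<close>
      have "\<exists>L. \<exists>C. \<forall>n. av (L - \<psi> b (h n)) \<le> C * (1 / 2) ^ n" if b: "b \<in> B" for b
      proof -
        obtain C where C: "0 < C" "\<And>x. x \<in> H \<Longrightarrow> av (\<psi> b x) \<le> C * p x"
          using less.hyps[OF dimH pH H B(3)[of b]] B(4)[OF b] by blast
        have "av (\<psi> b (h (Suc n)) - \<psi> b (h n)) \<le> C * (1 / 2) ^ n" for n
        proof -
          have "p (h (Suc n) - h n) = p ((x0 - h n) - (x0 - h (Suc n)))" by simp
          also have "\<dots> \<le> max (p (x0 - h n)) (p (x0 - h (Suc n)))"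
            using x0 h(1) HW by (intro seminorm_diff[OF p W] subspace_diff W) auto
          also have "\<dots> \<le> (1 / 2) ^ n"
            using h(2)[of n] less_le_trans[OF h(2)[of "Suc n"] power_decreasing[of n "Suc n"]] by simp
          finally have "C * p (h (Suc n) - h n) \<le> C * (1 / 2) ^ n" using C(1) by simp
          moreover have "av (\<psi> b (h (Suc n) - h n)) \<le> C * p (h (Suc n) - h n)"
            using h(1) by (intro C subspace_diff H)
          ultimately show ?thesis using B(3)[of b] by (simp add: functional_diff)
        qed
        from geometric_sequence_converges[OF this] show ?thesis by blast
      qed
      then obtain L C where L: "\<And>b n. b \<in> B \<Longrightarrow> av (L b - \<psi> b (h n)) \<le> C b * (1 / 2) ^ n" by metis
      define g where "g = (\<Sum>b\<in>B. smul (L b) b)"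
      have g: "g \<in> H" unfolding g_def using B(2) by (intro subspace_sum subspace_scale H) auto
      define M where "M = Max (insert 1 ((\<lambda>b. C b * p b) ` B))"
      have M: "1 \<le> M" "\<And>b. b \<in> B \<Longrightarrow> C b * p b \<le> M" using B(1) by (auto simp: M_def)
      have bound: "p (x0 - g) \<le> M * (1 / 2) ^ n" for n
      proof -
        let ?q = "\<Sum>b\<in>B. smul (\<psi> b (h n)) b"
        have q: "?q \<in> H" using B(2) by (intro subspace_sum subspace_scale H) auto
        have "p (x0 - g) = p ((x0 - h n) + ((h n - ?q) + (?q - g)))" by simp
        also have "\<dots> \<le> max (p (x0 - h n)) (p ((h n - ?q) + (?q - g)))"
        proof -
          have "x0 - h n \<in> W" "h n - ?q + (?q - g) \<in> W"
            using x0 h(1)[of n] HW g q by (auto intro!: subspace_diff subspace_add W)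
          then show ?thesis using p unfolding ultra_seminorm_on_def by blast
        qed
        also have "\<dots> \<le> max (p (x0 - h n)) (max (p (h n - ?q)) (p (?q - g)))"
        proof -
          have "h n - ?q \<in> H" "?q - g \<in> H" using h(1)[of n] g q by (auto intro!: subspace_diff H)
          then have "p (h n - ?q + (?q - g)) \<le> max (p (h n - ?q)) (p (?q - g))"
            using pH unfolding ultra_seminorm_on_def by blast
          then show ?thesis by (intro max.mono order_refl)
        qed
        finally have le: "p (x0 - g) \<le> max (p (x0 - h n)) (max (p (h n - ?q)) (p (?q - g)))" .
        have "p (h n - ?q) = 0" using B(5)[OF h(1)[of n]] by simp
        moreover have "p (?q - g) \<le> M * (1 / 2) ^ n"
        proof -
          have "?q - g = (\<Sum>b\<in>B. smul (\<psi> b (h n) - L b) b)"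
            by (simp add: g_def sum_subtractf scale_left_diff_distrib)
          also have "p \<dots> \<le> M * (1 / 2) ^ n"
          proof (rule seminorm_sum_le[OF pH H])
            show "0 \<le> M * (1 / 2) ^ n" using M by simp
            fix b assume b: "b \<in> B"
            then show "smul (\<psi> b (h n) - L b) b \<in> H" using B(2) by (intro subspace_scale H) auto
            have bW: "b \<in> W" using b B(2) HW by auto
            have "p (smul (\<psi> b (h n) - L b) b) = av (L b - \<psi> b (h n)) * p b"
              using psc[OF bW] av_minus[of "L b - \<psi> b (h n)"] by simp
            also have "\<dots> \<le> C b * (1 / 2) ^ n * p b"
              using L[OF b] p0[OF bW] by (rule mult_right_mono)
            also have "\<dots> = (C b * p b) * (1 / 2) ^ n" by simp
            also have "\<dots> \<le> M * (1 / 2) ^ n" using M(2)[OF b] by (rule mult_right_mono) simp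
            finally show "p (smul (\<psi> b (h n) - L b) b) \<le> M * (1 / 2) ^ n" .
          qed
          finally show ?thesis .
        qed
        moreover have "(1 / 2) ^ n \<le> M * (1 / 2 :: real) ^ n" using M(1) by simp
        moreover have "0 \<le> M * (1 / 2) ^ n" using M(1) by simp
        ultimately show ?thesis using le h(2)[of n] by linarith
      qed
      \<comment> \<open>Thus \<open>p (x0 - g) = 0\<close> with \<open>g\<close> in
        \<open>H\<close>, and the hypothesis on the kernel of \<open>p\<close> contradicts
        \<open>\<phi> x0 = 1\<close>.\<close>
      have "(\<lambda>n. M * (1 / 2) ^ n) \<longlonglongrightarrow> M * 0"
        by (intro tendsto_mult_left LIMSEQ_power_zero) simp
      then have "p (x0 - g) \<le> M * 0" by (rule Lim_bounded2) (use bound in auto)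
      moreover have xg: "x0 - g \<in> W" using x0 g HW by (intro subspace_diff W) auto
      ultimately have "\<phi> (x0 - g) = 0" using p0[OF xg] ker[OF xg] by simp
      then show False using x0 g \<phi> by (simp add: functional_diff H_def)
    qed
    then obtain n :: nat where n: "\<And>h. h \<in> H \<Longrightarrow> (1 / 2) ^ n \<le> p (x0 - h)" by blast
    \<comment> \<open>A vector outside \<open>H\<close> is \<open>\<phi> x\<close> times some
      \<open>x0 - h\<close>, so the distance bound scales.\<close>
    have "av (\<phi> x) \<le> 2 ^ n * p x" if x: "x \<in> W" for x
    proof (cases "\<phi> x = 0")
      case False
      define h where "h = x0 - smul (inverse (\<phi> x)) x"
      have "h \<in> H"
        using x0 x False W \<phi> unfolding H_def h_def
        by (auto simp: functional_diff functional_scale intro!: subspace_diff subspace_scale)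
      then have "(1 / 2) ^ n \<le> p (x0 - h)" by (rule n)
      also have "x0 - h = smul (inverse (\<phi> x)) x" by (simp add: h_def)
      also have "p \<dots> = inverse (av (\<phi> x)) * p x" using psc[OF x] by (simp add: av_inverse)
      finally show ?thesis using av_pos[OF False] by (simp add: field_simps power_divide)
    qed (use p0[OF x] in simp)
    then show ?thesis by (intro exI[of _ "2 ^ n"]) auto
  qed
qed

end

section \<open>Slow and fast parts of a differential module\<close>

text \<open>For \<open>s \<ge> 0\<close> this says that the limit superior of the
  \<open>i\<close>-th roots of |a i| is at most \<open>s\<close>. The strict inequality
  \<open>l > s\<close> makes the condition closed under infima of levels.\<close>

definition growth_le :: "('k \<Rightarrow> real) \<Rightarrow> real \<Rightarrow> (nat \<Rightarrow> 'k) \<Rightarrow> bool" where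
  "growth_le av s a \<longleftrightarrow> (\<forall>l>s. \<exists>C. \<forall>i. av (a i) \<le> C * l ^ i)"

text \<open>Growth is tested by functionals, so that no norm has to be chosen; in finite dimension
  it is the growth in any norm.\<close>

definition slow_part ::
    "('k \<Rightarrow> real) \<Rightarrow> ('k::field \<Rightarrow> 'v::ab_group_add \<Rightarrow> 'v) \<Rightarrow> ('v \<Rightarrow> 'v) \<Rightarrow> real \<Rightarrow> 'v set" where
  "slow_part av smul D s = {x. \<forall>\<phi>. functional smul \<phi> \<longrightarrow> growth_le av s (\<lambda>i. \<phi> ((D ^^ i) x))}"

definition slow_functional ::
    "('k \<Rightarrow> real) \<Rightarrow> ('k::field \<Rightarrow> 'v::ab_group_add \<Rightarrow> 'v) \<Rightarrow> ('v \<Rightarrow> 'v) \<Rightarrow> real \<Rightarrow> 'v set \<Rightarrow>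
     ('v \<Rightarrow> 'k) \<Rightarrow> bool" where
  "slow_functional av smul D s W \<phi> \<longleftrightarrow>
     functional smul \<phi> \<and> (\<forall>y\<in>W. growth_le av s (\<lambda>i. \<phi> ((D ^^ i) y)))"

text \<open>For stable \<open>W\<close> and \<open>s \<ge> 0\<close> this is the smallest subspace
  of \<open>W\<close> with slow quotient: a functional vanishing on such a subspace is slow, hence
  vanishes here.\<close>

definition fast_part ::
    "('k \<Rightarrow> real) \<Rightarrow> ('k::field \<Rightarrow> 'v::ab_group_add \<Rightarrow> 'v) \<Rightarrow> ('v \<Rightarrow> 'v) \<Rightarrow> real \<Rightarrow> 'v set \<Rightarrow> 'v set" where
  "fast_part av smul D s W = {x \<in> W. \<forall>\<phi>. slow_functional av smul D s W \<phi> \<longrightarrow> \<phi> x = 0}"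

definition slow_quotient ::
    "('k \<Rightarrow> real) \<Rightarrow> ('k::field \<Rightarrow> 'v::ab_group_add \<Rightarrow> 'v) \<Rightarrow> ('v \<Rightarrow> 'v) \<Rightarrow> real \<Rightarrow> 'v set \<Rightarrow> 'v set \<Rightarrow> bool" where
  "slow_quotient av smul D s W U \<longleftrightarrow>
     (\<forall>\<phi>. functional smul \<phi> \<and> (\<forall>u\<in>U. \<phi> u = 0) \<longrightarrow> slow_functional av smul D s W \<phi>)"

text \<open>The image of the ball of radius \<open>e\<close> for the Gauss norm of weight
  \<open>l\<close> on families of twisted polynomials in \<open>D\<close>, one for each generator in
  \<open>E\<close>.\<close>

inductive_set presentable ::
    "('k \<Rightarrow> real) \<Rightarrow> ('k::field \<Rightarrow> 'v::ab_group_add \<Rightarrow> 'v) \<Rightarrow> ('v \<Rightarrow> 'v) \<Rightarrow> 'v set \<Rightarrow> real \<Rightarrow> real \<Rightarrow> 'v set"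
  for av smul D E l e where
    zero: "0 \<in> presentable av smul D E l e"
  | step: "x \<in> presentable av smul D E l e \<Longrightarrow> g \<in> E \<Longrightarrow> av a * l ^ i \<le> e \<Longrightarrow>
      x + smul a ((D ^^ i) g) \<in> presentable av smul D E l e"

lemma finite_real_bound:
  fixes f :: "'a \<Rightarrow> real"
  assumes "finite A"
  obtains M where "0 < M" "\<And>a. a \<in> A \<Longrightarrow> f a \<le> M"
proof (rule that[of "Max (insert 1 (f ` A))"])
  have "1 \<le> Max (insert 1 (f ` A))" using assms by (intro Max_ge) auto
  then show "0 < Max (insert 1 (f ` A))" by linarith
  show "f a \<le> Max (insert 1 (f ` A))" if "a \<in> A" for a using assms that by (intro Max_ge) auto
qed

section \<open>Sequences of bounded exponential growth\<close>

context complete_nonarch_field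
begin

lemma growth_leD:
  assumes "growth_le av s a" "s < l"
  obtains C where "0 \<le> C" "\<And>i. av (a i) \<le> C * l ^ i"
proof -
  obtain C where C: "\<And>i. av (a i) \<le> C * l ^ i" using assms unfolding growth_le_def by blast
  have "0 \<le> C" using order_trans[OF av_nonneg C[of 0]] by simp
  then show ?thesis using C by (rule that)
qed

lemma growth_le_zero: "growth_le av s (\<lambda>i. 0)"
  unfolding growth_le_def by (auto intro: exI[of _ 0])

lemma growth_le_add:
  assumes "growth_le av s a" "growth_le av s b" "0 \<le> s"
  shows "growth_le av s (\<lambda>i. a i + b i)"
  unfolding growth_le_def
proof (intro allI impI)
  fix l assume l: "s < l"
  obtain C where C: "0 \<le> C" "\<And>i. av (a i) \<le> C * l ^ i" using growth_leD[OF assms(1) l] by metis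
  obtain C' where C': "0 \<le> C'" "\<And>i. av (b i) \<le> C' * l ^ i" using growth_leD[OF assms(2) l] by metis
  have "av (a i + b i) \<le> max C C' * l ^ i" for i
  proof (rule av_add_le)
    have l0: "0 \<le> l ^ i" using l assms(3) by simp
    show "av (a i) \<le> max C C' * l ^ i" using C(2)[of i] mult_right_mono[OF max.cobounded1 l0, of C C'] by linarith
    show "av (b i) \<le> max C C' * l ^ i" using C'(2)[of i] mult_right_mono[OF max.cobounded2 l0, of C' C] by linarith
  qed
  then show "\<exists>C. \<forall>i. av (a i + b i) \<le> C * l ^ i" by blast
qed

lemma growth_le_image:
  assumes "growth_le av s a" "\<And>i. av (b i) \<le> M * av (a i)"
  shows "growth_le av s b"
  unfolding growth_le_def
proof (intro allI impI)
  fix l assume l: "s < l"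
  obtain C where C: "0 \<le> C" "\<And>i. av (a i) \<le> C * l ^ i" using growth_leD[OF assms(1) l] by metis
  have "av (b i) \<le> max M 0 * C * l ^ i" for i
  proof -
    have "av (b i) \<le> max M 0 * av (a i)"
      using assms(2)[of i] mult_right_mono[of M "max M 0" "av (a i)"] av_nonneg[of "a i"] by simp
    also have "\<dots> \<le> max M 0 * (C * l ^ i)" using C by (intro mult_left_mono) auto
    finally show ?thesis by simp
  qed
  then show "\<exists>C. \<forall>i. av (b i) \<le> C * l ^ i" by blast
qed

lemma growth_le_diff:
  assumes "growth_le av s a" "growth_le av s b" "0 \<le> s"
  shows "growth_le av s (\<lambda>i. a i - b i)"
  using growth_le_add[OF assms(1) growth_le_image[OF assms(2), of "\<lambda>i. - b i" 1] assms(3)] by simp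

end

section \<open>Differential modules over one derivation\<close>

locale valued_differential_module =
  complete_differential_field av d + valued_vector_space av smul Basis
  for av :: "'k::field_char_0 \<Rightarrow> real" and d :: "'k \<Rightarrow> 'k"
    and smul :: "'k \<Rightarrow> 'v::ab_group_add \<Rightarrow> 'v" and Basis +
  fixes D :: "'v \<Rightarrow> 'v"
  assumes D_add: "D (v + w) = D v + D w"
    and D_scale: "D (smul c v) = smul (d c) v + smul c (D v)"
begin

abbreviation "slow \<equiv> slow_part av smul D"
abbreviation "slowf \<equiv> slow_functional av smul D"
abbreviation "fast \<equiv> fast_part av smul D"
abbreviation "slowq \<equiv> slow_quotient av smul D"
abbreviation "pres \<equiv> presentable av smul D"
abbreviation "stab \<equiv> stable_subspace smul D"

lemma D_0 [simp]: "D 0 = 0"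
  using D_add[of 0 0] by simp

lemma D_minus: "D (- x) = - D x"
  using D_add[of x "- x"] by (simp add: eq_neg_iff_add_eq_0 add.commute)

lemma D_diff: "D (x - y) = D x - D y"
  using D_add[of x "- y"] by (simp add: D_minus)

lemma D_sum: "D (\<Sum>i\<in>A. f i) = (\<Sum>i\<in>A. D (f i))"
  by (induction A rule: infinite_finite_induct) (simp_all add: D_add)

lemma D_funpow_add: "(D ^^ n) (x + y) = (D ^^ n) x + (D ^^ n) y"
  by (induction n) (simp_all add: D_add)

lemma D_funpow_0 [simp]: "(D ^^ n) 0 = 0"
  by (induction n) simp_all

lemma D_funpow_diff: "(D ^^ n) (x - y) = (D ^^ n) x - (D ^^ n) y"
  by (induction n) (simp_all add: D_diff)

lemma D_funpow_sum: "(D ^^ n) (\<Sum>i\<in>A. f i) = (\<Sum>i\<in>A. (D ^^ n) (f i))"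
  by (induction A rule: infinite_finite_induct) (simp_all add: D_funpow_add)

lemma d_funpow_diff: "(d ^^ n) (x - y) = (d ^^ n) x - (d ^^ n) y"
  by (induction n) (simp_all add: d_diff)

lemma stable_subspaceD: "stab W \<Longrightarrow> subspace W" "stab W \<Longrightarrow> x \<in> W \<Longrightarrow> D x \<in> W"
  by (auto simp: stable_subspace_def)

lemma stable_funpow: "stab W \<Longrightarrow> x \<in> W \<Longrightarrow> (D ^^ n) x \<in> W"
  by (rule funpow_closed) (rule stable_subspaceD)

text \<open>Each \<open>D\<close> falls on the scalar or on the vector and raises one of two
  exponents by one; the ultrametric inequality replaces the binomial sum by a maximum.\<close>

lemma leibniz_bound:
  assumes p: "ultra_seminorm_on av smul W p" and W: "stab W" and x: "x \<in> W"
    and c: "\<And>k. av ((d ^^ k) c) \<le> A * l ^ k" and pD: "\<And>b. p ((D ^^ b) x) \<le> M * l ^ b"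
  shows "p ((D ^^ n) (smul c x)) \<le> A * M * l ^ n"
proof -
  note sub = stable_subspaceD(1)[OF W]
  \<comment> \<open>Generalised to all terms of the Leibniz expansion; the total
    \<open>n + k + b\<close> is preserved by the step.\<close>
  have "p ((D ^^ n) (smul ((d ^^ k) c) ((D ^^ b) x))) \<le> A * M * l ^ (n + k + b)" for k b
  proof (induction n arbitrary: k b)
    case 0
    have xW: "(D ^^ b) x \<in> W" using W x by (rule stable_funpow)
    then have "p (smul ((d ^^ k) c) ((D ^^ b) x)) = av ((d ^^ k) c) * p ((D ^^ b) x)"
      using p unfolding ultra_seminorm_on_def by blast
    also have "\<dots> \<le> (A * l ^ k) * (M * l ^ b)"
      using c[of k] pD[of b] av_nonneg[of "(d ^^ k) c"] p xW unfolding ultra_seminorm_on_def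
      by (intro mult_mono) (auto intro: order_trans)
    finally show ?case by (simp add: power_add mult_ac)
  next
    case (Suc n)
    let ?y = "smul ((d ^^ k) c) ((D ^^ b) x)"
    have "(D ^^ Suc n) ?y = (D ^^ n) (smul ((d ^^ Suc k) c) ((D ^^ b) x) + smul ((d ^^ k) c) ((D ^^ Suc b) x))"
      unfolding funpow_Suc_right[of n D] comp_def D_scale by simp
    also have "\<dots> = (D ^^ n) (smul ((d ^^ Suc k) c) ((D ^^ b) x)) + (D ^^ n) (smul ((d ^^ k) c) ((D ^^ Suc b) x))"
      by (rule D_funpow_add)
    also have "p \<dots> \<le> max (p ((D ^^ n) (smul ((d ^^ Suc k) c) ((D ^^ b) x)))) (p ((D ^^ n) (smul ((d ^^ k) c) ((D ^^ Suc b) x))))"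
    proof -
      have "(D ^^ n) (smul c' ((D ^^ b') x)) \<in> W" for c' b'
        using W x by (intro stable_funpow subspace_scale sub)
      then show ?thesis using p unfolding ultra_seminorm_on_def by blast
    qed
    also have "\<dots> \<le> A * M * l ^ (Suc n + k + b)"
      using Suc.IH[of "Suc k" b] Suc.IH[of k "Suc b"] by simp
    finally show ?case .
  qed
  from this[of 0 0] show ?thesis by simp
qed

text \<open>The dual connection. The terms \<open>d c * \<phi> x\<close> arising from
  \<open>d (\<phi> (smul c x))\<close> and from \<open>\<phi> (D (smul c x))\<close> cancel, so
  functionals go to functionals.\<close>

definition adj :: "('v \<Rightarrow> 'k) \<Rightarrow> 'v \<Rightarrow> 'k" where
  "adj \<phi> x = d (\<phi> x) - \<phi> (D x)"

lemma functional_adj: "fnl \<phi> \<Longrightarrow> fnl (adj \<phi>)"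
  by (simp add: functional_def adj_def d_add d_mult D_add D_scale algebra_simps)

lemma functional_adj_funpow: "fnl \<phi> \<Longrightarrow> fnl ((adj ^^ n) \<phi>)"
  by (induction n) (simp_all add: functional_adj)

lemma adj_vanishes: "stab U \<Longrightarrow> \<forall>u\<in>U. \<phi> u = 0 \<Longrightarrow> \<forall>u\<in>U. adj \<phi> u = 0"
  by (auto simp: adj_def stable_subspaceD)

lemma adj_funpow_vanishes: "stab U \<Longrightarrow> \<forall>u\<in>U. \<phi> u = 0 \<Longrightarrow> \<forall>u\<in>U. (adj ^^ n) \<phi> u = 0"
proof (induction n)
  case (Suc n)
  then show ?case using adj_vanishes[OF Suc.prems(1), of "(adj ^^ n) \<phi>"] by simp
qed simp

text \<open>One application of \<open>adj\<close> becomes one \<open>d\<close> outside or one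
  \<open>D\<close> inside \<open>\<phi>\<close>, so the total exponent is preserved as in the
  Leibniz bound.\<close>

lemma adj_funpow_bound:
  assumes dA: "\<And>k c. av ((d ^^ k) c) \<le> A * l ^ k * av c" and "0 \<le> A" "0 \<le> l"
    and \<phi>: "\<And>b. av (\<phi> ((D ^^ b) x)) \<le> M * l ^ b"
  shows "av ((adj ^^ n) \<phi> x) \<le> A * M * l ^ n"
proof -
  have "av ((d ^^ k) ((adj ^^ n) \<phi> ((D ^^ b) x))) \<le> A * M * l ^ (k + n + b)" for k b
  proof (induction n arbitrary: k b)
    case 0
    have "av ((d ^^ k) (\<phi> ((D ^^ b) x))) \<le> A * l ^ k * av (\<phi> ((D ^^ b) x))" by (rule dA)
    also have "\<dots> \<le> A * l ^ k * (M * l ^ b)" using \<phi>[of b] assms(2,3) by (intro mult_left_mono) auto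
    finally show ?case by (simp add: power_add mult_ac)
  next
    case (Suc n)
    have "(d ^^ k) ((adj ^^ Suc n) \<phi> ((D ^^ b) x)) =
      (d ^^ Suc k) ((adj ^^ n) \<phi> ((D ^^ b) x)) - (d ^^ k) ((adj ^^ n) \<phi> ((D ^^ Suc b) x))"
      unfolding funpow_Suc_right[of k d] by (simp add: adj_def d_funpow_diff)
    then show ?case
      using av_diff_le Suc.IH[of "Suc k" b] Suc.IH[of k "Suc b"] by simp
  qed
  then have "av ((d ^^ 0) ((adj ^^ n) \<phi> ((D ^^ 0) x))) \<le> A * M * l ^ (0 + n + 0)" .
  then show ?thesis by simp
qed

lemma d_funpow_boundE:
  assumes "sp \<le> s" "s < l"
  obtains A where "0 < A" "\<And>n x. av ((d ^^ n) x) \<le> A * l ^ n * av x"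
  using d_funpow_bound[of l] assms by (meson order_le_less_trans)

text \<open>This passes between the two sides of the duality: growth of \<open>D\<close> on a vector
  against growth of the dual connection on a functional.\<close>

lemma growth_le_adj:
  assumes "sp \<le> s" and g: "growth_le av s (\<lambda>i. \<phi> ((D ^^ i) x))"
  shows "growth_le av s (\<lambda>i. (adj ^^ i) \<phi> x)"
  unfolding growth_le_def
proof (intro allI impI)
  fix l assume l: "s < l"
  obtain A where A: "0 < A" "\<And>n x. av ((d ^^ n) x) \<le> A * l ^ n * av x"
    using d_funpow_boundE[OF assms(1) l] by metis
  obtain C where C: "0 \<le> C" "\<And>i. av (\<phi> ((D ^^ i) x)) \<le> C * l ^ i" using growth_leD[OF g l] by metis
  have "av ((adj ^^ i) \<phi> x) \<le> A * C * l ^ i" for i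
    using A C l assms(1) sp_nonneg by (intro adj_funpow_bound) auto
  then show "\<exists>C. \<forall>i. av ((adj ^^ i) \<phi> x) \<le> C * l ^ i" by blast
qed

lemma growth_le_smul:
  assumes "sp \<le> s" "fnl \<phi>" "growth_le av s (\<lambda>i. \<phi> ((D ^^ i) x))"
  shows "growth_le av s (\<lambda>i. \<phi> ((D ^^ i) (smul c x)))"
  unfolding growth_le_def
proof (intro allI impI)
  fix l assume l: "s < l"
  obtain A where A: "0 < A" "\<And>n x. av ((d ^^ n) x) \<le> A * l ^ n * av x"
    using d_funpow_boundE[OF assms(1) l] by metis
  obtain C where C: "0 \<le> C" "\<And>i. av (\<phi> ((D ^^ i) x)) \<le> C * l ^ i" using growth_leD[OF assms(3) l] by metis
  have "av (\<phi> ((D ^^ i) (smul c x))) \<le> A * av c * C * l ^ i" for i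
    by (rule leibniz_bound[OF functional_seminorm[OF assms(2)], of UNIV])
      (use A(2)[of _ c] C in \<open>auto simp: stable_subspace_def mult_ac\<close>)
  then show "\<exists>C. \<forall>i. av (\<phi> ((D ^^ i) (smul c x))) \<le> C * l ^ i" by blast
qed

lemma subspace_slow_part:
  assumes "sp \<le> s"
  shows "subspace (slow s)"
proof -
  have "0 \<le> s" using assms sp_nonneg by linarith
  then show ?thesis
    using growth_le_smul[OF assms] growth_le_add
    by (auto simp: subspace_def slow_part_def functional_0 growth_le_zero D_funpow_add functional_add)
qed

lemma subspace_fast_part: "subspace W \<Longrightarrow> subspace (fast s W)"
  by (auto simp: subspace_def fast_part_def slow_functional_def functional_0 functional_add functional_scale)

lemma fast_part_subset: "fast s W \<subseteq> W"
  by (auto simp: fast_part_def)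

section \<open>Operators commuting with \<open>D\<close>\<close>

context
  fixes T :: "'v \<Rightarrow> 'v" and t :: "'k \<Rightarrow> 'k"
  assumes T_add: "\<And>x y. T (x + y) = T x + T y"
    and T_scale: "\<And>c x. T (smul c x) = smul (t c) x + smul c (T x)"
    and T_commute: "\<And>x. T (D x) = D (T x)"
    and t_derivation: "bounded_derivation av t"
begin

lemma T_funpow: "T ((D ^^ i) x) = (D ^^ i) (T x)"
  by (induction i) (simp_all add: T_commute)

text \<open>This functional, called \<open>?\<psi>\<close> below, moves \<open>T\<close> off the
  argument: \<open>\<phi> (T x)\<close> is \<open>t (\<phi> x) - ?\<psi> x\<close>, with a linear
  \<open>?\<psi>\<close> although \<open>T\<close> is not linear.\<close>

lemma functional_commutator: "fnl \<phi> \<Longrightarrow> fnl (\<lambda>x. t (\<phi> x) - \<phi> (T x))"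
  using bounded_derivation.d_add[OF t_derivation] bounded_derivation.d_mult[OF t_derivation]
  by (simp add: functional_def T_add T_scale algebra_simps)

lemma growth_le_derivation: "growth_le av s a \<Longrightarrow> growth_le av s (\<lambda>i. t (a i))"
proof -
  interpret t: complete_differential_field av t
    using t_derivation complete_nonarch_field_axioms by (rule complete_differential_field.intro[rotated])
  assume "growth_le av s a"
  moreover obtain M where "\<And>x. av (t x) \<le> M * av x" using t.d_bound by blast
  ultimately show ?thesis by (rule growth_le_image)
qed

text \<open>Evaluate the identity along the iterates of \<open>x\<close>, with which
  \<open>T\<close> commutes; \<open>t\<close> is bounded on scalars and so preserves growth.\<close>

lemma slow_part_invariant:
  assumes "0 \<le> s" "x \<in> slow s"
  shows "T x \<in> slow s"
  unfolding slow_part_def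
proof (intro CollectI allI impI)
  fix \<phi> assume \<phi>: "fnl \<phi>"
  let ?\<psi> = "\<lambda>x. t (\<phi> x) - \<phi> (T x)"
  have g: "growth_le av s (\<lambda>i. \<psi> ((D ^^ i) x))" if "fnl \<psi>" for \<psi>
    using assms(2) that by (simp add: slow_part_def)
  have "growth_le av s (\<lambda>i. t (\<phi> ((D ^^ i) x)) - ?\<psi> ((D ^^ i) x))"
    by (rule growth_le_diff[OF growth_le_derivation])
      (use g[OF \<phi>] g[OF functional_commutator[OF \<phi>]] assms(1) in simp_all)
  then show "growth_le av s (\<lambda>i. \<phi> ((D ^^ i) (T x)))" by (simp add: T_funpow)
qed

text \<open>The commutator functional of a slow functional is again slow, so both vanish at
  \<open>x\<close>, and with them \<open>\<phi> (T x)\<close>.\<close>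

lemma fast_part_invariant:
  assumes "0 \<le> s" "x \<in> fast s W" "T ` W \<subseteq> W"
  shows "T x \<in> fast s W"
  unfolding fast_part_def
proof (intro CollectI conjI allI impI)
  show "T x \<in> W" using assms by (auto simp: fast_part_def)
  fix \<phi> assume slow: "slowf s W \<phi>"
  then have \<phi>: "fnl \<phi>" by (simp add: slow_functional_def)
  let ?\<psi> = "\<lambda>x. t (\<phi> x) - \<phi> (T x)"
  have "slowf s W ?\<psi>"
    unfolding slow_functional_def
  proof (intro conjI ballI)
    show "fnl ?\<psi>" using \<phi> by (rule functional_commutator)
    fix y assume "y \<in> W"
    then show "growth_le av s (\<lambda>i. ?\<psi> ((D ^^ i) y))"
      unfolding T_funpow using slow assms(1,3)
      by (intro growth_le_diff growth_le_derivation) (auto simp: slow_functional_def)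
  qed
  then have "?\<psi> x = 0" "\<phi> x = 0" using assms(2) slow by (auto simp: fast_part_def)
  moreover have "t 0 = 0" using bounded_derivation.d_add[OF t_derivation, of 0 0] by simp
  ultimately show "\<phi> (T x) = 0" by simp
qed

end

lemma bounded_derivation_d: "bounded_derivation av d"
  by (rule bounded_derivation_axioms)

lemma stable_fast_part:
  assumes "sp \<le> s" "stab W"
  shows "stab (fast s W)"
proof -
  have "0 \<le> s" using assms(1) sp_nonneg by linarith
  then show ?thesis
    using assms(2) fast_part_invariant[OF D_add D_scale refl bounded_derivation_d]
      subspace_fast_part[of W s]
    by (auto simp: stable_subspace_def)
qed

section \<open>Slow quotients and their extensions\<close>

lemma slow_quotient_mono: "slowq s W U \<Longrightarrow> W' \<subseteq> W \<Longrightarrow> U \<subseteq> U' \<Longrightarrow> slowq s W' U'"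
  unfolding slow_quotient_def slow_functional_def by blast

lemma slow_quotient_zero_iff: "slowq s W {0} \<longleftrightarrow> W \<subseteq> slow s"
  unfolding slow_quotient_def slow_functional_def slow_part_def by (auto simp: functional_0)

text \<open>By the double annihilator, \<open>\<phi>\<close> agrees on \<open>W'\<close> with a
  functional that is slow on \<open>W\<close>, and stability keeps the iterates in
  \<open>W'\<close>. A \<open>W'\<close> smaller than \<open>W\<close> is wanted for comparing
  composition factors with the fast part of the whole module.\<close>

lemma functional_slow_if_vanishes_on_common_kernel:
  assumes "0 \<le> s" "subspace W" "stab W'" "W' \<subseteq> W" "fnl \<phi>"
    and "\<And>x. x \<in> W' \<Longrightarrow> (\<And>\<psi>. slowf s W \<psi> \<Longrightarrow> \<psi> x = 0) \<Longrightarrow> \<phi> x = 0"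
  shows "slowf s W' \<phi>"
proof -
  have "\<exists>\<psi>\<in>{\<psi>. slowf s W \<psi>}. \<forall>x\<in>W'. \<phi> x = \<psi> x"
  proof (rule double_annihilator[OF stable_subspaceD(1)[OF assms(3)] assms(5)])
    show "(\<lambda>x. \<psi> x + c * \<theta> x) \<in> {\<psi>. slowf s W \<psi>}" if "\<psi> \<in> {\<psi>. slowf s W \<psi>}" "\<theta> \<in> {\<psi>. slowf s W \<psi>}" for \<psi> \<theta> c
      using that assms(1)
      by (auto simp: slow_functional_def av_mult intro!: functional_add_fun functional_scale_fun growth_le_add
          intro: growth_le_image[of s _ _ "av c"])
  qed (use assms(6) in \<open>auto simp: slow_functional_def functional_zero_fun growth_le_zero\<close>)
  then obtain \<psi> where \<psi>: "slowf s W \<psi>" "\<And>x. x \<in> W' \<Longrightarrow> \<phi> x = \<psi> x" by blast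
  have "growth_le av s (\<lambda>i. \<phi> ((D ^^ i) y))" if "y \<in> W'" for y
    using \<psi> that assms(4) stable_funpow[OF assms(3) that] by (auto simp: slow_functional_def)
  then show ?thesis using assms(5) by (simp add: slow_functional_def)
qed

lemma slow_quotient_fast_part:
  assumes "0 \<le> s" "stab W"
  shows "slowq s W (fast s W)"
  unfolding slow_quotient_def
  using functional_slow_if_vanishes_on_common_kernel[OF assms(1) stable_subspaceD(1)[OF assms(2)] assms(2) subset_refl]
  by (auto simp: fast_part_def)

text \<open>A linear projection \<open>q\<close> from \<open>W\<close> to \<open>M\<close> need not
  commute with \<open>D\<close>, but the defect is a combination of finitely many vectors of
  \<open>M\<close> with slow coefficients. The resulting inhomogeneous recursion loses nothing,
  because sums are bounded by their largest term.\<close>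

lemma slow_quotient_trans:
  assumes s: "sp \<le> s" and W: "stab W" and M: "stab M" and "M \<subseteq> W"
    and WM: "slowq s W M" and MU: "slowq s M U"
  shows "slowq s W U"
  unfolding slow_quotient_def
proof (intro allI impI)
  fix \<phi> assume \<phi>': "fnl \<phi> \<and> (\<forall>u\<in>U. \<phi> u = 0)"
  then have \<phi>: "fnl \<phi>" by blast
  obtain B \<psi> where B: "finite B" "B \<subseteq> W" "\<And>b. fnl (\<psi> b)" "\<And>b u. b \<in> B \<Longrightarrow> u \<in> M \<Longrightarrow> \<psi> b u = 0"
    "\<And>x. x \<in> W \<Longrightarrow> x - (\<Sum>b\<in>B. smul (\<psi> b x) b) \<in> M"
    "\<And>b b'. b \<in> B \<Longrightarrow> b' \<in> B \<Longrightarrow> \<psi> b b' = (if b = b' then 1 else 0)"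
    by (rule quotient_basis[OF stable_subspaceD(1)[OF M] stable_subspaceD(1)[OF W] \<open>M \<subseteq> W\<close>]) (rule that)
  have slow\<phi>: "growth_le av s (\<lambda>i. \<phi> ((D ^^ i) m))" if "m \<in> M" for m
    using MU \<phi>' that unfolding slow_quotient_def slow_functional_def by blast
  have slow\<psi>: "growth_le av s (\<lambda>i. \<psi> b ((D ^^ i) x))" if "b \<in> B" "x \<in> W" for b x
    using WM B(3,4) that unfolding slow_quotient_def slow_functional_def by blast
  define q where "q x = x - (\<Sum>b\<in>B. smul (\<psi> b x) b)" for x
  have qM: "q x \<in> M" if "x \<in> W" for x using B(5)[OF that] by (simp add: q_def)
  have q_add: "q (x + y) = q x + q y" for x y
    by (simp add: q_def functional_add[OF B(3)] scale_left_distrib sum.distrib)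
  have q_scale: "q (smul c x) = smul c (q x)" for c x
    by (simp add: q_def functional_scale[OF B(3)] scale_right_diff_distrib scale_sum_right)
  have q_sum: "q (\<Sum>i\<in>I. f i) = (\<Sum>i\<in>I. q (f i))" for f :: "'v \<Rightarrow> 'v" and I
  proof (induction I rule: infinite_finite_induct)
    case (insert x F)
    then show ?case by (simp add: q_add)
  qed (simp_all add: q_def functional_0[OF B(3)])
  have q_id: "q m = m" if "m \<in> M" for m
    using B(4) that by (simp add: q_def)
  have q_basis: "q b = 0" if "b \<in> B" for b
  proof -
    have "(\<Sum>b'\<in>B. smul (\<psi> b' b) b') = (\<Sum>b'\<in>B. if b' = b then b else 0)"
      using B(6) that by (intro sum.cong) auto
    then show ?thesis using that B(1) by (simp add: q_def)
  qed
  show "slowf s W \<phi>"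
    unfolding slow_functional_def growth_le_def
  proof (intro conjI ballI allI impI)
    fix x l assume x: "x \<in> W" and l: "s < l"
    have l0: "0 < l" using s l sp_nonneg by linarith
    obtain A where A: "0 < A" "\<And>n x. av ((d ^^ n) x) \<le> A * l ^ n * av x"
      using d_funpow_boundE[OF s l] by metis
    have xW: "(D ^^ n) x \<in> W" for n using W x by (rule stable_funpow)
    define c where "c n b = \<psi> b ((D ^^ n) x)" for n b
    have "\<forall>b\<in>B. \<exists>C. 0 \<le> C \<and> (\<forall>n. av (c n b) \<le> C * l ^ n)"
    proof
      fix b assume "b \<in> B"
      from growth_leD[OF slow\<psi>[OF this x] l]
      show "\<exists>C. 0 \<le> C \<and> (\<forall>n. av (c n b) \<le> C * l ^ n)" unfolding c_def by blast
    qed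
    from bchoice[OF this] obtain C
      where C: "\<And>b. b \<in> B \<Longrightarrow> 0 \<le> C b" "\<And>b n. b \<in> B \<Longrightarrow> av (c n b) \<le> C b * l ^ n" by blast
    define f where "f b = q (D b)" for b
    have fM: "f b \<in> M" if "b \<in> B" for b
      using qM B(2) that stable_subspaceD(2)[OF W] by (auto simp: f_def)
    have "\<forall>b\<in>B. \<exists>C. 0 \<le> C \<and> (\<forall>n. av (\<phi> ((D ^^ n) (f b))) \<le> C * l ^ n)"
    proof
      fix b assume "b \<in> B"
      from growth_leD[OF slow\<phi>[OF fM[OF this]] l]
      show "\<exists>C. 0 \<le> C \<and> (\<forall>n. av (\<phi> ((D ^^ n) (f b))) \<le> C * l ^ n)" by blast
    qed
    from bchoice[OF this] obtain F
      where F: "\<And>b. b \<in> B \<Longrightarrow> 0 \<le> F b" "\<And>b n. b \<in> B \<Longrightarrow> av (\<phi> ((D ^^ n) (f b))) \<le> F b * l ^ n"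
      by blast
    obtain E where E: "0 \<le> E" "\<And>n. av (\<phi> ((D ^^ n) (q x))) \<le> E * l ^ n"
      using growth_leD[OF slow\<phi>[OF qM[OF x]] l] by metis
    \<comment> \<open>The division by \<open>l\<close> accounts for a shift: coefficients at time
      \<open>n\<close> enter the vector at time \<open>Suc n\<close>.\<close>
    obtain K where K: "0 < K" "\<And>b. b \<in> B \<Longrightarrow> A * C b * F b / l \<le> K"
      using finite_real_bound[OF B(1), of "\<lambda>b. A * C b * F b / l"] by metis
    define L where "L = max E K"
    have L: "0 \<le> L" "E \<le> L" "K \<le> L" using E K by (auto simp: L_def)
    have q_step: "q ((D ^^ Suc n) x) = D (q ((D ^^ n) x)) + (\<Sum>b\<in>B. smul (c n b) (f b))" for n
    proof -
      let ?y = "(D ^^ n) x"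
      let ?r = "\<Sum>b\<in>B. smul (d (c n b)) b + smul (c n b) (D b)"
      have r: "q ?r = (\<Sum>b\<in>B. smul (c n b) (f b))"
        by (simp add: q_sum q_add q_scale q_basis f_def)
      have "D ?y = D (q ?y) + ?r"
        by (simp add: q_def D_diff D_sum D_scale c_def)
      then have "q (D ?y) = q (D (q ?y)) + q ?r" by (simp only: q_add)
      also have "q (D (q ?y)) = D (q ?y)"
        using qM[OF xW] stable_subspaceD(2)[OF M] by (simp add: q_id)
      finally show ?thesis by (simp add: r)
    qed
    \<comment> \<open>The outer iterates are needed for the induction, since the recursion trades a
      step inside \<open>q\<close> for one more \<open>D\<close> outside.\<close>
    have main: "av (\<phi> ((D ^^ k) (q ((D ^^ n) x)))) \<le> L * l ^ (n + k)" for n k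
    proof (induction n arbitrary: k)
      case 0
      have "E * l ^ k \<le> L * l ^ k" using L l0 by (intro mult_right_mono) auto
      then show ?case using E(2)[of k] by simp
    next
      case (Suc n)
      have "\<phi> ((D ^^ k) (q ((D ^^ Suc n) x))) =
        \<phi> ((D ^^ Suc k) (q ((D ^^ n) x))) + (\<Sum>b\<in>B. \<phi> ((D ^^ k) (smul (c n b) (f b))))"
        unfolding q_step D_funpow_add D_funpow_sum functional_add[OF \<phi>] functional_sum[OF \<phi>]
        by (simp add: funpow_swap1)
      moreover have "av (\<phi> ((D ^^ Suc k) (q ((D ^^ n) x)))) \<le> L * l ^ (Suc n + k)"
        using Suc[of "Suc k"] by simp
      moreover have "av (\<Sum>b\<in>B. \<phi> ((D ^^ k) (smul (c n b) (f b)))) \<le> L * l ^ (Suc n + k)"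
      proof (rule av_sum_le)
        show "0 \<le> L * l ^ (Suc n + k)" using L l0 by simp
        fix b assume b: "b \<in> B"
        have "av (\<phi> ((D ^^ k) (smul (c n b) (f b)))) \<le> (A * av (c n b)) * F b * l ^ k"
        proof (rule leibniz_bound[OF functional_seminorm[OF \<phi>], of UNIV])
          show "av ((d ^^ j) (c n b)) \<le> A * av (c n b) * l ^ j" for j
            using A(2)[of j "c n b"] by (simp add: mult_ac)
        qed (use F(2)[OF b] in \<open>auto simp: stable_subspace_def\<close>)
        also have "\<dots> \<le> (A * (C b * l ^ n)) * F b * l ^ k"
          using C(2)[OF b, of n] F(1)[OF b] A(1) l0 by (intro mult_right_mono mult_left_mono) auto
        also have "\<dots> = (A * C b * F b / l) * l ^ (Suc n + k)"
          using l0 by (simp add: power_add)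
        also have "\<dots> \<le> L * l ^ (Suc n + k)"
          using K(2)[OF b] L(3) l0 by (intro mult_right_mono) auto
        finally show "av (\<phi> ((D ^^ k) (smul (c n b) (f b)))) \<le> L * l ^ (Suc n + k)" .
      qed
      ultimately show ?case using av_add_le by simp
    qed
    obtain P where P: "0 < P" "\<And>b. b \<in> B \<Longrightarrow> C b * av (\<phi> b) \<le> P"
      using finite_real_bound[OF B(1), of "\<lambda>b. C b * av (\<phi> b)"] by metis
    have "av (\<phi> ((D ^^ n) x)) \<le> max L P * l ^ n" for n
    proof -
      have ln: "0 \<le> l ^ n" using l0 by simp
      have "\<phi> ((D ^^ n) x) = \<phi> (q ((D ^^ n) x) + (\<Sum>b\<in>B. smul (c n b) b))" by (simp add: q_def c_def)
      also have "\<dots> = \<phi> (q ((D ^^ n) x)) + (\<Sum>b\<in>B. c n b * \<phi> b)"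
        by (simp only: functional_add[OF \<phi>] functional_sum[OF \<phi>] functional_scale[OF \<phi>] flip: c_def)
      finally have "\<phi> ((D ^^ n) x) = \<phi> (q ((D ^^ n) x)) + (\<Sum>b\<in>B. c n b * \<phi> b)" .
      moreover have "av (\<phi> (q ((D ^^ n) x))) \<le> max L P * l ^ n"
        using main[of 0 n] mult_right_mono[OF max.cobounded1 ln, of L P] by simp
      moreover have "av (\<Sum>b\<in>B. c n b * \<phi> b) \<le> max L P * l ^ n"
      proof (rule av_sum_le)
        show "0 \<le> max L P * l ^ n" using L ln by (simp add: le_max_iff_disj)
        fix b assume b: "b \<in> B"
        have "av (c n b * \<phi> b) \<le> C b * l ^ n * av (\<phi> b)"
          unfolding av_mult using C(2)[OF b] av_nonneg by (rule mult_right_mono)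
        also have "\<dots> = (C b * av (\<phi> b)) * l ^ n" by simp
        also have "\<dots> \<le> max L P * l ^ n" using P(2)[OF b] ln by (intro mult_right_mono) auto
        finally show "av (c n b * \<phi> b) \<le> max L P * l ^ n" .
      qed
      ultimately show ?thesis using av_add_le by simp
    qed
    then show "\<exists>C. \<forall>n. av (\<phi> ((D ^^ n) x)) \<le> C * l ^ n" by blast
  qed (rule \<phi>)
qed

section \<open>Presentations with small coefficients and their seminorm\<close>

lemma presentable_add:
  assumes "x \<in> pres E l e" "y \<in> pres E l e"
  shows "x + y \<in> pres E l e"
  using assms(2)
proof induction
  case (step y g a i)
  then have "(x + y) + smul a ((D ^^ i) g) \<in> pres E l e" by (intro presentable.step) auto
  then show ?case by (simp add: add.assoc)
qed (use assms(1) in simp)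

lemma presentable_generator: "g \<in> E \<Longrightarrow> av a * l ^ i \<le> e \<Longrightarrow> smul a ((D ^^ i) g) \<in> pres E l e"
  using presentable.step[OF presentable.zero] by force

lemma presentable_mono:
  assumes "x \<in> pres E l e" "e \<le> e'" "0 \<le> l'" "l' \<le> l"
  shows "x \<in> pres E l' e'"
  using assms(1)
proof induction
  case (step x g a i)
  have "av a * l' ^ i \<le> av a * l ^ i"
    using assms(3,4) by (intro mult_left_mono power_mono av_nonneg)
  then show ?case using step assms(2) by (intro presentable.step) auto
qed (rule presentable.zero)

lemma presentable_scale: "x \<in> pres E l e \<Longrightarrow> smul c x \<in> pres E l (av c * e)"
proof (induction rule: presentable.induct)
  case (step x g a i)
  have "av (c * a) * l ^ i \<le> av c * e"
    using mult_left_mono[OF step(3) av_nonneg[of c]] by (simp add: av_mult mult_ac)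
  then have "smul c x + smul (c * a) ((D ^^ i) g) \<in> pres E l (av c * e)"
    using step by (intro presentable.step)
  then show ?case by (simp add: scale_right_distrib)
qed (simp add: presentable.zero)

lemma presentable_exists:
  assumes "x \<in> span E" "0 \<le> l"
  shows "\<exists>e\<ge>0. x \<in> pres E l e"
  using assms(1)
proof (induction rule: span_induct_alt)
  case base
  then show ?case using presentable.zero by blast
next
  case (step c x y)
  then obtain e where e: "0 \<le> e" "y \<in> pres E l e" by blast
  have "y \<in> pres E l (max e (av c))" using presentable_mono[OF e(2)] assms(2) by simp
  moreover have "smul c x \<in> pres E l (max e (av c))"
    using presentable_generator[OF step(1), of c l 0 "max e (av c)"] by simp
  ultimately show ?case using presentable_add e(1) by (intro exI[of _ "max e (av c)"]) auto
qed

text \<open>The quotient seminorm of the Gauss norm of weight \<open>l\<close>. The condition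
  \<open>0 \<le> e\<close> matters: zero is presentable for negative \<open>e\<close> as
  well.\<close>

definition pres_norm :: "'v set \<Rightarrow> real \<Rightarrow> 'v \<Rightarrow> real" where
  "pres_norm E l x = Inf {e. 0 \<le> e \<and> x \<in> pres E l e}"

lemma pres_norm_le: "0 \<le> e \<Longrightarrow> x \<in> pres E l e \<Longrightarrow> pres_norm E l x \<le> e"
  unfolding pres_norm_def by (rule cInf_lower) (auto intro!: bdd_belowI[of _ 0])

lemma pres_norm_less:
  assumes "x \<in> span E" "0 \<le> l" "pres_norm E l x < e"
  shows "x \<in> pres E l e"
proof -
  have "{e. 0 \<le> e \<and> x \<in> pres E l e} \<noteq> {}" using presentable_exists[OF assms(1,2)] by blast
  from cInf_lessD[OF this assms(3)[unfolded pres_norm_def]]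
  obtain e' where "e' < e" "x \<in> pres E l e'" by blast
  then show ?thesis using assms(2) by (auto intro: presentable_mono)
qed

lemma pres_norm_nonneg:
  assumes "x \<in> span E" "0 \<le> l"
  shows "0 \<le> pres_norm E l x"
  unfolding pres_norm_def using presentable_exists[OF assms] by (intro cInf_greatest) auto

lemma pres_norm_seminorm:
  assumes l: "0 \<le> l"
  shows "ultra_seminorm_on av smul (span E) (pres_norm E l)"
proof -
  let ?p = "pres_norm E l"
  have ultra: "?p (x + y) \<le> max (?p x) (?p y)" if "x \<in> span E" "y \<in> span E" for x y
  proof (rule dense_ge)
    fix e assume e: "max (?p x) (?p y) < e"
    then have "0 \<le> e" using pres_norm_nonneg[OF that(1) l] by simp
    moreover have "x \<in> pres E l e" "y \<in> pres E l e" using e that l by (auto intro: pres_norm_less)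
    ultimately show "?p (x + y) \<le> e" by (intro pres_norm_le presentable_add)
  qed
  have scale_le: "?p (smul c x) \<le> av c * ?p x" if x: "x \<in> span E" for c x
  proof (cases "c = 0")
    case True
    then show ?thesis using pres_norm_le[of 0 0 E l] by (simp add: presentable.zero)
  next
    case False
    then have c: "0 < av c" by (rule av_pos)
    show ?thesis
    proof (rule dense_ge)
      fix e assume e: "av c * ?p x < e"
      then have less: "?p x < e / av c" using c by (simp add: field_simps)
      then have "x \<in> pres E l (e / av c)" by (rule pres_norm_less[OF x l])
      from presentable_scale[OF this, of c] have "smul c x \<in> pres E l e" using c by simp
      moreover have "0 \<le> e"
        using e mult_nonneg_nonneg[OF less_imp_le[OF c] pres_norm_nonneg[OF x l]]
        by linarith
      ultimately show "?p (smul c x) \<le> e" by (rule pres_norm_le[rotated])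
    qed
  qed
  have scale: "?p (smul c x) = av c * ?p x" if x: "x \<in> span E" for c x
  proof (cases "c = 0")
    case True
    then show ?thesis
      using scale_le[OF x, of 0] pres_norm_nonneg[OF span_zero l, of E] by simp
  next
    case False
    have "?p (smul (inverse c) (smul c x)) \<le> av (inverse c) * ?p (smul c x)"
      using x by (intro scale_le span_scale)
    then have "?p x \<le> inverse (av c) * ?p (smul c x)" using False by (simp add: av_inverse)
    then have "av c * ?p x \<le> ?p (smul c x)" using av_pos[OF False] by (simp add: field_simps)
    then show ?thesis using scale_le[OF x, of c] by linarith
  qed
  show ?thesis
    unfolding ultra_seminorm_on_def using ultra scale pres_norm_nonneg[OF _ l] by blast
qed

text \<open>By definition \<open>(D ^^ n) g\<close> costs at most \<open>l ^ n\<close> for a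
  generator \<open>g\<close>; scalar factors are handled by the Leibniz bound, which needs
  \<open>sp < l\<close>.\<close>

lemma pres_norm_funpow_bound:
  assumes s: "sp < l" and E: "stab (span E)" and x: "x \<in> span E"
  shows "\<exists>M. \<forall>n. pres_norm E l ((D ^^ n) x) \<le> M * l ^ n"
proof -
  have l: "0 < l" using s sp_nonneg by linarith
  obtain A where A: "0 < A" "\<And>n x. av ((d ^^ n) x) \<le> A * l ^ n * av x"
    using d_funpow_bound[OF s] by blast
  let ?p = "pres_norm E l"
  have p: "ultra_seminorm_on av smul (span E) ?p" using l by (intro pres_norm_seminorm) simp
  \<comment> \<open>Membership in the span is carried along, since the induction rule does not
    supply it for the second summand.\<close>
  have "x \<in> span E \<and> ?thesis"
    using x
  proof (induction rule: span_induct_alt)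
    case base
    have "?p 0 \<le> 0" using presentable.zero by (rule pres_norm_le[OF order_refl])
    then show ?case by (auto intro!: exI[of _ 0] span_zero)
  next
    case (step c g y)
    then obtain M where M: "\<And>n. ?p ((D ^^ n) y) \<le> M * l ^ n" by blast
    have g: "?p ((D ^^ n) g) \<le> 1 * l ^ n" for n
      using presentable_generator[OF step(1), of 1 l n "l ^ n"] l by (intro pres_norm_le) simp_all
    have gE: "g \<in> span E" using step(1) by (rule span_base)
    have yE: "y \<in> span E" using step(2) by blast
    have cg: "?p ((D ^^ n) (smul c g)) \<le> A * av c * 1 * l ^ n" for n
      by (rule leibniz_bound[OF p E gE _ g]) (use A(2)[of _ c] in \<open>simp add: mult_ac\<close>)
    have "?p ((D ^^ n) (smul c g + y)) \<le> max (A * av c) M * l ^ n" for n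
    proof -
      have "(D ^^ n) (smul c g) \<in> span E" "(D ^^ n) y \<in> span E"
        using gE yE by (auto intro!: stable_funpow[OF E] span_scale)
      then have "?p ((D ^^ n) (smul c g + y)) \<le> max (?p ((D ^^ n) (smul c g))) (?p ((D ^^ n) y))"
        using p unfolding D_funpow_add ultra_seminorm_on_def by blast
      also have "\<dots> \<le> max (A * av c * l ^ n) (M * l ^ n)"
        using cg[of n] M[of n] by (intro max.mono) auto
      also have "\<dots> = max (A * av c) M * l ^ n"
        using l by (simp add: max_mult_distrib_right)
      finally show ?thesis .
    qed
    then show ?case using gE yE by (blast intro: span_add span_scale)
  qed
  then show ?thesis ..
qed

text \<open>The fast part has no non-zero slow quotient, so the seminorm above must vanish on it
  for \<open>l\<close> close to \<open>s\<close>.\<close>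

lemma fast_part_presentable:
  assumes s: "sp \<le> s" and W: "stab W" and E: "span E = fast s W"
  obtains l where "s < l" "\<And>x e. x \<in> fast s W \<Longrightarrow> 0 < e \<Longrightarrow> x \<in> pres E l e"
proof -
  have s0: "0 \<le> s" using s sp_nonneg by linarith
  let ?G = "fast s W"
  have G: "stab ?G" using s W by (rule stable_fast_part)
  define K where "K l = {x \<in> ?G. pres_norm E l x = 0}" for l
  have p: "ultra_seminorm_on av smul ?G (pres_norm E l)" if "s < l" for l
    using pres_norm_seminorm[of l E] that s0 by (simp add: E)
  have subK: "subspace (K l)" if "s < l" for l
    unfolding K_def using p[OF that] stable_subspaceD(1)[OF G] by (rule subspace_seminorm_kernel)
  \<comment> \<open>The kernel grows as \<open>l\<close> decreases, so a level \<open>l0\<close> of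
    maximal kernel dimension has the same kernel as every level between \<open>s\<close> and
    \<open>l0\<close>.\<close>
  obtain l0 where l0: "s < l0" "\<And>l. s < l \<Longrightarrow> dim (K l) \<le> dim (K l0)"
    using ex_has_greatest_nat[of "\<lambda>l. s < l" "s + 1" "\<lambda>l. dim (K l)" "Suc dimension"] dim_subset_UNIV
    by (metis less_add_one le_imp_less_Suc)
  have K_eq: "K l = K l0" if "s < l" "l \<le> l0" for l
  proof -
    have "K l0 \<subseteq> K l"
    proof
      fix x assume x: "x \<in> K l0"
      then have xE: "x \<in> span E" by (simp add: K_def E)
      have "pres_norm E l x \<le> e" if e: "0 < e" for e
      proof -
        have "x \<in> pres E l0 e" using x e s0 l0 xE by (intro pres_norm_less) (auto simp: K_def)
        then have "x \<in> pres E l e" using \<open>l \<le> l0\<close> \<open>s < l\<close> s0 by (auto intro: presentable_mono)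
        then show ?thesis using e by (intro pres_norm_le) auto
      qed
      then have "pres_norm E l x \<le> 0" by (rule dense_ge)
      then show "x \<in> K l" using x pres_norm_nonneg[OF xE, of l] that(1) s0 by (simp add: K_def)
    qed
    then show ?thesis using subspace_dim_equal[OF subK[OF l0(1)] subK[OF that(1)]] l0(2)[OF that(1)] by simp
  qed
  \<comment> \<open>Slow at \<open>s\<close>, not merely at \<open>l0\<close>: for each
    \<open>l > s\<close> the seminorm at \<open>min l l0\<close> has the same kernel and therefore
    bounds \<open>\<phi>\<close>.\<close>
  have "slowq s ?G (K l0)"
    unfolding slow_quotient_def slow_functional_def growth_le_def
  proof (intro allI impI conjI ballI)
    fix \<phi> x l assume \<phi>: "fnl \<phi> \<and> (\<forall>u\<in>K l0. \<phi> u = 0)" and x: "x \<in> ?G" and l: "s < l"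
    define m where "m = min l l0"
    have m: "s < m" "m \<le> l" "m \<le> l0" "0 < m" using l l0 s0 by (auto simp: m_def)
    have "\<phi> y = 0" if "y \<in> ?G" "pres_norm E m y = 0" for y
    proof -
      have "y \<in> K m" using that by (simp add: K_def)
      then show ?thesis using \<phi> K_eq[OF m(1,3)] by blast
    qed
    then obtain C where C: "0 < C" "\<And>y. y \<in> ?G \<Longrightarrow> av (\<phi> y) \<le> C * pres_norm E m y"
      using functional_bounded_by_seminorm[OF p[OF m(1)] stable_subspaceD(1)[OF G], of \<phi>] \<phi> by blast
    obtain M where M: "\<And>n. pres_norm E m ((D ^^ n) x) \<le> M * m ^ n"
      using pres_norm_funpow_bound[of m E x] m(1) s G x by (auto simp: E)
    have "0 \<le> pres_norm E m x" using x m by (intro pres_norm_nonneg) (auto simp: E)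
    then have M0: "0 \<le> M" using M[of 0] by simp
    have "av (\<phi> ((D ^^ n) x)) \<le> C * M * l ^ n" for n
    proof -
      have "av (\<phi> ((D ^^ n) x)) \<le> C * pres_norm E m ((D ^^ n) x)"
        using G x by (intro C stable_funpow)
      also have "\<dots> \<le> C * (M * m ^ n)" using C(1) M by (intro mult_left_mono) auto
      also have "\<dots> \<le> C * (M * l ^ n)" using C(1) M0 m by (intro mult_left_mono power_mono) auto
      finally show ?thesis by simp
    qed
    then show "\<exists>C. \<forall>n. av (\<phi> ((D ^^ n) x)) \<le> C * l ^ n" by blast
  qed blast
  \<comment> \<open>Since \<open>W\<close> modulo its fast part is slow too, functionals vanishing
    on \<open>K l0\<close> are slow on all of \<open>W\<close>, and so they kill the fast
    part.\<close>
  then have slow: "slowq s W (K l0)"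
    using slow_quotient_trans[OF s W G fast_part_subset slow_quotient_fast_part[OF s0 W]] by blast
  have "?G \<subseteq> K l0"
  proof
    fix x assume x: "x \<in> ?G"
    show "x \<in> K l0"
    proof (rule ccontr)
      assume "x \<notin> K l0"
      then obtain \<phi> where \<phi>: "fnl \<phi>" "\<And>u. u \<in> K l0 \<Longrightarrow> \<phi> u = 0" "\<phi> x = 1"
        by (rule separating_functional[OF subK[OF l0(1)]]) (rule that)
      then have "slowf s W \<phi>" using slow unfolding slow_quotient_def by blast
      then have "\<phi> x = 0" using x unfolding fast_part_def by blast
      then show False using \<phi>(3) by simp
    qed
  qed
  then have "x \<in> pres E l0 e" if "x \<in> ?G" "0 < e" for x e
    using that l0(1) s0 by (intro pres_norm_less) (auto simp: K_def E)
  with l0(1) show ?thesis by (rule that)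
qed

section \<open>Commutators of \<open>D\<close> with linear maps\<close>

definition comm :: "('v \<Rightarrow> 'v) \<Rightarrow> 'v \<Rightarrow> 'v" where
  "comm h x = D (h x) - h (D x)"

text \<open>The linear maps from the whole space modulo \<open>G\<close> to \<open>G\<close>, kept
  as maps on vectors.\<close>

definition homs :: "'v set \<Rightarrow> ('v \<Rightarrow> 'v) set" where
  "homs G = {h. (\<forall>x y. h (x + y) = h x + h y) \<and> (\<forall>c x. h (smul c x) = smul c (h x)) \<and>
     (\<forall>x. h x \<in> G) \<and> (\<forall>x\<in>G. h x = 0)}"

lemma homs_zero: "subspace G \<Longrightarrow> (\<lambda>x. 0) \<in> homs G"
  by (simp add: homs_def subspace_0)

lemma homs_add: "subspace G \<Longrightarrow> h \<in> homs G \<Longrightarrow> k \<in> homs G \<Longrightarrow> (\<lambda>x. h x + k x) \<in> homs G"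
  by (simp add: homs_def subspace_add scale_right_distrib algebra_simps)

lemma homs_diff: "subspace G \<Longrightarrow> h \<in> homs G \<Longrightarrow> k \<in> homs G \<Longrightarrow> (\<lambda>x. h x - k x) \<in> homs G"
  by (simp add: homs_def subspace_diff scale_right_diff_distrib algebra_simps)

lemma homs_tensor:
  "subspace G \<Longrightarrow> fnl \<phi> \<Longrightarrow> \<forall>u\<in>G. \<phi> u = 0 \<Longrightarrow> g \<in> G \<Longrightarrow> (\<lambda>x. smul (\<phi> x) g) \<in> homs G"
  by (simp add: homs_def functional_def subspace_scale scale_left_distrib)

lemma homs_comm:
  assumes "stab G" "h \<in> homs G"
  shows "comm h \<in> homs G"
  using assms stable_subspaceD[OF assms(1)]
  by (simp add: homs_def comm_def D_add D_scale scale_right_diff_distrib subspace_diff algebra_simps)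

lemma comm_zero: "comm (\<lambda>x. 0) x = 0"
  by (simp add: comm_def)

lemma comm_add: "comm (\<lambda>x. h x + k x) x = comm h x + comm k x"
  by (simp add: comm_def D_add)

lemma comm_diff: "comm (\<lambda>x. h x - k x) x = comm h x - comm k x"
  by (simp add: comm_def D_diff)

text \<open>The product rule for the rank-one map given by \<open>\<phi>\<close> and
  \<open>g\<close>. Read backwards, it moves one \<open>D\<close> from \<open>g\<close> to
  \<open>\<phi>\<close> at the price of a sign and a commutator.\<close>

lemma comm_tensor: "comm (\<lambda>x. smul (\<phi> x) g) x = smul (adj \<phi> x) g + smul (\<phi> x) (D g)"
  by (simp add: comm_def adj_def D_scale scale_left_diff_distrib)

text \<open>Modulo commutators \<open>\<phi> \<otimes> a D\<^sup>i g\<close> is \<open>\<plusminus> (adj ^^ i) (a \<phi>) \<otimes> g\<close> (integration by parts). The latter is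
  small when \<open>\<phi>\<close> is slow and \<open>|a| l\<^sup>i\<close> is small, so presentability of \<open>G\<close> yields a contraction.\<close>

lemma commutator_surjective:
  assumes W: "stab W" and G: "stab G" and "G \<subseteq> W" and l: "sp < l"
    and slow: "\<And>\<phi> y. fnl \<phi> \<Longrightarrow> \<forall>u\<in>G. \<phi> u = 0 \<Longrightarrow> y \<in> W \<Longrightarrow> \<exists>C. \<forall>i. av (\<phi> ((D ^^ i) y)) \<le> C * l ^ i"
    and E: "finite E" "E \<subseteq> G" and pres: "\<And>x e. x \<in> G \<Longrightarrow> 0 < e \<Longrightarrow> x \<in> pres E l e"
    and y: "y \<in> homs G"
  shows "\<exists>h\<in>homs G. \<forall>x\<in>W. comm h x = y x"
proof -
  note subG = stable_subspaceD(1)[OF G] and subW = stable_subspaceD(1)[OF W]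
  have l0: "0 < l" using l sp_nonneg by linarith
  obtain B \<psi> where B: "finite B" "B \<subseteq> W" "\<And>b. fnl (\<psi> b)" "\<And>b u. b \<in> B \<Longrightarrow> u \<in> G \<Longrightarrow> \<psi> b u = 0"
    "\<And>x. x \<in> W \<Longrightarrow> x - (\<Sum>b\<in>B. smul (\<psi> b x) b) \<in> G"
    "\<And>b b'. b \<in> B \<Longrightarrow> b' \<in> B \<Longrightarrow> \<psi> b b' = (if b = b' then 1 else 0)"
    by (rule quotient_basis[OF subG subW \<open>G \<subseteq> W\<close>]) (rule that)
  have "{0} \<subseteq> G" using subspace_0[OF subG] by simp
  then obtain F \<pi> where F: "finite F" "F \<subseteq> G" "\<And>f. fnl (\<pi> f)" "\<And>f u. f \<in> F \<Longrightarrow> u \<in> {0} \<Longrightarrow> \<pi> f u = 0"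
    "\<And>x. x \<in> G \<Longrightarrow> x - (\<Sum>f\<in>F. smul (\<pi> f x) f) \<in> {0}"
    "\<And>f f'. f \<in> F \<Longrightarrow> f' \<in> F \<Longrightarrow> \<pi> f f' = (if f = f' then 1 else 0)"
    by (rule quotient_basis[OF subspace_single_0 subG]) (rule that)
  have G_expand: "x = (\<Sum>f\<in>F. smul (\<pi> f x) f)" if "x \<in> G" for x
    using F(5)[OF that] by simp
  define \<Psi> where "\<Psi> = {\<phi>. fnl \<phi> \<and> (\<forall>u\<in>G. \<phi> u = 0)}"
  have \<Psi>_expand: "\<phi> x = (\<Sum>b\<in>B. \<psi> b x * \<phi> b)" if "\<phi> \<in> \<Psi>" "x \<in> W" for \<phi> x
  proof -
    have \<phi>: "fnl \<phi>" and 0: "\<phi> (x - (\<Sum>b\<in>B. smul (\<psi> b x) b)) = 0" using that B(5) by (auto simp: \<Psi>_def)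
    then show ?thesis
      by (simp add: functional_diff[OF \<phi>] functional_sum[OF \<phi>] functional_scale[OF \<phi>])
  qed
  \<comment> \<open>\<open>nbf\<close> and \<open>nb\<close> bound coordinates of functionals and
    matrix entries of maps, with respect to the bases \<open>B\<close> of \<open>W\<close> modulo
    \<open>G\<close> and \<open>F\<close> of \<open>G\<close>.\<close>
  define nbf where "nbf \<phi> M \<longleftrightarrow> (\<forall>b\<in>B. av (\<phi> b) \<le> M)" for \<phi> :: "'v \<Rightarrow> 'k" and M
  define nb where "nb h M \<longleftrightarrow> (\<forall>b\<in>B. \<forall>f\<in>F. av (\<pi> f (h b)) \<le> M)" for h :: "'v \<Rightarrow> 'v" and M
  have nb_zero: "nb (\<lambda>x. 0) M" if "0 \<le> M" for M
    using that by (simp add: nb_def functional_0[OF F(3)])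
  have nb_add: "nb (\<lambda>x. h x + k x) M" if "nb h M" "nb k M" for h k M
    using that by (simp add: nb_def functional_add[OF F(3)] av_add_le)
  have nb_diff: "nb (\<lambda>x. h x - k x) M" if "nb h M" "nb k M" for h k M
    using that by (simp add: nb_def functional_diff[OF F(3)] av_diff_le)
  have nb_mono: "nb h M'" if "nb h M" "M \<le> M'" for h M M'
    using that unfolding nb_def by (meson order_trans)
  have nb_tensor: "nb (\<lambda>x. smul (\<phi> x) g) (M * N)"
    if "nbf \<phi> M" "\<And>f. f \<in> F \<Longrightarrow> av (\<pi> f g) \<le> N" "0 \<le> M" for \<phi> g M N
    unfolding nb_def functional_scale[OF F(3)] av_mult
    using that by (intro ballI mult_mono) (auto simp: nbf_def av_nonneg)

  obtain A where A: "0 < A" "\<And>n x. av ((d ^^ n) x) \<le> A * l ^ n * av x"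
    using d_funpow_bound[OF l] by blast
  have "\<forall>p\<in>B \<times> B. \<exists>C. \<forall>i. av (\<psi> (fst p) ((D ^^ i) (snd p))) \<le> C * l ^ i"
    using slow[OF B(3)] B(2,4) by auto
  from bchoice[OF this] obtain C'
    where C': "\<And>b b' i. b \<in> B \<Longrightarrow> b' \<in> B \<Longrightarrow> av (\<psi> b ((D ^^ i) b')) \<le> C' (b, b') * l ^ i"
    by (metis (no_types, lifting) fst_conv mem_Sigma_iff snd_conv)
  obtain C1 where C1: "0 < C1" "\<And>p. p \<in> B \<times> B \<Longrightarrow> C' p \<le> C1"
    using finite_real_bound[of "B \<times> B" C'] B(1) by (metis finite_cartesian_product)
  have \<psi>_bound: "av (\<psi> b ((D ^^ i) b')) \<le> C1 * l ^ i" if "b \<in> B" "b' \<in> B" for b b' i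
  proof -
    have "C' (b, b') * l ^ i \<le> C1 * l ^ i" using C1(2)[of "(b, b')"] that l0 by (intro mult_right_mono) auto
    then show ?thesis using C'[OF that, of i] by linarith
  qed
  \<comment> \<open>\<open>A\<close> comes from the iterates of \<open>d\<close>, and
    \<open>C1\<close> from the slow coordinates of the iterates of \<open>D\<close> on
    \<open>B\<close>.\<close>
  define C0 where "C0 = A * C1"
  have C0: "0 < C0" using A C1 by (simp add: C0_def)
  have adj_bound: "nbf ((adj ^^ i) \<phi>) (C0 * M * l ^ i)" if "\<phi> \<in> \<Psi>" "nbf \<phi> M" "0 \<le> M" for \<phi> M i
    unfolding nbf_def
  proof
    fix b assume b: "b \<in> B"
    have "av (\<phi> ((D ^^ k) b)) \<le> C1 * M * l ^ k" for k
    proof -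
      have "(D ^^ k) b \<in> W" using b B(2) by (intro stable_funpow W) auto
      then have "\<phi> ((D ^^ k) b) = (\<Sum>b'\<in>B. \<psi> b' ((D ^^ k) b) * \<phi> b')" by (rule \<Psi>_expand[OF that(1)])
      also have "av \<dots> \<le> C1 * M * l ^ k"
      proof (rule av_sum_le)
        show "0 \<le> C1 * M * l ^ k" using C1 that l0 by simp
        fix b' assume b': "b' \<in> B"
        have "av (\<psi> b' ((D ^^ k) b) * \<phi> b') \<le> (C1 * l ^ k) * M"
          unfolding av_mult using \<psi>_bound[OF b' b] that(2) b' C1 l0
          by (intro mult_mono) (auto simp: nbf_def av_nonneg)
        then show "av (\<psi> b' ((D ^^ k) b) * \<phi> b') \<le> C1 * M * l ^ k" by (simp add: mult_ac)
      qed
      finally show ?thesis .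
    qed
    then have "av ((adj ^^ i) \<phi> b) \<le> A * (C1 * M) * l ^ i"
      using A l0 by (intro adj_funpow_bound) auto
    then show "av ((adj ^^ i) \<phi> b) \<le> C0 * M * l ^ i" by (simp add: C0_def mult_ac)
  qed
  have adj_\<Psi>: "adj \<phi> \<in> \<Psi>" if "\<phi> \<in> \<Psi>" for \<phi>
    using that functional_adj adj_vanishes[OF G] by (auto simp: \<Psi>_def)
  have adjn_\<Psi>: "(adj ^^ i) \<phi> \<in> \<Psi>" if "\<phi> \<in> \<Psi>" for \<phi> i
    using that functional_adj_funpow adj_funpow_vanishes[OF G] by (auto simp: \<Psi>_def)
  have scale_\<Psi>: "(\<lambda>x. c * \<phi> x) \<in> \<Psi>" if "\<phi> \<in> \<Psi>" for \<phi> c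
    using that by (simp add: \<Psi>_def functional_scale_fun)
  have tensor: "(\<lambda>x. smul (\<phi> x) g) \<in> homs G" if "\<phi> \<in> \<Psi>" "g \<in> G" for \<phi> g
    using that homs_tensor[OF subG] by (simp add: \<Psi>_def)

  \<comment> \<open>\<open>K\<close> depends on \<open>i\<close> and \<open>g\<close> but not on
    \<open>\<phi>\<close> or its size \<open>M\<close>. Each step peels one \<open>D\<close> off the
    vector and uses the induction hypothesis for \<open>adj \<phi>\<close>.\<close>
  have by_parts: "\<exists>K\<ge>0. \<forall>\<phi>\<in>\<Psi>. \<forall>M\<ge>0. nbf \<phi> M \<longrightarrow> (\<exists>h\<in>homs G. nb h (K * M) \<and>
      (\<forall>x. smul (\<phi> x) ((D ^^ i) g) = comm h x + smul ((-1) ^ i * (adj ^^ i) \<phi> x) g))" if g: "g \<in> G" for i g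
  proof (induction i)
    case 0
    show ?case
      using homs_zero[OF subG] nb_zero
      by (intro exI[of _ 0]) (auto simp: comm_zero intro!: bexI[of _ "\<lambda>x. 0"])
  next
    case (Suc i)
    then obtain K where K: "0 \<le> K" and step: "\<And>\<phi> M. \<phi> \<in> \<Psi> \<Longrightarrow> 0 \<le> M \<Longrightarrow> nbf \<phi> M \<Longrightarrow> \<exists>h\<in>homs G. nb h (K * M) \<and>
      (\<forall>x. smul (\<phi> x) ((D ^^ i) g) = comm h x + smul ((-1) ^ i * (adj ^^ i) \<phi> x) g)" by blast
    obtain N where N: "0 < N" "\<And>f. f \<in> F \<Longrightarrow> av (\<pi> f ((D ^^ i) g)) \<le> N"
      using finite_real_bound[OF F(1), of "\<lambda>f. av (\<pi> f ((D ^^ i) g))"] by metis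
    define K' where "K' = max N (K * (C0 * l))"
    have "\<exists>h\<in>homs G. nb h (K' * M) \<and> (\<forall>x. smul (\<phi> x) ((D ^^ Suc i) g) =
      comm h x + smul ((-1) ^ Suc i * (adj ^^ Suc i) \<phi> x) g)" if \<phi>: "\<phi> \<in> \<Psi>" and M: "0 \<le> M" "nbf \<phi> M" for \<phi> M
    proof -
      have "nbf (adj \<phi>) (C0 * M * l)" using adj_bound[OF \<phi> M(2,1), of 1] by simp
      moreover have "0 \<le> C0 * M * l" using C0 M l0 by simp
      ultimately obtain h where h: "h \<in> homs G" "nb h (K * (C0 * M * l))"
        "\<And>x. smul (adj \<phi> x) ((D ^^ i) g) = comm h x + smul ((-1) ^ i * (adj ^^ i) (adj \<phi>) x) g"
        using step[OF adj_\<Psi>[OF \<phi>]] by blast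
      let ?t = "\<lambda>x. smul (\<phi> x) ((D ^^ i) g)"
      have t: "?t \<in> homs G" using tensor[OF \<phi> stable_funpow[OF G g]] .
      have nbt: "nb ?t (K' * M)"
        by (rule nb_mono[OF nb_tensor[OF M(2) N(2) M(1)]])
          (use M(1) in \<open>auto simp: K'_def mult.commute[of M] intro!: mult_right_mono\<close>)
      have "K * (C0 * M * l) = (K * (C0 * l)) * M" by simp
      also have "\<dots> \<le> K' * M" using M(1) by (intro mult_right_mono) (auto simp: K'_def)
      finally have nbh: "nb h (K' * M)" by (rule nb_mono[OF h(2)])
      have "smul (\<phi> x) ((D ^^ Suc i) g) = comm (\<lambda>x. ?t x - h x) x + smul ((-1) ^ Suc i * (adj ^^ Suc i) \<phi> x) g" for x
      proof -
        have "smul (\<phi> x) (D ((D ^^ i) g)) = comm ?t x - smul (adj \<phi> x) ((D ^^ i) g)"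
          by (simp add: comm_tensor)
        also have "\<dots> = comm ?t x - comm h x - smul ((-1) ^ i * (adj ^^ i) (adj \<phi>) x) g"
          by (simp add: h(3))
        also have "(adj ^^ i) (adj \<phi>) = (adj ^^ Suc i) \<phi>" by (simp add: funpow_swap1)
        finally show ?thesis by (simp add: comm_diff)
      qed
      then show ?thesis using homs_diff[OF subG t h(1)] nb_diff[OF nbt nbh] by blast
    qed
    moreover have "0 \<le> K'" using N by (simp add: K'_def le_max_iff_disj)
    ultimately show ?case by blast
  qed

  have "finite (F \<times> E)" using F(1) E(1) by simp
  then obtain P where P: "0 < P" "\<And>p. p \<in> F \<times> E \<Longrightarrow> av (\<pi> (fst p) (snd p)) \<le> P"
    using finite_real_bound[of "F \<times> E" "\<lambda>p. av (\<pi> (fst p) (snd p))"] by metis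
  \<comment> \<open>The factor \<open>C0 * P * e\<close> of the remainder is independent of the
    presentation of \<open>g\<close>; only the size \<open>K\<close> of the commutator part depends
    on it. This is why a presentation of any length and order will do.\<close>
  have approx_pres: "\<exists>K\<ge>0. \<forall>\<phi>\<in>\<Psi>. \<forall>M\<ge>0. nbf \<phi> M \<longrightarrow> (\<exists>h\<in>homs G. \<exists>k\<in>homs G.
      nb h (K * M) \<and> nb k (C0 * P * e * M) \<and> (\<forall>x. smul (\<phi> x) g = comm h x + k x))"
    if e: "0 < e" and g: "g \<in> pres E l e" for e g
    using g
  proof induction
    case zero
    show ?case
    proof (intro exI[of _ 0] conjI ballI allI impI bexI[of _ "\<lambda>x. 0"] homs_zero[OF subG] nb_zero)
      fix M :: real assume "0 \<le> M"
      then show "0 \<le> C0 * P * e * M" using C0 P e by simp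
    qed (simp_all add: comm_zero)
  next
    case (step z g a i)
    then obtain K1 where K1: "0 \<le> K1" "\<And>\<phi> M. \<phi> \<in> \<Psi> \<Longrightarrow> 0 \<le> M \<Longrightarrow> nbf \<phi> M \<Longrightarrow> \<exists>h\<in>homs G. \<exists>k\<in>homs G.
      nb h (K1 * M) \<and> nb k (C0 * P * e * M) \<and> (\<forall>x. smul (\<phi> x) z = comm h x + k x)" by blast
    have gG: "g \<in> G" using step E(2) by blast
    obtain K2 where K2: "0 \<le> K2" "\<And>\<phi> M. \<phi> \<in> \<Psi> \<Longrightarrow> 0 \<le> M \<Longrightarrow> nbf \<phi> M \<Longrightarrow> \<exists>h\<in>homs G. nb h (K2 * M) \<and>
      (\<forall>x. smul (\<phi> x) ((D ^^ i) g) = comm h x + smul ((-1) ^ i * (adj ^^ i) \<phi> x) g)"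
      using by_parts[OF gG, of i] by blast
    define K where "K = max K1 (K2 * av a)"
    have "\<exists>h\<in>homs G. \<exists>k\<in>homs G. nb h (K * M) \<and> nb k (C0 * P * e * M) \<and>
      (\<forall>x. smul (\<phi> x) (z + smul a ((D ^^ i) g)) = comm h x + k x)" if \<phi>: "\<phi> \<in> \<Psi>" and M: "0 \<le> M" "nbf \<phi> M" for \<phi> M
    proof -
      obtain h1 k1 where 1: "h1 \<in> homs G" "k1 \<in> homs G" "nb h1 (K1 * M)" "nb k1 (C0 * P * e * M)"
        "\<And>x. smul (\<phi> x) z = comm h1 x + k1 x" using K1(2)[OF \<phi> M] by blast
      let ?a\<phi> = "\<lambda>x. a * \<phi> x"
      have a\<phi>: "?a\<phi> \<in> \<Psi>" using \<phi> by (rule scale_\<Psi>)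
      have aM: "nbf ?a\<phi> (av a * M)" using M(2) by (auto simp: nbf_def av_mult av_nonneg intro: mult_left_mono)
      have aM0: "0 \<le> av a * M" using M(1) by (simp add: av_nonneg)
      obtain h2 where 2: "h2 \<in> homs G" "nb h2 (K2 * (av a * M))"
        "\<And>x. smul (a * \<phi> x) ((D ^^ i) g) = comm h2 x + smul ((-1) ^ i * (adj ^^ i) ?a\<phi> x) g"
        using K2(2)[OF a\<phi> aM0 aM] by blast
      let ?k2 = "\<lambda>x. smul ((-1) ^ i * (adj ^^ i) ?a\<phi> x) g"
      have k2: "?k2 \<in> homs G" by (rule tensor[OF scale_\<Psi>[OF adjn_\<Psi>[OF a\<phi>]] gG])
      have "nbf (\<lambda>x. (-1) ^ i * (adj ^^ i) ?a\<phi> x) (C0 * (av a * M) * l ^ i)"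
        using adj_bound[OF a\<phi> aM aM0, of i] by (simp add: nbf_def av_mult av_power)
      then have "nb ?k2 (C0 * (av a * M) * l ^ i * P)"
      proof (rule nb_tensor)
        show "av (\<pi> f g) \<le> P" if "f \<in> F" for f using P(2)[of "(f, g)"] that step by simp
        show "0 \<le> C0 * (av a * M) * l ^ i" using C0 aM0 l0 by simp
      qed
      \<comment> \<open>Here the smallness \<open>av a * l ^ i \<le> e\<close> of the presentation
        enters.\<close>
      moreover have "C0 * (av a * M) * l ^ i * P \<le> C0 * P * e * M"
      proof -
        have "(C0 * P * M) * (av a * l ^ i) \<le> (C0 * P * M) * e"
          using step C0 P M(1) by (intro mult_left_mono) auto
        then show ?thesis by (simp add: mult_ac)
      qed
      ultimately have nbk2: "nb ?k2 (C0 * P * e * M)" by (rule nb_mono)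
      have "K1 * M \<le> K * M" "K2 * (av a * M) \<le> K * M"
        using M(1) by (auto simp: K_def simp flip: mult.assoc intro!: mult_right_mono)
      then have nbh: "nb (\<lambda>x. h1 x + h2 x) (K * M)" using 1(3) 2(2) nb_mono nb_add by blast
      have "smul (\<phi> x) (z + smul a ((D ^^ i) g)) = comm (\<lambda>x. h1 x + h2 x) x + (k1 x + ?k2 x)" for x
        using 1(5)[of x] 2(3)[of x] by (simp add: comm_add scale_right_distrib mult.commute algebra_simps)
      then show ?thesis
        using homs_add[OF subG 1(1) 2(1)] homs_add[OF subG 1(2) k2] nbh nb_add[OF 1(4) nbk2] by blast
    qed
    moreover have "0 \<le> K" using K1 by (simp add: K_def le_max_iff_disj)
    ultimately show ?case by blast
  qed

  \<comment> \<open>Chosen to make the remainder at most half as large as the input.\<close>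
  define e where "e = 1 / (2 * C0 * P)"
  have e: "0 < e" "C0 * P * e = 1 / 2" using C0 P by (simp_all add: e_def)
  \<comment> \<open>A map into \<open>G\<close> is the sum over \<open>f\<close> in \<open>F\<close>
    of rank-one maps with functional \<open>\<pi> f \<circ> y\<close> and vector \<open>f\<close>;
    they are added one at a time, enlarging \<open>K\<close> while the remainder bound stays the
    same.\<close>
  have "\<exists>K\<ge>0. \<forall>y\<in>homs G. \<forall>M\<ge>0. nb y M \<longrightarrow> (\<exists>h\<in>homs G. \<exists>k\<in>homs G.
      nb h (K * M) \<and> nb k (M / 2) \<and> (\<forall>x. (\<Sum>f\<in>S. smul (\<pi> f (y x)) f) = comm h x + k x))"
    if "finite S" "S \<subseteq> F" for S
    using that
  proof (induction S rule: finite_induct)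
    case empty
    show ?case
    proof (intro exI[of _ 0] conjI ballI allI impI bexI[of _ "\<lambda>x. 0"] homs_zero[OF subG] nb_zero)
    qed (simp_all add: comm_zero)
  next
    case (insert f S)
    then obtain K1 where K1: "0 \<le> K1" "\<And>y M. y \<in> homs G \<Longrightarrow> 0 \<le> M \<Longrightarrow> nb y M \<Longrightarrow> \<exists>h\<in>homs G. \<exists>k\<in>homs G.
      nb h (K1 * M) \<and> nb k (M / 2) \<and> (\<forall>x. (\<Sum>f\<in>S. smul (\<pi> f (y x)) f) = comm h x + k x)" by blast
    have f: "f \<in> F" "f \<in> G" using insert F(2) by auto
    obtain K2 where K2: "0 \<le> K2" "\<And>\<phi> M. \<phi> \<in> \<Psi> \<Longrightarrow> 0 \<le> M \<Longrightarrow> nbf \<phi> M \<Longrightarrow> \<exists>h\<in>homs G. \<exists>k\<in>homs G.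
      nb h (K2 * M) \<and> nb k (C0 * P * e * M) \<and> (\<forall>x. smul (\<phi> x) f = comm h x + k x)"
      using approx_pres[OF e(1) pres[OF f(2) e(1)]] by blast
    have "\<exists>h\<in>homs G. \<exists>k\<in>homs G. nb h (max K1 K2 * M) \<and> nb k (M / 2) \<and>
      (\<forall>x. (\<Sum>f\<in>insert f S. smul (\<pi> f (y x)) f) = comm h x + k x)" if y: "y \<in> homs G" and M: "0 \<le> M" "nb y M" for y M
    proof -
      obtain h1 k1 where 1: "h1 \<in> homs G" "k1 \<in> homs G" "nb h1 (K1 * M)" "nb k1 (M / 2)"
        "\<And>x. (\<Sum>f\<in>S. smul (\<pi> f (y x)) f) = comm h1 x + k1 x" using K1(2)[OF y M] by blast
      have "(\<lambda>x. \<pi> f (y x)) \<in> \<Psi>"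
        using y F(3)[of f] by (simp add: \<Psi>_def homs_def functional_def functional_0[OF F(3)])
      moreover have "nbf (\<lambda>x. \<pi> f (y x)) M" using M(2) f(1) by (simp add: nb_def nbf_def)
      ultimately obtain h2 k2 where 2: "h2 \<in> homs G" "k2 \<in> homs G" "nb h2 (K2 * M)" "nb k2 (C0 * P * e * M)"
        "\<And>x. smul (\<pi> f (y x)) f = comm h2 x + k2 x" using K2(2)[OF _ M(1)] by blast
      have "nb k2 (M / 2)" using 2(4) e(2) by simp
      moreover have "K1 * M \<le> max K1 K2 * M" "K2 * M \<le> max K1 K2 * M"
        using M(1) by (auto intro!: mult_right_mono)
      then have "nb (\<lambda>x. h1 x + h2 x) (max K1 K2 * M)" using 1(3) 2(3) nb_mono nb_add by blast
      moreover have "(\<Sum>f\<in>insert f S. smul (\<pi> f (y x)) f) = comm (\<lambda>x. h1 x + h2 x) x + (k1 x + k2 x)" for x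
        using insert.hyps 1(5)[of x] 2(5)[of x] by (simp add: comm_add algebra_simps)
      ultimately show ?thesis
        using homs_add[OF subG 1(1) 2(1)] homs_add[OF subG 1(2) 2(2)] nb_add[OF 1(4)] by blast
    qed
    moreover have "0 \<le> max K1 K2" using K1 by simp
    ultimately show ?case by blast
  qed
  from this[OF F(1) subset_refl] obtain K where K: "0 \<le> K"
    and approx': "\<And>y M. y \<in> homs G \<Longrightarrow> 0 \<le> M \<Longrightarrow> nb y M \<Longrightarrow> \<exists>h\<in>homs G. \<exists>k\<in>homs G.
      nb h (K * M) \<and> nb k (M / 2) \<and> (\<forall>x. (\<Sum>f\<in>F. smul (\<pi> f (y x)) f) = comm h x + k x)" by blast
  have approx: "\<exists>h k. h \<in> homs G \<and> k \<in> homs G \<and> nb h (K * M) \<and> nb k (M / 2) \<and> (\<forall>x. y x = comm h x + k x)"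
    if "y \<in> homs G" "0 \<le> M" "nb y M" for y M
  proof -
    have "y x \<in> G" for x using that(1) by (simp add: homs_def)
    then have "(\<Sum>f\<in>F. smul (\<pi> f (y x)) f) = y x" for x using G_expand[of "y x"] by simp
    then show ?thesis using approx'[OF that] by auto
  qed

  have "finite (B \<times> F)" using B(1) F(1) by simp
  then obtain M where M: "0 < M" "\<And>p. p \<in> B \<times> F \<Longrightarrow> av (\<pi> (snd p) (y (fst p))) \<le> M"
    using finite_real_bound[of "B \<times> F" "\<lambda>p. av (\<pi> (snd p) (y (fst p)))"] by metis
  have yM: "nb y M" using M(2) by (force simp: nb_def)
  \<comment> \<open>The first component is the solution accumulated so far, the second the remaining
    error, which halves at each step.\<close>
  define state where "state n p \<longleftrightarrow> fst p \<in> homs G \<and> snd p \<in> homs G \<and> nb (snd p) (M * (1 / 2) ^ n) \<and>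
      (\<forall>x. y x = comm (fst p) x + snd p x)" for n :: nat and p
  have "\<exists>f. \<forall>n. state n (f n) \<and> nb (\<lambda>x. fst (f (Suc n)) x - fst (f n) x) (K * M * (1 / 2) ^ n)"
  proof (rule dependent_nat_choice)
    show "\<exists>p. state 0 p"
      using y yM homs_zero[OF subG] by (intro exI[of _ "(\<lambda>x. 0, y)"]) (simp add: state_def comm_zero)
  next
    fix p n assume p: "state n p"
    then obtain h k where hk: "h \<in> homs G" "k \<in> homs G" "nb h (K * (M * (1 / 2) ^ n))"
      "nb k (M * (1 / 2) ^ n / 2)" "\<And>x. snd p x = comm h x + k x"
      using approx[of "snd p" "M * (1 / 2) ^ n"] M(1) unfolding state_def by auto
    let ?q = "(\<lambda>x. fst p x + h x, k)"
    have "state (Suc n) ?q"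
      using p hk homs_add[OF subG] by (simp add: state_def comm_add add.assoc)
    moreover have "nb (\<lambda>x. fst ?q x - fst p x) (K * M * (1 / 2) ^ n)" using hk(3) by (simp add: mult.assoc)
    ultimately show "\<exists>q. state (Suc n) q \<and> nb (\<lambda>x. fst q x - fst p x) (K * M * (1 / 2) ^ n)" by blast
  qed
  then obtain f where f: "\<And>n. state n (f n)"
    "\<And>n. nb (\<lambda>x. fst (f (Suc n)) x - fst (f n) x) (K * M * (1 / 2) ^ n)" by blast
  define S where "S n = fst (f n)" for n
  define Y where "Y n = snd (f n)" for n
  have SY: "S n \<in> homs G" "Y n \<in> homs G" "nb (Y n) (M * (1 / 2) ^ n)" "y x = comm (S n) x + Y n x" for n x
    using f(1)[of n] by (auto simp: state_def S_def Y_def)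
  have "\<exists>L. \<forall>n. av (L - \<pi> g (S n b)) \<le> K * M * (1 / 2) ^ n" if "b \<in> B" "g \<in> F" for b g
  proof (rule geometric_sequence_converges)
    fix n show "av (\<pi> g (S (Suc n) b) - \<pi> g (S n b)) \<le> K * M * (1 / 2) ^ n"
      using f(2)[of n] that by (simp add: nb_def S_def functional_diff[OF F(3)])
  qed
  then have "\<forall>p\<in>B \<times> F. \<exists>L. \<forall>n. av (L - \<pi> (snd p) (S n (fst p))) \<le> K * M * (1 / 2) ^ n" by auto
  from bchoice[OF this] obtain L
    where L: "\<And>p n. p \<in> B \<times> F \<Longrightarrow> av (L p - \<pi> (snd p) (S n (fst p))) \<le> K * M * (1 / 2) ^ n" by blast
  \<comment> \<open>The limit of the \<open>S n\<close> modulo \<open>G\<close>, assembled from the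
    limits of their matrix entries; using \<open>\<psi>\<close> makes it vanish on
    \<open>G\<close>.\<close>
  define h where "h x = (\<Sum>b\<in>B. smul (\<psi> b x) (\<Sum>g\<in>F. smul (L (b, g)) g))" for x
  have h: "h \<in> homs G"
    unfolding homs_def
  proof (intro CollectI conjI allI ballI)
    show "h (x + z) = h x + h z" for x z
      by (simp add: h_def functional_add[OF B(3)] scale_left_distrib sum.distrib)
    show "h (smul c x) = smul c (h x)" for c x
      by (simp add: h_def functional_scale[OF B(3)] scale_sum_right mult.assoc)
    show "h x \<in> G" for x
      unfolding h_def using F(2) by (intro subspace_sum subspace_scale subG) auto
    show "h x = 0" if "x \<in> G" for x
      using B(4) that by (simp add: h_def)
  qed
  have hL: "\<pi> g (h b) = L (b, g)" if "b \<in> B" "g \<in> F" for b g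
  proof -
    have "h b = (\<Sum>b'\<in>B. if b' = b then (\<Sum>g\<in>F. smul (L (b, g)) g) else 0)"
      unfolding h_def using B(6) that by (intro sum.cong) auto
    also have "\<dots> = (\<Sum>g\<in>F. smul (L (b, g)) g)" using that B(1) by simp
    also have "\<pi> g \<dots> = (\<Sum>g'\<in>F. L (b, g') * \<pi> g g')"
      by (simp add: functional_sum[OF F(3)] functional_scale[OF F(3)])
    also have "\<dots> = (\<Sum>g'\<in>F. if g' = g then L (b, g) else 0)"
      using F(6) that by (intro sum.cong) auto
    also have "\<dots> = L (b, g)" using that F(1) by simp
    finally show ?thesis .
  qed
  have nbhS: "nb (\<lambda>x. S n x - h x) (K * M * (1 / 2) ^ n)" for n
    unfolding nb_def
  proof (intro ballI)
    fix b g assume bg: "b \<in> B" "g \<in> F"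
    then have "av (L (b, g) - \<pi> g (S n b)) \<le> K * M * (1 / 2) ^ n" using L[of "(b, g)" n] by simp
    then show "av (\<pi> g (S n b - h b)) \<le> K * M * (1 / 2) ^ n"
      using av_minus[of "L (b, g) - \<pi> g (S n b)"] by (simp add: functional_diff[OF F(3)] hL[OF bg])
  qed

  \<comment> \<open>Forming the commutator with \<open>D\<close> is bounded for the matrix norm, so
    it passes to the limit.\<close>
  have "\<exists>R\<ge>0. \<forall>z\<in>homs G. \<forall>M\<ge>0. nb z M \<longrightarrow> nb (comm z) (R * M)"
  proof -
    obtain R1 where R1: "0 < R1" "\<And>x. av (d x) \<le> R1 * av x" using d_bound by blast
    obtain R2 where R2: "0 < R2" "\<And>p. p \<in> F \<times> F \<Longrightarrow> av (\<pi> (fst p) (D (snd p))) \<le> R2"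
      using finite_real_bound[of "F \<times> F" "\<lambda>p. av (\<pi> (fst p) (D (snd p)))"] F(1)
      by (metis finite_cartesian_product)
    obtain R3 where R3: "0 < R3" "\<And>p. p \<in> B \<times> B \<Longrightarrow> av (\<psi> (fst p) (D (snd p))) \<le> R3"
      using finite_real_bound[of "B \<times> B" "\<lambda>p. av (\<psi> (fst p) (D (snd p)))"] B(1)
      by (metis finite_cartesian_product)
    define R where "R = max R1 (max R2 R3)"
    have R: "0 < R" "R1 \<le> R" "R2 \<le> R" "R3 \<le> R" using R1 by (auto simp: R_def)
    have "nb (comm z) (R * M)" if z: "z \<in> homs G" and M: "0 \<le> M" "nb z M" for z M
      unfolding nb_def
    proof (intro ballI)
      fix b g assume bg: "b \<in> B" "g \<in> F"
      have zG: "z x \<in> G" for x using z by (simp add: homs_def)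
      have zM: "av (\<pi> g' (z b')) \<le> M" if "b' \<in> B" "g' \<in> F" for b' g' using M(2) that by (simp add: nb_def)
      have RM: "0 \<le> R * M" using R M by simp
      have "D (z b) = D (\<Sum>g'\<in>F. smul (\<pi> g' (z b)) g')" using G_expand[OF zG[of b]] by simp
      also have "\<dots> = (\<Sum>g'\<in>F. smul (d (\<pi> g' (z b))) g' + smul (\<pi> g' (z b)) (D g'))"
        by (simp add: D_sum D_scale)
      finally have "\<pi> g (D (z b)) = (\<Sum>g'\<in>F. d (\<pi> g' (z b)) * \<pi> g g' + \<pi> g' (z b) * \<pi> g (D g'))"
        by (simp add: functional_sum[OF F(3)] functional_add[OF F(3)] functional_scale[OF F(3)])
      also have "av \<dots> \<le> R * M"
      proof (intro av_sum_le av_add_le RM)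
        fix g' assume g': "g' \<in> F"
        have "av (d (\<pi> g' (z b)) * \<pi> g g') \<le> (R1 * M) * 1"
          unfolding av_mult
        proof (intro mult_mono)
          show "av (d (\<pi> g' (z b))) \<le> R1 * M"
            using R1(2)[of "\<pi> g' (z b)"] mult_left_mono[OF zM[OF bg(1) g'], of R1] R1(1) by linarith
          show "av (\<pi> g g') \<le> 1" using F(6)[OF bg(2) g'] by simp
        qed (use R1 M in \<open>simp_all add: av_nonneg\<close>)
        also have "\<dots> \<le> R * M" using R M by (simp add: mult_right_mono)
        finally show "av (d (\<pi> g' (z b)) * \<pi> g g') \<le> R * M" .
        have "av (\<pi> g' (z b) * \<pi> g (D g')) \<le> M * R2"
          unfolding av_mult using zM[OF bg(1) g'] R2(2)[of "(g, g')"] bg g' M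
          by (intro mult_mono) (auto simp: av_nonneg)
        also have "\<dots> \<le> R * M" using R M by (simp add: mult.commute mult_left_mono)
        finally show "av (\<pi> g' (z b) * \<pi> g (D g')) \<le> R * M" .
      qed
      finally have 1: "av (\<pi> g (D (z b))) \<le> R * M" .
      have Db: "D b \<in> W" using bg B(2) stable_subspaceD(2)[OF W] by auto
      have "(\<lambda>x. \<pi> g (z x)) \<in> \<Psi>"
        using z F(3)[of g] by (simp add: \<Psi>_def homs_def functional_def functional_0[OF F(3)])
      from \<Psi>_expand[OF this Db] have "\<pi> g (z (D b)) = (\<Sum>b'\<in>B. \<psi> b' (D b) * \<pi> g (z b'))" .
      also have "av \<dots> \<le> R * M"
      proof (intro av_sum_le RM)
        fix b' assume b': "b' \<in> B"
        have "av (\<psi> b' (D b) * \<pi> g (z b')) \<le> R3 * M"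
          unfolding av_mult using zM[OF b' bg(2)] R3(2)[of "(b', b)"] R3(1) bg b' M
          by (intro mult_mono) (auto simp: av_nonneg)
        also have "\<dots> \<le> R * M" using R M by (simp add: mult_right_mono)
        finally show "av (\<psi> b' (D b) * \<pi> g (z b')) \<le> R * M" .
      qed
      finally have "av (\<pi> g (z (D b))) \<le> R * M" .
      with 1 show "av (\<pi> g (comm z b)) \<le> R * M"
        unfolding comm_def functional_diff[OF F(3)] by (rule av_diff_le)
    qed
    then show ?thesis using R(1) by (intro exI[of _ R]) auto
  qed
  then obtain R where R: "0 \<le> R" "\<And>z M. z \<in> homs G \<Longrightarrow> 0 \<le> M \<Longrightarrow> nb z M \<Longrightarrow> nb (comm z) (R * M)" by blast
  \<comment> \<open>For every \<open>n\<close> this error is the commutator of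
    \<open>S n - h\<close> plus \<open>Y n\<close>. Hence it vanishes on \<open>B\<close>, and as a
    member of \<open>homs G\<close> on all of \<open>W\<close>.\<close>
  define rest where "rest x = y x - comm h x" for x
  have rest: "rest \<in> homs G" unfolding rest_def using y homs_comm[OF G h] by (rule homs_diff[OF subG])
  have nb_rest: "nb rest (max (R * K * M) M * (1 / 2) ^ n)" for n
  proof -
    have Q: "0 \<le> K * M * (1 / 2) ^ n" using K M(1) by simp
    have "nb (comm (\<lambda>x. S n x - h x)) (R * (K * M * (1 / 2) ^ n))"
      using R(2)[OF homs_diff[OF subG SY(1) h] Q nbhS] .
    moreover have "R * (K * M * (1 / 2) ^ n) \<le> max (R * K * M) M * (1 / 2) ^ n"
      using mult_right_mono[OF max.cobounded1[of "R * K * M" M], of "(1 / 2) ^ n"] by (simp add: mult_ac)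
    ultimately have "nb (comm (\<lambda>x. S n x - h x)) (max (R * K * M) M * (1 / 2) ^ n)" by (rule nb_mono)
    moreover have "nb (Y n) (max (R * K * M) M * (1 / 2) ^ n)"
      by (rule nb_mono[OF SY(3)]) (intro mult_right_mono, auto)
    ultimately have "nb (\<lambda>x. comm (\<lambda>x. S n x - h x) x + Y n x) (max (R * K * M) M * (1 / 2) ^ n)"
      by (rule nb_add)
    moreover have "(\<lambda>x. comm (\<lambda>x. S n x - h x) x + Y n x) = rest"
      using SY(4)[of _ n] by (simp add: rest_def comm_diff fun_eq_iff)
    ultimately show ?thesis by simp
  qed
  have rest_B: "rest b = 0" if b: "b \<in> B" for b
  proof -
    have "\<pi> g (rest b) = 0" if "g \<in> F" for g
      using nb_rest b that unfolding nb_def by (intro vanishing_if_av_le_small[of _ "max (R * K * M) M"]) blast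
    moreover have "rest b \<in> G" using rest by (simp add: homs_def)
    ultimately show ?thesis using G_expand[of "rest b"] by simp
  qed
  have "comm h x = y x" if x: "x \<in> W" for x
  proof -
    have "(\<lambda>x. \<pi> g (rest x)) \<in> \<Psi>" for g
      using rest F(3)[of g] by (simp add: \<Psi>_def homs_def functional_def functional_0[OF F(3)])
    then have "\<pi> g (rest x) = (\<Sum>b\<in>B. \<psi> b x * \<pi> g (rest b))" for g
      using \<Psi>_expand x by blast
    then have "\<pi> g (rest x) = 0" for g using rest_B by (simp add: functional_0[OF F(3)])
    moreover have "rest x \<in> G" using rest by (simp add: homs_def)
    ultimately have "rest x = 0" using G_expand[of "rest x"] by simp
    then show ?thesis by (simp add: rest_def)
  qed
  then show ?thesis using h by blast
qed

text \<open>The commutator of a projection \<open>P\<close> onto the fast part both kills and lands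
  in the fast part, so on \<open>W\<close> it is also the commutator of a map \<open>h\<close> of
  the same kind. Then \<open>P - h\<close> is still the identity on the fast part but commutes with
  \<open>D\<close> on \<open>W\<close>.\<close>

theorem slow_fast_decomposition:
  assumes s: "sp \<le> s" and W: "stab W" and x: "x \<in> W"
  obtains f g where "f \<in> slow s" "f \<in> W" "g \<in> fast s W" "x = f + g"
proof -
  have s0: "0 \<le> s" using s sp_nonneg by linarith
  let ?G = "fast s W"
  have G: "stab ?G" using s W by (rule stable_fast_part)
  note subG = stable_subspaceD(1)[OF G]
  have "{0} \<subseteq> ?G" using subspace_0[OF subG] by simp
  then obtain F \<pi> where F: "finite F" "F \<subseteq> ?G" "\<And>f. fnl (\<pi> f)" "\<And>f u. f \<in> F \<Longrightarrow> u \<in> {0} \<Longrightarrow> \<pi> f u = 0"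
    "\<And>x. x \<in> ?G \<Longrightarrow> x - (\<Sum>f\<in>F. smul (\<pi> f x) f) \<in> {0}"
    "\<And>f f'. f \<in> F \<Longrightarrow> f' \<in> F \<Longrightarrow> \<pi> f f' = (if f = f' then 1 else 0)"
    by (rule quotient_basis[OF subspace_single_0 subG]) (rule that)
  have spanF: "span F = ?G"
  proof
    show "span F \<subseteq> ?G" using F(2) subG by (rule span_minimal)
    show "?G \<subseteq> span F"
    proof
      fix x assume "x \<in> ?G"
      then have "x = (\<Sum>f\<in>F. smul (\<pi> f x) f)" using F(5) by force
      also have "\<dots> \<in> span F" by (intro span_sum span_scale span_base)
      finally show "x \<in> span F" .
    qed
  qed
  obtain l where l: "s < l" "\<And>x e. x \<in> ?G \<Longrightarrow> 0 < e \<Longrightarrow> x \<in> pres F l e"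
    by (rule fast_part_presentable[OF s W spanF]) (rule that)
  define P where "P x = (\<Sum>f\<in>F. smul (\<pi> f x) f)" for x
  have P: "P (x + z) = P x + P z" "P (smul c x) = smul c (P x)" "P x \<in> ?G" for x z c
    unfolding P_def using F(2)
    by (auto simp: functional_add[OF F(3)] functional_scale[OF F(3)] scale_left_distrib sum.distrib scale_sum_right
        intro!: subspace_sum subspace_scale subG)
  have P_id: "P x = x" if "x \<in> ?G" for x using F(5)[OF that] by (simp add: P_def)
  have y: "comm P \<in> homs ?G"
    unfolding homs_def comm_def
  proof (intro CollectI conjI allI ballI)
    show "D (P (x + z)) - P (D (x + z)) = D (P x) - P (D x) + (D (P z) - P (D z))" for x z
      by (simp add: P D_add)
    show "D (P (smul c x)) - P (D (smul c x)) = smul c (D (P x) - P (D x))" for c x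
      by (simp add: P D_scale scale_right_diff_distrib)
    show "D (P x) - P (D x) \<in> ?G" for x
      using P(3) by (intro subspace_diff subG stable_subspaceD(2)[OF G])
    show "D (P x) - P (D x) = 0" if "x \<in> ?G" for x
      using that stable_subspaceD(2)[OF G that] by (simp add: P_id)
  qed
  have slowq: "slowq s W ?G" using s0 W by (rule slow_quotient_fast_part)
  have "\<exists>h\<in>homs ?G. \<forall>x\<in>W. comm h x = comm P x"
  proof (rule commutator_surjective[OF W G fast_part_subset _ _ F(1,2) l(2) y])
    show "sp < l" using s l by linarith
    show "\<exists>C. \<forall>i. av (\<phi> ((D ^^ i) y)) \<le> C * l ^ i" if "fnl \<phi>" "\<forall>u\<in>?G. \<phi> u = 0" "y \<in> W" for \<phi> y
      using slowq that l(1) unfolding slow_quotient_def slow_functional_def growth_le_def by blast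
  qed
  then obtain h where h: "h \<in> homs ?G" "\<And>x. x \<in> W \<Longrightarrow> comm h x = comm P x" by blast
  define Q where "Q x = P x - h x" for x
  have QG: "Q x \<in> ?G" for x using h(1) P(3) unfolding Q_def by (intro subspace_diff subG) (auto simp: homs_def)
  have Q_id: "Q x = x" if "x \<in> ?G" for x using h(1) that by (simp add: Q_def P_id homs_def)
  have Q_add: "Q (x + z) = Q x + Q z" and Q_scale: "Q (smul c x) = smul c (Q x)" for x z c
    using h(1) by (simp_all add: Q_def P homs_def scale_right_diff_distrib)
  have QD: "Q (D x) = D (Q x)" if "x \<in> W" for x
    using h(2)[OF that] by (simp add: Q_def comm_def D_diff algebra_simps)
  have QDn: "Q ((D ^^ i) x) = (D ^^ i) (Q x)" for i
    by (induction i) (use x in \<open>simp_all add: QD stable_funpow[OF W]\<close>)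
  have "x - Q x \<in> slow s"
    unfolding slow_part_def
  proof (intro CollectI allI impI)
    fix \<phi> assume \<phi>: "fnl \<phi>"
    \<comment> \<open>This functional vanishes on the fast part, hence is slow on \<open>W\<close>;
      along the iterates of \<open>x\<close> it computes \<open>\<phi>\<close> on the iterates of
      \<open>x - Q x\<close>.\<close>
    have "fnl (\<lambda>x. \<phi> x - \<phi> (Q x))"
      using \<phi> by (simp add: functional_def Q_add Q_scale algebra_simps)
    moreover have "\<forall>u\<in>?G. \<phi> u - \<phi> (Q u) = 0" by (simp add: Q_id)
    ultimately have "slowf s W (\<lambda>x. \<phi> x - \<phi> (Q x))" using slowq unfolding slow_quotient_def by blast
    then have "growth_le av s (\<lambda>i. \<phi> ((D ^^ i) x) - \<phi> (Q ((D ^^ i) x)))"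
      using x by (simp add: slow_functional_def)
    then show "growth_le av s (\<lambda>i. \<phi> ((D ^^ i) (x - Q x)))"
      by (simp add: QDn D_funpow_diff functional_diff[OF \<phi>])
  qed
  moreover have "x - Q x \<in> W"
    using x QG[of x] fast_part_subset by (intro subspace_diff stable_subspaceD(1)[OF W]) auto
  ultimately show ?thesis using QG[of x] that[of "x - Q x" "Q x"] by simp
qed

subsection \<open>The dual module\<close>

text \<open>The dual is realised on the same vector space by means of the pairing for which \<open>Basis\<close>
  is orthonormal.\<close>

definition pair :: "'v \<Rightarrow> 'v \<Rightarrow> 'k" where
  "pair v w = (\<Sum>b\<in>Basis. representation Basis v b * representation Basis w b)"

definition dual_D :: "'v \<Rightarrow> 'v" where
  "dual_D w = (\<Sum>b\<in>Basis. smul (adj (\<lambda>v. pair v w) b) b)"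

lemma in_span_Basis: "v \<in> span Basis"
  using span_Basis by simp

lemma Basis_expand: "(\<Sum>b\<in>Basis. smul (representation Basis v b) b) = v"
  by (rule sum_representation_eq[OF independent_Basis in_span_Basis finite_Basis subset_refl])

lemma functional_expand: "fnl \<phi> \<Longrightarrow> (\<Sum>b\<in>Basis. representation Basis v b * \<phi> b) = \<phi> v"
  using functional_sum[of smul \<phi> "\<lambda>b. smul (representation Basis v b) b" Basis]
  by (simp add: Basis_expand functional_scale)

lemma pair_commute: "pair v w = pair w v"
  by (simp add: pair_def mult.commute)

lemma functional_pair: "fnl (\<lambda>v. pair v w)"
  by (simp add: functional_def pair_def representation_add[OF independent_Basis in_span_Basis in_span_Basis]
      representation_scale[OF independent_Basis in_span_Basis] distrib_right sum.distrib sum_distrib_left mult.assoc)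

lemma functional_pair': "fnl (pair v)"
proof -
  have "pair v = (\<lambda>w. pair w v)" by (rule ext) (rule pair_commute)
  then show ?thesis using functional_pair[of v] by simp
qed

lemma pair_Basis: "b \<in> Basis \<Longrightarrow> pair v b = representation Basis v b"
proof -
  assume b: "b \<in> Basis"
  have "pair v b = (\<Sum>b'\<in>Basis. if b' = b then representation Basis v b else 0)"
    unfolding pair_def representation_basis[OF independent_Basis b] by (intro sum.cong) auto
  then show ?thesis using b finite_Basis by simp
qed

lemma pair_nondegenerate:
  assumes "\<And>w. pair v w = 0"
  shows "v = 0"
  using Basis_expand[of v] assms by (simp flip: pair_Basis)

lemma pair_dual_D: "pair v (dual_D w) = adj (\<lambda>v. pair v w) v"
proof -
  have "pair v (dual_D w) = (\<Sum>b\<in>Basis. representation Basis v b * adj (\<lambda>v. pair v w) b)"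
    unfolding dual_D_def functional_sum[OF functional_pair'] functional_scale[OF functional_pair']
    by (intro sum.cong) (simp_all add: pair_Basis)
  also have "\<dots> = adj (\<lambda>v. pair v w) v"
    by (rule functional_expand[OF functional_adj[OF functional_pair]])
  finally show ?thesis .
qed

lemma dual_D_eqI: "(\<And>v. pair v x = pair v y) \<Longrightarrow> x = y"
  using pair_nondegenerate[of "x - y"] functional_diff[OF functional_pair'] pair_commute
  by (metis eq_iff_diff_eq_0)

text \<open>The dual is an instance of the same locale over the same \<open>d\<close>, so the
  splitting theorem applies to it.\<close>

lemma dual_module: "valued_differential_module av d smul Basis dual_D"
proof unfold_locales
  note add = functional_add[OF functional_pair'] and scale = functional_scale[OF functional_pair']
  show "dual_D (v + w) = dual_D v + dual_D w" for v w
    by (rule dual_D_eqI) (simp add: add pair_dual_D adj_def d_add)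
  show "dual_D (smul c v) = smul (d c) v + smul c (dual_D v)" for c v
    by (rule dual_D_eqI) (simp add: add scale pair_dual_D adj_def d_mult algebra_simps)
qed

text \<open>Pair \<open>v\<close> with an arbitrary \<open>w = f + g\<close>, split in the dual. A
  slow \<open>f\<close> is a slow functional on the module, which kills the fast \<open>v\<close>; a
  slow \<open>v\<close> is a slow functional on the dual, which kills the fast
  \<open>g\<close>.\<close>

lemma slow_fast_disjoint:
  assumes s: "sp \<le> s" and v: "v \<in> slow s" "v \<in> fast s UNIV"
  shows "v = 0"
proof (rule pair_nondegenerate)
  interpret dual: valued_differential_module av d smul Basis dual_D by (rule dual_module)
  \<comment> \<open>Biduality: the dual connection of the dual is \<open>D\<close> again.\<close>
  have dual_adj: "(dual.adj ^^ i) (pair y) = pair ((D ^^ i) y)" for i y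
  proof (induction i)
    case (Suc i)
    have "dual.adj (pair z) = pair (D z)" for z
      by (rule ext) (simp add: dual.adj_def pair_dual_D adj_def)
    then show ?case using Suc by simp
  qed simp
  have pair_funpow: "(\<lambda>y. pair y ((dual_D ^^ i) w)) = (adj ^^ i) (\<lambda>y. pair y w)" for i w
  proof (induction i)
    case (Suc i)
    then show ?case by (simp add: pair_dual_D flip: Suc)
  qed simp
  fix w
  have "dual.stab UNIV" by (simp add: stable_subspace_def)
  then obtain f g where f: "f \<in> dual.slow s" and g: "g \<in> dual.fast s UNIV" and w: "w = f + g"
    using dual.slow_fast_decomposition[OF s _ UNIV_I] by metis
  have "slowf s UNIV (\<lambda>y. pair y f)"
    unfolding slow_functional_def
  proof (intro conjI ballI functional_pair)
    fix y
    have "growth_le av s (\<lambda>i. pair y ((dual_D ^^ i) f))"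
      using f functional_pair' by (simp add: slow_part_def)
    from dual.growth_le_adj[OF s this] show "growth_le av s (\<lambda>i. pair ((D ^^ i) y) f)"
      by (simp add: dual_adj)
  qed
  then have 1: "pair v f = 0" using v(2) unfolding fast_part_def by blast
  have "dual.slowf s UNIV (pair v)"
    unfolding slow_functional_def
  proof (intro conjI ballI functional_pair')
    fix z
    have "growth_le av s (\<lambda>i. pair ((D ^^ i) v) z)"
      using v(1)[unfolded slow_part_def, THEN CollectD, rule_format, OF functional_pair[of z]] .
    from growth_le_adj[OF s this] show "growth_le av s (\<lambda>i. pair v ((dual_D ^^ i) z))"
      by (simp flip: pair_funpow)
  qed
  then have "pair v g = 0" using g unfolding fast_part_def by blast
  with 1 show "pair v w = 0" using functional_add[OF functional_pair'] by (simp add: w)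
qed

subsection \<open>Spectral norms of quotients\<close>

lemma vcoset_eq_iff:
  assumes "subspace U"
  shows "vcoset U x = vcoset U y \<longleftrightarrow> x - y \<in> U"
proof
  assume "vcoset U x = vcoset U y"
  moreover have "x \<in> vcoset U x" unfolding vcoset_def using subspace_0[OF assms] by force
  ultimately obtain u where "u \<in> U" "x = y + u" unfolding vcoset_def by auto
  then show "x - y \<in> U" by simp
next
  assume xy: "x - y \<in> U"
  have "vcoset U a \<subseteq> vcoset U b" if ab: "a - b \<in> U" for a b
  proof
    fix z assume "z \<in> vcoset U a"
    then obtain u where "u \<in> U" "z = a + u" unfolding vcoset_def by auto
    then have "z = b + ((a - b) + u)" "(a - b) + u \<in> U" using ab assms by (auto intro: subspace_add)
    then show "z \<in> vcoset U b" unfolding vcoset_def by blast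
  qed
  moreover have "y - x \<in> U" using subspace_neg[OF assms xy] by simp
  ultimately show "vcoset U x = vcoset U y" using xy by blast
qed

text \<open>The maximum of the coordinates modulo \<open>U\<close> is constant on cosets, so it may
  be evaluated at an arbitrarily chosen representative.\<close>

lemma quotient_norm_exists:
  assumes "subspace U" "subspace W" "U \<subseteq> W"
  shows "\<exists>N. quotient_norm av smul W U N"
proof -
  obtain B \<psi> where B: "finite B" "B \<subseteq> W" "\<And>b. fnl (\<psi> b)" "\<And>b u. b \<in> B \<Longrightarrow> u \<in> U \<Longrightarrow> \<psi> b u = 0"
    "\<And>x. x \<in> W \<Longrightarrow> x - (\<Sum>b\<in>B. smul (\<psi> b x) b) \<in> U"
    "\<And>b b'. b \<in> B \<Longrightarrow> b' \<in> B \<Longrightarrow> \<psi> b b' = (if b = b' then 1 else 0)"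
    by (rule quotient_basis[OF assms]) (rule that)
  define p where "p x = Max (insert 0 ((\<lambda>b. av (\<psi> b x)) ` B))" for x
  have fin: "finite (insert 0 ((\<lambda>b. av (\<psi> b x)) ` B))" for x using B(1) by simp
  have p_le: "p x \<le> M \<longleftrightarrow> 0 \<le> M \<and> (\<forall>b\<in>B. av (\<psi> b x) \<le> M)" for x M
    unfolding p_def using fin by (subst Max_le_iff) auto
  have p0: "0 \<le> p x" and pb: "b \<in> B \<Longrightarrow> av (\<psi> b x) \<le> p x" for x b
    using p_le[of x "p x"] by auto
  have p_scale_le: "p (smul c x) \<le> av c * p x" for c x
    unfolding p_le using p0 pb by (auto simp: functional_scale[OF B(3)] av_mult av_nonneg intro!: mult_left_mono)
  have p_scale: "p (smul c x) = av c * p x" for c x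
  proof (cases "c = 0")
    case True
    then show ?thesis using p_scale_le[of 0 x] p0[of "smul 0 x"] by simp
  next
    case False
    have "p (smul (inverse c) (smul c x)) \<le> av (inverse c) * p (smul c x)" by (rule p_scale_le)
    then have "p x \<le> inverse (av c) * p (smul c x)" using False by (simp add: av_inverse)
    then have "av c * p x \<le> p (smul c x)" using av_pos[OF False] by (simp add: field_simps)
    then show ?thesis using p_scale_le[of c x] by linarith
  qed
  define N where "N Y = p (SOME x. x \<in> Y)" for Y
  have N: "N (vcoset U x) = p x" for x
  proof -
    let ?z = "SOME z. z \<in> vcoset U x"
    have "x \<in> vcoset U x" unfolding vcoset_def using subspace_0[OF assms(1)] by force
    then have "?z \<in> vcoset U x" by (rule someI)
    then obtain u where u: "u \<in> U" "?z = x + u" unfolding vcoset_def by auto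
    have "\<psi> b ?z = \<psi> b x" if "b \<in> B" for b using B(4)[OF that u(1)] by (simp add: u(2) functional_add[OF B(3)])
    then have "(\<lambda>b. av (\<psi> b ?z)) ` B = (\<lambda>b. av (\<psi> b x)) ` B" by (intro image_cong) auto
    then show ?thesis by (simp add: N_def p_def)
  qed
  have "quotient_norm av smul W U N"
    unfolding quotient_norm_def N vcoset_eq_iff[OF assms(1)]
  proof (intro conjI ballI allI p0 p_scale)
    fix x assume x: "x \<in> W"
    show "p x = 0 \<longleftrightarrow> x - 0 \<in> U"
    proof
      assume "p x = 0"
      then have "\<psi> b x = 0" if "b \<in> B" for b
        using pb[OF that, of x] av_nonneg[of "\<psi> b x"] av_eq_0_iff by simp
      then show "x - 0 \<in> U" using B(5)[OF x] by simp
    next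
      assume "x - 0 \<in> U"
      then have "p x \<le> 0" unfolding p_le using B(4) by simp
      then show "p x = 0" using p0[of x] by simp
    qed
    fix y assume "y \<in> W"
    show "p (x + y) \<le> max (p x) (p y)"
      unfolding p_le functional_add[OF B(3)]
      by (intro conjI ballI av_add_le max.coboundedI1[OF p0]
          max.coboundedI1[OF pb, of _ x] max.coboundedI2[OF pb, of _ y])
  qed
  then show ?thesis by blast
qed

text \<open>The bridge from spectral norms to slowness. Together the two claims make
  \<open>q\<close> the least level, among those at least \<open>sp\<close>, at which the quotient is
  slow; in particular it does not depend on \<open>N\<close>.\<close>

lemma quotient_spectral_norm:
  assumes U: "stab U" and W: "stab W" and UW: "U \<subset> W" and N: "quotient_norm av smul W U N"
  defines "q \<equiv> sp_norm (W - U) (\<lambda>x. N (vcoset U x)) D"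
  shows "sp \<le> q" and "\<And>t. sp \<le> t \<Longrightarrow> q \<le> t \<longleftrightarrow> slowq t W U"
proof -
  note subU = stable_subspaceD(1)[OF U] and subW = stable_subspaceD(1)[OF W]
  define p where "p x = N (vcoset U x)" for x
  have p: "ultra_seminorm_on av smul W p"
    using N unfolding quotient_norm_def ultra_seminorm_on_def p_def by blast
  have p0: "p x = 0 \<longleftrightarrow> x \<in> U" if "x \<in> W" for x
    using N that vcoset_eq_iff[OF subU, of x 0] unfolding quotient_norm_def p_def by simp
  have pn: "0 \<le> p x" if "x \<in> W" for x using p that unfolding ultra_seminorm_on_def by blast
  have psc: "p (smul c x) = av c * p x" if "x \<in> W" for c x using p that unfolding ultra_seminorm_on_def by blast
  have S: "W - U = {x \<in> W. p x \<noteq> 0}" using p0 by auto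
  have Sne: "W - U \<noteq> {}" using UW by blast
  have DW: "D x \<in> W" if "x \<in> W" for x using W that by (rule stable_subspaceD)
  have q: "q = sp_norm (W - U) p D" unfolding q_def p_def ..
  have q0: "0 \<le> q" unfolding q sp_norm_def by (rule cINF_greatest) auto
  obtain B \<psi> where B: "finite B" "B \<subseteq> W" "\<And>b. fnl (\<psi> b)" "\<And>b u. b \<in> B \<Longrightarrow> u \<in> U \<Longrightarrow> \<psi> b u = 0"
    "\<And>x. x \<in> W \<Longrightarrow> x - (\<Sum>b\<in>B. smul (\<psi> b x) b) \<in> U"
    "\<And>b b'. b \<in> B \<Longrightarrow> b' \<in> B \<Longrightarrow> \<psi> b b' = (if b = b' then 1 else 0)"
    by (rule quotient_basis[OF subU subW]) (use UW in \<open>auto intro: that\<close>)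
  have fun_bound: "\<exists>C>0. \<forall>x\<in>W. av (\<phi> x) \<le> C * p x" if "fnl \<phi>" "\<forall>u\<in>U. \<phi> u = 0" for \<phi>
    using that p0 by (intro functional_bounded_by_seminorm[OF p subW]) auto
  have "\<forall>b\<in>B. \<exists>C. 0 < C \<and> (\<forall>x\<in>W. av (\<psi> b x) \<le> C * p x)" using fun_bound[OF B(3)] B(4) by blast
  from bchoice[OF this] obtain C
    where C: "\<And>b. b \<in> B \<Longrightarrow> 0 < C b" "\<And>b x. b \<in> B \<Longrightarrow> x \<in> W \<Longrightarrow> av (\<psi> b x) \<le> C b * p x" by blast
  have p_mod: "p x \<le> M" if x: "x \<in> W" and u: "x - z \<in> U" and z: "z \<in> W" "p z \<le> M" for x z M
  proof -
    have "x - z \<in> W" using u UW by blast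
    then have "p (z + (x - z)) \<le> max (p z) (p (x - z))" using p z(1) unfolding ultra_seminorm_on_def by blast
    moreover have "p (x - z) = 0" using p0 u UW by blast
    ultimately show ?thesis using z pn[OF z(1)] by simp
  qed
  \<comment> \<open>An additive map preserving \<open>U\<close> and \<open>W\<close> is controlled
    by its values on multiples of the finitely many \<open>b\<close>; this serves \<open>D\<close>
    as well as all its powers.\<close>
  have expand: "p (T x) \<le> M * p x"
    if x: "x \<in> W" and T: "\<And>v w. T (v - w) = T v - T w" "\<And>f. T (\<Sum>b\<in>B. f b) = (\<Sum>b\<in>B. T (f b))"
      "\<And>u. u \<in> U \<Longrightarrow> T u \<in> U" "\<And>u. u \<in> W \<Longrightarrow> T u \<in> W"
      and b: "\<And>b. b \<in> B \<Longrightarrow> p (T (smul (\<psi> b x) b)) \<le> M * p x" and M: "0 \<le> M" for T x M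
  proof (rule p_mod)
    let ?z = "\<Sum>b\<in>B. smul (\<psi> b x) b"
    have bW: "smul c b \<in> W" if "b \<in> B" for b c using that B(2) by (intro subspace_scale subW) auto
    show "T x \<in> W" using x by (rule T(4))
    show "T x - T ?z \<in> U" using T(3)[OF B(5)[OF x]] by (simp only: T(1))
    show "T ?z \<in> W" using bW by (intro T(4) subspace_sum subW)
    show "p (T ?z) \<le> M * p x"
      unfolding T(2) using b bW T(4) pn[OF x] M by (intro seminorm_sum_le[OF p subW]) auto
  qed
  \<comment> \<open>Boundedness of \<open>D\<close> is what gives the suprema in
    \<open>sp_norm\<close> their meaning.\<close>
  have "\<exists>M. \<forall>x\<in>W. p (D x) \<le> M * p x"
  proof -
    obtain R where R: "0 < R" "\<And>x. av (d x) \<le> R * av x" using d_bound by blast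
    obtain M where M: "0 < M" "\<And>b. b \<in> B \<Longrightarrow> C b * max (R * p b) (p (D b)) \<le> M"
      using finite_real_bound[OF B(1), of "\<lambda>b. C b * max (R * p b) (p (D b))"] by metis
    have "p (D x) \<le> M * p x" if x: "x \<in> W" for x
    proof (rule expand[OF x])
      fix b assume b: "b \<in> B"
      then have bW: "b \<in> W" using B(2) by blast
      have "p (D (smul (\<psi> b x) b)) \<le> max (p (smul (d (\<psi> b x)) b)) (p (smul (\<psi> b x) (D b)))"
        unfolding D_scale using p bW DW subspace_scale[OF subW] unfolding ultra_seminorm_on_def by blast
      also have "\<dots> \<le> max (R * av (\<psi> b x) * p b) (av (\<psi> b x) * p (D b))"
        using R(2)[of "\<psi> b x"] pn[OF bW] psc[OF bW] psc[OF DW[OF bW]]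
        by (intro max.mono) (auto intro: mult_right_mono)
      also have "\<dots> = av (\<psi> b x) * max (R * p b) (p (D b))"
        using av_nonneg[of "\<psi> b x"] by (simp add: max_mult_distrib_left mult_ac)
      also have "\<dots> \<le> (C b * p x) * max (R * p b) (p (D b))"
        using C(2)[OF b x] pn[OF DW[OF bW]] by (intro mult_right_mono) (auto simp: le_max_iff_disj)
      also have "\<dots> = (C b * max (R * p b) (p (D b))) * p x" by simp
      also have "\<dots> \<le> M * p x" using M(2)[OF b] pn[OF x] by (rule mult_right_mono)
      finally show "p (D (smul (\<psi> b x) b)) \<le> M * p x" .
    qed (use M stable_subspaceD(2)[OF U] in \<open>auto simp: D_diff D_sum DW\<close>)
    then show ?thesis by blast
  qed
  then obtain M where M: "\<And>x. x \<in> W \<Longrightarrow> p (D x) \<le> M * p x" by blast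
  have lessD: "\<exists>C>0. \<forall>n. \<forall>x\<in>W. p ((D ^^ n) x) \<le> C * l ^ n * p x" if "q < l" for l
    by (rule sp_norm_lessD[OF S Sne _ M]) (use pn DW that q in auto)
  have leI: "q \<le> l" if "0 < l" "\<And>n x. x \<in> W \<Longrightarrow> p ((D ^^ n) x) \<le> K * l ^ n * p x" for l K
    unfolding q by (rule sp_norm_leI[OF S Sne _ _ that(1)]) (use pn DW that(2) in auto)

  show "sp \<le> q"
  proof (rule ccontr)
    assume "\<not> sp \<le> q"
    then obtain l where l: "q < l" "l < sp" using dense[of q sp] by auto
    have l0: "0 < l" using l q0 by linarith
    obtain K where K: "0 < K" "\<And>n x. x \<in> W \<Longrightarrow> p ((D ^^ n) x) \<le> K * l ^ n * p x" using lessD[OF l(1)] by blast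
    obtain x where x: "x \<in> W" "x \<notin> U" using UW by blast
    have px: "0 < p x" using x pn[OF x(1)] p0[OF x(1)] by linarith
    have DnW: "(D ^^ a) (smul c ((D ^^ b) x)) \<in> W" for a b c
      using x(1) by (intro stable_funpow[OF W] subspace_scale subW)
    \<comment> \<open>The Leibniz rule read backwards writes \<open>d c\<close> times a vector as a
      difference of two terms in \<open>D\<close>. So growth \<open>l\<close> of \<open>D\<close> on
      the quotient forces growth \<open>l\<close> of \<open>d\<close> on scalars.\<close>
    have main: "p ((D ^^ a) (smul ((d ^^ n) c) ((D ^^ b) x))) \<le> K * K * l ^ (a + n + b) * av c * p x" for a n b c
    proof (induction n arbitrary: a b)
      case 0
      have bW: "(D ^^ b) x \<in> W" using W x(1) by (rule stable_funpow)
      have "p ((D ^^ a) (smul c ((D ^^ b) x))) \<le> K * l ^ a * (av c * p ((D ^^ b) x))"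
        using K(2)[OF subspace_scale[OF subW bW, of c], of a] psc[OF bW] by simp
      also have "\<dots> \<le> K * l ^ a * (av c * (K * l ^ b * p x))"
        using K l0 x(1) by (intro mult_left_mono) (auto simp: av_nonneg)
      finally show ?case by (simp add: power_add mult_ac)
    next
      case (Suc n)
      let ?c = "(d ^^ n) c"
      have "smul (d ?c) ((D ^^ b) x) = D (smul ?c ((D ^^ b) x)) - smul ?c ((D ^^ Suc b) x)"
        by (simp add: D_scale)
      then have "(D ^^ a) (smul ((d ^^ Suc n) c) ((D ^^ b) x)) =
          (D ^^ Suc a) (smul ?c ((D ^^ b) x)) - (D ^^ a) (smul ?c ((D ^^ Suc b) x))"
        unfolding funpow_Suc_right[of a D] by (simp add: D_funpow_diff)
      also have "p \<dots> \<le> max (p ((D ^^ Suc a) (smul ?c ((D ^^ b) x)))) (p ((D ^^ a) (smul ?c ((D ^^ Suc b) x))))"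
        by (rule seminorm_diff[OF p subW DnW DnW])
      also have "\<dots> \<le> K * K * l ^ (a + Suc n + b) * av c * p x"
        using Suc.IH[of "Suc a" b] Suc.IH[of a "Suc b"] by simp
      finally show ?case .
    qed
    have "av ((d ^^ n) c) \<le> K * K * l ^ n * av c" for n c
      using main[of 0 n c 0] psc[OF x(1)] px by simp
    moreover have "UNIV - {0::'k} \<noteq> {}" using one_neq_zero by blast
    ultimately have "sp \<le> l" using l0 av_nonneg by (intro sp_norm_leI[OF nonzero_eq]) auto
    then show False using l by simp
  qed

  fix t assume t: "sp \<le> t"
  show "q \<le> t \<longleftrightarrow> slowq t W U"
  proof
    assume qt: "q \<le> t"
    show "slowq t W U"
      unfolding slow_quotient_def slow_functional_def growth_le_def
    proof (intro allI impI conjI ballI)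
      fix \<phi> x l assume \<phi>: "fnl \<phi> \<and> (\<forall>u\<in>U. \<phi> u = 0)" and x: "x \<in> W" and l: "t < l"
      obtain K where K: "0 < K" "\<And>n x. x \<in> W \<Longrightarrow> p ((D ^^ n) x) \<le> K * l ^ n * p x"
        using lessD[of l] qt l by auto
      obtain R where R: "0 < R" "\<And>x. x \<in> W \<Longrightarrow> av (\<phi> x) \<le> R * p x" using fun_bound \<phi> by blast
      have "av (\<phi> ((D ^^ n) x)) \<le> (R * K * p x) * l ^ n" for n
      proof -
        have "av (\<phi> ((D ^^ n) x)) \<le> R * p ((D ^^ n) x)" by (rule R(2)[OF stable_funpow[OF W x]])
        also have "\<dots> \<le> R * (K * l ^ n * p x)" using R(1) K(2)[OF x] by (intro mult_left_mono) auto
        finally show ?thesis by (simp add: mult_ac)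
      qed
      then show "\<exists>C. \<forall>n. av (\<phi> ((D ^^ n) x)) \<le> C * l ^ n" by blast
    qed blast
  next
    \<comment> \<open>Slow coordinates bound the iterates of each basis vector in the norm, and the
      Leibniz bound makes this uniform on \<open>W\<close>.\<close>
    assume slow: "slowq t W U"
    show "q \<le> t"
    proof (rule dense_ge)
      fix l assume l: "t < l"
      have l0: "0 < l" using l t sp_nonneg by linarith
      obtain A where A: "0 < A" "\<And>n x. av ((d ^^ n) x) \<le> A * l ^ n * av x"
        using d_funpow_boundE[OF t l] by metis
      have "\<exists>K. 0 < K \<and> (\<forall>n. p ((D ^^ n) b) \<le> K * l ^ n)" if b: "b \<in> B" for b
      proof -
        have bW: "b \<in> W" using b B(2) by blast
        have "\<forall>b'\<in>B. \<exists>K. 0 \<le> K \<and> (\<forall>n. av (\<psi> b' ((D ^^ n) b)) \<le> K * l ^ n)"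
        proof
          fix b' assume b': "b' \<in> B"
          then have "growth_le av t (\<lambda>n. \<psi> b' ((D ^^ n) b))"
            using slow B(3,4) bW unfolding slow_quotient_def slow_functional_def by blast
          from growth_leD[OF this l] show "\<exists>K. 0 \<le> K \<and> (\<forall>n. av (\<psi> b' ((D ^^ n) b)) \<le> K * l ^ n)" by blast
        qed
        from bchoice[OF this] obtain K where K: "\<And>b'. b' \<in> B \<Longrightarrow> 0 \<le> K b'"
          "\<And>b' n. b' \<in> B \<Longrightarrow> av (\<psi> b' ((D ^^ n) b)) \<le> K b' * l ^ n" by blast
        obtain R where R: "0 < R" "\<And>b'. b' \<in> B \<Longrightarrow> K b' * p b' \<le> R"
          using finite_real_bound[OF B(1), of "\<lambda>b'. K b' * p b'"] by metis
        have "p ((D ^^ n) b) \<le> R * l ^ n" for n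
        proof (rule p_mod)
          let ?x = "(D ^^ n) b"
          show x: "?x \<in> W" using W bW by (rule stable_funpow)
          show "?x - (\<Sum>b'\<in>B. smul (\<psi> b' ?x) b') \<in> U" using x by (rule B(5))
          show "(\<Sum>b'\<in>B. smul (\<psi> b' ?x) b') \<in> W" using B(2) by (intro subspace_sum subspace_scale subW) auto
          show "p (\<Sum>b'\<in>B. smul (\<psi> b' ?x) b') \<le> R * l ^ n"
          proof (rule seminorm_sum_le[OF p subW])
            show "0 \<le> R * l ^ n" using R l0 by simp
            fix b' assume b': "b' \<in> B"
            then have b'W: "b' \<in> W" using B(2) by blast
            then show "smul (\<psi> b' ?x) b' \<in> W" by (intro subspace_scale subW)
            have "p (smul (\<psi> b' ?x) b') \<le> (K b' * l ^ n) * p b'"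
              unfolding psc[OF b'W] using K(2)[OF b'] pn[OF b'W] by (rule mult_right_mono)
            also have "\<dots> = (K b' * p b') * l ^ n" by simp
            also have "\<dots> \<le> R * l ^ n" using R(2)[OF b'] l0 by (intro mult_right_mono) auto
            finally show "p (smul (\<psi> b' ?x) b') \<le> R * l ^ n" .
          qed
        qed
        then show ?thesis using R(1) by blast
      qed
      then have "\<forall>b\<in>B. \<exists>K. 0 < K \<and> (\<forall>n. p ((D ^^ n) b) \<le> K * l ^ n)" by blast
      from bchoice[OF this] obtain K where K: "\<And>b. b \<in> B \<Longrightarrow> 0 < K b"
        "\<And>b n. b \<in> B \<Longrightarrow> p ((D ^^ n) b) \<le> K b * l ^ n" by blast
      obtain R where R: "0 < R" "\<And>b. b \<in> B \<Longrightarrow> A * C b * K b \<le> R"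
        using finite_real_bound[OF B(1), of "\<lambda>b. A * C b * K b"] by metis
      have "p ((D ^^ n) x) \<le> R * l ^ n * p x" if x: "x \<in> W" for n x
      proof (rule expand[OF x])
        fix b assume b: "b \<in> B"
        then have bW: "b \<in> W" using B(2) by blast
        have "p ((D ^^ n) (smul (\<psi> b x) b)) \<le> (A * av (\<psi> b x)) * K b * l ^ n"
          by (rule leibniz_bound[OF p W bW _ K(2)[OF b]]) (use A(2)[of _ "\<psi> b x"] in \<open>simp add: mult_ac\<close>)
        also have "\<dots> \<le> (A * (C b * p x)) * K b * l ^ n"
          using A(1) C(2)[OF b x] K(1)[OF b] l0 by (intro mult_right_mono mult_left_mono) auto
        also have "\<dots> = (A * C b * K b) * (l ^ n * p x)" by simp
        also have "\<dots> \<le> R * (l ^ n * p x)" using R(2)[OF b] l0 pn[OF x] by (intro mult_right_mono) auto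
        finally show "p ((D ^^ n) (smul (\<psi> b x) b)) \<le> R * l ^ n * p x" by simp
      qed (use R l0 stable_funpow[OF U] stable_funpow[OF W] in \<open>auto simp: D_funpow_diff D_funpow_sum\<close>)
      then show "q \<le> l" by (rule leI[OF l0])
    qed
  qed
qed

end

section \<open>Pure parts and composition series\<close>

text \<open>Slow at \<open>s\<close> and fast at every admissible level below: this encodes that all
  factors have spectral norm exactly \<open>s\<close>, hence radius
  \<open>omega av / s\<close>.\<close>

definition pure_part ::
    "('k::field_char_0 \<Rightarrow> real) \<Rightarrow> ('k \<Rightarrow> 'k) \<Rightarrow> ('k \<Rightarrow> 'v::ab_group_add \<Rightarrow> 'v) \<Rightarrow> ('v \<Rightarrow> 'v) \<Rightarrow> real \<Rightarrow> 'v set" where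
  "pure_part av d smul D s = {x \<in> slow_part av smul D s.
     \<forall>t. sp_norm (UNIV - {0}) av d \<le> t \<and> t < s \<longrightarrow> x \<in> fast_part av smul D t UNIV}"

context valued_differential_module
begin

abbreviation "pure \<equiv> pure_part av d smul D"

lemma subspace_pure_part:
  assumes "sp \<le> s"
  shows "subspace (pure s)"
proof -
  note slow = subspace_slow_part[OF assms] and fast = subspace_fast_part[OF subspace_UNIV]
  show ?thesis
    unfolding pure_part_def
    by (rule subspaceI)
      (simp_all add: subspace_0[OF slow] subspace_0[OF fast] subspace_add[OF slow] subspace_add[OF fast]
        subspace_scale[OF slow] subspace_scale[OF fast])
qed

text \<open>The spectral norm of the whole module is such a level. The zero module is treated apart,
  because its suprema range over the empty set.\<close>

lemma exists_slow: "\<exists>s\<ge>sp. slow s = UNIV"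
proof (cases "UNIV = {0::'v}")
  case True
  have "0 \<in> slow sp" by (rule subspace_0[OF subspace_slow_part[OF order_refl]])
  moreover have "x = 0" for x :: 'v using UNIV_I[of x] unfolding True by simp
  ultimately have "slow sp = UNIV" by (metis UNIV_eq_I)
  then show ?thesis by (intro exI[of _ sp]) simp
next
  case False
  have 0: "stab {0}" and 1: "stab UNIV" by (auto simp: stable_subspace_def)
  obtain N where N: "quotient_norm av smul UNIV {0} N"
    using quotient_norm_exists[OF subspace_single_0 subspace_UNIV subset_UNIV] ..
  have "{0::'v} \<subset> UNIV" using False[symmetric] by (intro psubsetI subset_UNIV)
  note q = quotient_spectral_norm[OF 0 1 this N]
  have "UNIV \<subseteq> slow (sp_norm (UNIV - {0}) (\<lambda>x. N (vcoset {0} x)) D)"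
    using q(2)[OF q(1)] by (simp only: slow_quotient_zero_iff order_refl)
  then have "slow (sp_norm (UNIV - {0}) (\<lambda>x. N (vcoset {0} x)) D) = UNIV" by (rule top.extremum_uniqueI)
  with q(1) show ?thesis by (intro exI conjI)
qed

lemma fast_part_mono: "W \<subseteq> W' \<Longrightarrow> fast s W \<subseteq> fast s W'"
  by (auto simp: fast_part_def slow_functional_def)

lemma irreducible_quotientD:
  assumes "irreducible_quotient smul D W U"
  shows "stab U" "stab W" "U \<subset> W" "U \<subseteq> W"
  using assms by (simp_all add: irreducible_quotient_def psubset_imp_subset)

lemma composition_series_exists: "stab X \<Longrightarrow> \<exists>Ws. composition_series smul D X Ws"
proof (induction "dim X" arbitrary: X rule: less_induct)
  case less
  show ?case
  proof (cases "X = {0}")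
    case True
    then show ?thesis by (intro exI[of _ "[{0}]"]) (simp add: composition_series_def)
  next
    case False
    have "{0} \<subset> X" using False subspace_0[OF stable_subspaceD(1)[OF less.prems]] by blast
    moreover have "stab {0}" by (simp add: stable_subspace_def)
    \<comment> \<open>Maximal dimension among the proper stable subspaces makes the top quotient
      irreducible.\<close>
    ultimately have "\<exists>U. (stab U \<and> U \<subset> X) \<and> (\<forall>Z. stab Z \<and> Z \<subset> X \<longrightarrow> dim Z \<le> dim U)"
      by (intro ex_has_greatest_nat[of _ "{0}" _ "Suc dimension"])
        (simp_all add: less_Suc_eq_le dim_subset_UNIV)
    then obtain U where U: "stab U" "U \<subset> X" "\<And>Z. stab Z \<Longrightarrow> Z \<subset> X \<Longrightarrow> dim Z \<le> dim U" by blast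
    have irr: "irreducible_quotient smul D X U"
      unfolding irreducible_quotient_def
    proof (intro conjI allI impI U(1,2) less.prems)
      fix Z assume Z: "stab Z \<and> U \<subseteq> Z \<and> Z \<subseteq> X"
      show "Z = U \<or> Z = X"
      proof (cases "Z = X")
        case False
        then have "dim Z \<le> dim U" using Z U(3) by blast
        then show ?thesis
          using subspace_dim_equal[OF stable_subspaceD(1)[OF U(1)] stable_subspaceD(1)] Z by blast
      qed simp
    qed
    have "dim U < dim X" using U less.prems by (intro dim_less stable_subspaceD(1))
    then obtain Ws where Ws: "composition_series smul D U Ws" using less.hyps U(1) by blast
    have "composition_series smul D X (Ws @ [X])"
      unfolding composition_series_def
    proof (intro conjI allI impI)
      show "hd (Ws @ [X]) = {0}" using Ws by (simp add: composition_series_def)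
      fix i assume i: "Suc i < length (Ws @ [X])"
      show "irreducible_quotient smul D ((Ws @ [X]) ! Suc i) ((Ws @ [X]) ! i)"
      proof (cases "Suc i < length Ws")
        case True
        then show ?thesis using Ws by (simp add: composition_series_def nth_append)
      next
        case False
        then have i': "length Ws = Suc i" using i by simp
        have "Ws \<noteq> []" "last Ws = U" using Ws by (simp_all add: composition_series_def)
        then have "Ws ! i = U" using i' by (simp add: last_conv_nth)
        then show ?thesis using irr i' by (simp add: nth_append)
      qed
    qed simp_all
    then show ?thesis by blast
  qed
qed

lemma composition_series_member:
  assumes "composition_series smul D X Ws" "stab X" "i < length Ws"
  shows "stab (Ws ! i) \<and> Ws ! i \<subseteq> X"
proof -
  have irr: "irreducible_quotient smul D (Ws ! Suc i) (Ws ! i)" if "Suc i < length Ws" for i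
    using assms(1) that by (simp add: composition_series_def)
  have last: "Ws ! (length Ws - 1) = X"
    using assms(1) by (auto simp: composition_series_def last_conv_nth)
  have "i \<le> length Ws - 1" using assms(3) by simp
  then show ?thesis
  proof (induction rule: inc_induct)
    case base
    then show ?case using last assms(2) by simp
  next
    case (step k)
    then have "irreducible_quotient smul D (Ws ! Suc k) (Ws ! k)" by (intro irr) simp
    from irreducible_quotientD[OF this] show ?case using step.IH by (meson order_trans)
  qed
qed

lemma irreducible_quotient_radius:
  assumes "irreducible_quotient smul D W U"
  obtains q where "quotient_radius av smul D W U = omega av / q" "sp \<le> q"
    "\<And>t. sp \<le> t \<Longrightarrow> q \<le> t \<longleftrightarrow> slowq t W U"
proof -
  note U = irreducible_quotientD(1)[OF assms] and W = irreducible_quotientD(2)[OF assms]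
    and UW = irreducible_quotientD(3)[OF assms]
  define N where "N = (SOME N. quotient_norm av smul W U N)"
  have N: "quotient_norm av smul W U N"
    unfolding N_def
    by (rule someI_ex[OF quotient_norm_exists[OF stable_subspaceD(1)[OF U] stable_subspaceD(1)[OF W]
        psubset_imp_subset[OF UW]]])
  show ?thesis
    by (rule that[OF _ quotient_spectral_norm[OF U W UW N]])
      (simp_all add: quotient_radius_def N_def)
qed

text \<open>The radii of \<open>X\<close> are \<open>omega av / q i\<close>, with \<open>q i\<close>
  the spectral norms of the composition factors. Slow factors build up to a slow module by
  extension, irreducibility pushes a non-slow factor into the fast part, and the converse rests on
  the disjointness of slow and fast parts.\<close>

lemma generic_radii_iff_pure:
  assumes sp: "0 < sp" "sp \<le> s" and X: "stab X"
  shows "(\<forall>t\<in>generic_radii av smul D X. t = omega av / s) \<longleftrightarrow> X \<subseteq> pure s"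
proof -
  have s0: "0 < s" using sp by linarith
  define Ws where "Ws = (SOME Ws. composition_series smul D X Ws)"
  have Ws: "composition_series smul D X Ws"
    unfolding Ws_def using composition_series_exists[OF X] by (rule someI_ex)
  have irr: "irreducible_quotient smul D (Ws ! Suc i) (Ws ! i)" if "Suc i < length Ws" for i
    using Ws that by (simp add: composition_series_def)
  have first: "Ws ! 0 = {0}" "0 < length Ws" using Ws by (auto simp: composition_series_def hd_conv_nth)
  have last: "Ws ! (length Ws - 1) = X" using Ws by (auto simp: composition_series_def last_conv_nth)
  have lt: "length Ws - 1 < length Ws" using first(2) by simp
  note member = composition_series_member[OF Ws X]
  have "\<forall>i. \<exists>q. Suc i < length Ws \<longrightarrow> quotient_radius av smul D (Ws ! Suc i) (Ws ! i) = omega av / q \<and> sp \<le> q \<and>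
    (\<forall>t\<ge>sp. q \<le> t \<longleftrightarrow> slowq t (Ws ! Suc i) (Ws ! i))"
  proof
    fix i
    show "\<exists>q. Suc i < length Ws \<longrightarrow> quotient_radius av smul D (Ws ! Suc i) (Ws ! i) = omega av / q \<and> sp \<le> q \<and>
      (\<forall>t\<ge>sp. q \<le> t \<longleftrightarrow> slowq t (Ws ! Suc i) (Ws ! i))"
    proof (cases "Suc i < length Ws")
      case True
      obtain q where "quotient_radius av smul D (Ws ! Suc i) (Ws ! i) = omega av / q" "sp \<le> q"
        "\<And>t. sp \<le> t \<Longrightarrow> q \<le> t \<longleftrightarrow> slowq t (Ws ! Suc i) (Ws ! i)"
        by (rule irreducible_quotient_radius[OF irr[OF True]]) (rule that)
      then show ?thesis by blast
    qed simp
  qed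
  from choice[OF this] obtain q where "\<forall>i. Suc i < length Ws \<longrightarrow>
    quotient_radius av smul D (Ws ! Suc i) (Ws ! i) = omega av / q i \<and> sp \<le> q i \<and>
    (\<forall>t\<ge>sp. q i \<le> t \<longleftrightarrow> slowq t (Ws ! Suc i) (Ws ! i))" ..
  then have q: "quotient_radius av smul D (Ws ! Suc i) (Ws ! i) = omega av / q i" "sp \<le> q i"
    "\<And>t. sp \<le> t \<Longrightarrow> q i \<le> t \<longleftrightarrow> slowq t (Ws ! Suc i) (Ws ! i)" if "Suc i < length Ws" for i
    using that by simp_all
  have radii: "(\<forall>t\<in>generic_radii av smul D X. t = omega av / s) \<longleftrightarrow> (\<forall>i. Suc i < length Ws \<longrightarrow> q i = s)"
  proof -
    \<comment> \<open>Strictness guarantees that truncated subtraction gives every factor a positive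
      multiplicity.\<close>
    have dim: "dim (Ws ! i) < dim (Ws ! Suc i)" if "Suc i < length Ws" for i
      by (intro dim_less stable_subspaceD(1) irreducible_quotientD[OF irr[OF that]])
    have mem: "t \<in> generic_radii av smul D X \<longleftrightarrow> (\<exists>i. Suc i < length Ws \<and> t = omega av / q i)" for t
    proof -
      have "t \<in> generic_radii av smul D X \<longleftrightarrow> (\<exists>i<length Ws - 1.
          (if t = quotient_radius av smul D (Ws ! Suc i) (Ws ! i) then dim (Ws ! Suc i) - dim (Ws ! i) else 0) > 0)"
        unfolding generic_radii_def radius_mult_def Let_def Ws_def[symmetric]
        by (simp only: mem_Collect_eq neq0_conv[symmetric] sum_eq_0_iff finite_lessThan
            Ball_def not_all not_imp lessThan_iff)
      also have "\<dots> \<longleftrightarrow> (\<exists>i. Suc i < length Ws \<and> t = omega av / q i)"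
      proof (intro ex_cong1)
        fix i
        show "i < length Ws - 1 \<and> 0 < (if t = quotient_radius av smul D (Ws ! Suc i) (Ws ! i)
            then dim (Ws ! Suc i) - dim (Ws ! i) else 0) \<longleftrightarrow> Suc i < length Ws \<and> t = omega av / q i"
          using dim[of i] q(1)[of i] by (cases "Suc i < length Ws") auto
      qed
      finally show ?thesis .
    qed
    show ?thesis
    proof
      assume radii: "\<forall>t\<in>generic_radii av smul D X. t = omega av / s"
      show "\<forall>i. Suc i < length Ws \<longrightarrow> q i = s"
      proof (intro allI impI)
        fix i assume i: "Suc i < length Ws"
        then have "omega av / q i \<in> generic_radii av smul D X" unfolding mem by (intro exI[of _ i]) simp
        then have "omega av / q i = omega av / s" using radii by simp
        then show "q i = s" using omega_pos q(2)[OF i] sp(1) s0 by (simp add: frac_eq_eq)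
      qed
    qed (auto simp: mem)
  qed
  show ?thesis
    unfolding radii
  proof
    assume eq: "\<forall>i. Suc i < length Ws \<longrightarrow> q i = s"
    have "slowq s (Ws ! i) {0}" if "i < length Ws" for i
      using that
    proof (induction i)
      case 0
      have "{0} \<subseteq> slow s" using subspace_0[OF subspace_slow_part[OF sp(2)]] by simp
      then show ?case by (simp add: first slow_quotient_zero_iff)
    next
      case (Suc i)
      have "slowq s (Ws ! Suc i) (Ws ! i)" using q(3)[OF Suc.prems sp(2)] eq Suc.prems by simp
      moreover have "Ws ! i \<subseteq> Ws ! Suc i" by (rule irreducible_quotientD(4)[OF irr[OF Suc.prems]])
      moreover have "stab (Ws ! Suc i)" "stab (Ws ! i)" "slowq s (Ws ! i) {0}"
        using member[of i] member[of "Suc i"] Suc.IH Suc.prems by simp_all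
      ultimately show ?case using slow_quotient_trans[OF sp(2), of "Ws ! Suc i" "Ws ! i" "{0}"] by simp
    qed
    from this[OF lt] have slow: "X \<subseteq> slow s" unfolding last slow_quotient_zero_iff .
    \<comment> \<open>Climb the series. If the next term met the fast part only in the previous
      term, the factor would embed in the slow quotient of the whole module, forcing
      \<open>q i \<le> t < s\<close>.\<close>
    have fast: "X \<subseteq> fast t UNIV" if t: "sp \<le> t" "t < s" for t
    proof -
      have t0: "0 \<le> t" using t sp by linarith
      have fast: "stab (fast t UNIV)" using t(1) by (intro stable_fast_part) (auto simp: stable_subspace_def)
      have "Ws ! i \<subseteq> fast t UNIV" if "i < length Ws" for i
        using that
      proof (induction i)
        case 0
        then show ?case using subspace_0[OF stable_subspaceD(1)[OF fast]] by (simp add: first)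
      next
        case (Suc i)
        let ?W = "Ws ! Suc i" and ?U = "Ws ! i"
        have sub: "?U \<subseteq> fast t UNIV" using Suc by simp
        have W: "stab ?W" using member Suc.prems by simp
        have "stab (?W \<inter> fast t UNIV)"
          using subspace_inter[OF stable_subspaceD(1)[OF W] stable_subspaceD(1)[OF fast]]
            stable_subspaceD(2)[OF W] stable_subspaceD(2)[OF fast]
          unfolding stable_subspace_def by auto
        moreover have "?U \<subseteq> ?W \<inter> fast t UNIV"
          using irreducible_quotientD(4)[OF irr[OF Suc.prems]] sub by (rule Int_greatest)
        ultimately have "?W \<inter> fast t UNIV = ?U \<or> ?W \<inter> fast t UNIV = ?W"
          using irr[OF Suc.prems] by (simp add: irreducible_quotient_def)
        then show ?case
        proof
          assume eqU: "?W \<inter> fast t UNIV = ?U"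
          have "slowq t ?W ?U"
            unfolding slow_quotient_def
          proof (intro allI impI)
            fix \<phi> assume \<phi>: "fnl \<phi> \<and> (\<forall>u\<in>?U. \<phi> u = 0)"
            show "slowf t ?W \<phi>"
            proof (rule functional_slow_if_vanishes_on_common_kernel[OF t0 subspace_UNIV W subset_UNIV])
              fix x assume "x \<in> ?W" "\<And>\<psi>. slowf t UNIV \<psi> \<Longrightarrow> \<psi> x = 0"
              then have "x \<in> ?W \<inter> fast t UNIV" by (simp add: fast_part_def)
              then have "x \<in> ?U" by (simp only: eqU)
              then show "\<phi> x = 0" using \<phi> by simp
            qed (use \<phi> in simp)
          qed
          then have "q i \<le> t" using q(3)[OF Suc.prems t(1)] by simp
          then show ?thesis using eq Suc.prems t(2) by simp
        qed blast
      qed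
      from this[OF lt] show ?thesis unfolding last .
    qed
    show "X \<subseteq> pure s" using slow fast by (auto simp: pure_part_def)
  next
    assume pure: "X \<subseteq> pure s"
    show "\<forall>i. Suc i < length Ws \<longrightarrow> q i = s"
    proof (intro allI impI)
      fix i assume i: "Suc i < length Ws"
      let ?W = "Ws ! Suc i" and ?U = "Ws ! i"
      have W: "stab ?W" "?W \<subseteq> X" using member i by auto
      have "X \<subseteq> slow s" using pure by (auto simp: pure_part_def)
      then have "slowq s ?W {0}" using W(2) by (auto simp: slow_quotient_zero_iff)
      moreover have U0: "{0} \<subseteq> ?U"
        using subspace_0[OF stable_subspaceD(1)[OF irreducible_quotientD(1)[OF irr[OF i]]]] by simp
      ultimately have "slowq s ?W ?U" by (rule slow_quotient_mono[OF _ order_refl])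
      then have le: "q i \<le> s" using q(3)[OF i sp(2)] by simp
      show "q i = s"
      proof (rule ccontr)
        assume "q i \<noteq> s"
        then have fast: "X \<subseteq> fast (q i) UNIV" using pure le q(2)[OF i] by (auto simp: pure_part_def)
        have slow: "slowq (q i) ?W ?U" using q(3)[OF i q(2)[OF i]] by simp
        \<comment> \<open>Split at level \<open>q i\<close>: the slow summand also lies in the fast
          part of the whole module and vanishes, and the fast summand lies in \<open>?U\<close>
          because the factor is slow.\<close>
        have "?W \<subseteq> ?U"
        proof
          fix x assume x: "x \<in> ?W"
          obtain f g where fg: "f \<in> slow (q i)" "f \<in> ?W" "g \<in> fast (q i) ?W" "x = f + g"
            by (rule slow_fast_decomposition[OF q(2)[OF i] W(1) x]) (rule that)
          have "f \<in> fast (q i) UNIV" using fg(2) W(2) fast by (meson subsetD)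
          then have "f = 0" by (rule slow_fast_disjoint[OF q(2)[OF i] fg(1)])
          moreover have "g \<in> ?U"
          proof (rule ccontr)
            assume gU: "g \<notin> ?U"
            have "subspace ?U" by (rule stable_subspaceD(1)[OF irreducible_quotientD(1)[OF irr[OF i]]])
            then obtain \<phi> where \<phi>: "fnl \<phi>" "\<And>u. u \<in> ?U \<Longrightarrow> \<phi> u = 0" "\<phi> g = 1"
              by (rule separating_functional[OF _ gU]) (rule that)
            then have "slowf (q i) ?W \<phi>" using slow by (simp add: slow_quotient_def)
            then have "\<phi> g = 0" using fg(3) by (simp add: fast_part_def)
            then show False using \<phi>(3) by simp
          qed
          ultimately show "x \<in> ?U" using fg(4) by simp
        qed
        then show False using irreducible_quotientD(3)[OF irr[OF i]] by blast
      qed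
    qed
  qed
qed

end

section \<open>Several commuting derivations\<close>

locale commuting_differential_module = valued_vector_space av smul Basis
  for av :: "'k::field_char_0 \<Rightarrow> real" and smul :: "'k \<Rightarrow> 'v::ab_group_add \<Rightarrow> 'v" and Basis +
  fixes J :: "'j set" and d :: "'j \<Rightarrow> 'k \<Rightarrow> 'k" and nabla :: "'j \<Rightarrow> 'v \<Rightarrow> 'v"
  assumes differential_module: "j \<in> J \<Longrightarrow> valued_differential_module av (d j) smul Basis (nabla j)"
    and d_nonzero: "j \<in> J \<Longrightarrow> \<exists>x. d j x \<noteq> 0"
    and nabla_commute: "i \<in> J \<Longrightarrow> j \<in> J \<Longrightarrow> nabla i (nabla j v) = nabla j (nabla i v)"
begin

abbreviation "spj j \<equiv> sp_norm (UNIV - {0}) av (d j)"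
abbreviation "slowj j \<equiv> slow_part av smul (nabla j)"
abbreviation "fastj j s \<equiv> fast_part av smul (nabla j) s UNIV"
abbreviation "tuples \<equiv> radius_tuples av J d"

definition invariant :: "'v set \<Rightarrow> bool" where
  "invariant X \<longleftrightarrow> subspace X \<and> (\<forall>j\<in>J. nabla j ` X \<subseteq> X)"

text \<open>An explicit candidate for \<open>radius_part\<close>, defined without reference to
  maximality.\<close>

definition part :: "('j \<Rightarrow> real) \<Rightarrow> 'v set" where
  "part r = {x. \<forall>j\<in>J. x \<in> pure_part av (d j) smul (nabla j) (omega av / r j)}"

lemma spj_pos: "j \<in> J \<Longrightarrow> 0 < spj j"
proof -
  assume j: "j \<in> J"
  interpret valued_differential_module av "d j" smul Basis "nabla j" using j by (rule differential_module)
  show ?thesis using d_nonzero[OF j] sp_pos by blast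
qed

lemma tuple_bounds:
  assumes "r \<in> tuples" "j \<in> J"
  shows "0 < r j" "spj j \<le> omega av / r j"
proof -
  have r: "0 < r j" "r j \<le> omega av / spj j"
    using assms by (auto simp: radius_tuples_def field_radius_def PiE_iff)
  then show "0 < r j" "spj j \<le> omega av / r j" using spj_pos[OF assms(2)] by (simp_all add: field_simps)
qed

lemma slow_invariant:
  assumes "i \<in> J" "j \<in> J" "0 \<le> s" "x \<in> slowj j s"
  shows "nabla i x \<in> slowj j s"
proof -
  interpret I: valued_differential_module av "d i" smul Basis "nabla i" using assms(1) by (rule differential_module)
  interpret valued_differential_module av "d j" smul Basis "nabla j" using assms(2) by (rule differential_module)
  show ?thesis
    by (rule slow_part_invariant[OF I.D_add I.D_scale nabla_commute[OF assms(1,2)] I.bounded_derivation_d assms(3,4)])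
qed

lemma fast_invariant:
  assumes "i \<in> J" "j \<in> J" "0 \<le> s" "x \<in> fastj j s"
  shows "nabla i x \<in> fastj j s"
proof -
  interpret I: valued_differential_module av "d i" smul Basis "nabla i" using assms(1) by (rule differential_module)
  interpret valued_differential_module av "d j" smul Basis "nabla j" using assms(2) by (rule differential_module)
  show ?thesis
    by (rule fast_part_invariant[OF I.D_add I.D_scale nabla_commute[OF assms(1,2)] I.bounded_derivation_d assms(3,4)])
      simp
qed

lemma subspace_slowj: "j \<in> J \<Longrightarrow> spj j \<le> s \<Longrightarrow> subspace (slowj j s)"
  by (rule valued_differential_module.subspace_slow_part[OF differential_module])

lemma subspace_fastj: "j \<in> J \<Longrightarrow> subspace (fastj j s)"
  by (rule valued_differential_module.subspace_fast_part[OF differential_module subspace_UNIV])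

lemma invariant_part:
  assumes "r \<in> tuples"
  shows "invariant (part r)"
proof -
  have "subspace (part r)"
  proof -
    have "subspace (pure_part av (d j) smul (nabla j) (omega av / r j))" if "j \<in> J" for j
      using valued_differential_module.subspace_pure_part[OF differential_module[OF that]] tuple_bounds[OF assms that] by blast
    then show ?thesis unfolding part_def subspace_def by blast
  qed
  moreover have "nabla i x \<in> part r" if i: "i \<in> J" and x: "x \<in> part r" for i x
    unfolding part_def pure_part_def
  proof (intro CollectI ballI conjI allI impI)
    fix j assume j: "j \<in> J"
    have x': "x \<in> pure_part av (d j) smul (nabla j) (omega av / r j)" using x j by (simp add: part_def)
    have "0 \<le> omega av / r j" using omega_pos tuple_bounds[OF assms j] by simp
    then show "nabla i x \<in> slowj j (omega av / r j)"
      using x' by (intro slow_invariant i j) (auto simp: pure_part_def)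
    fix t assume t: "spj j \<le> t \<and> t < omega av / r j"
    then have "0 \<le> t" using spj_pos[OF j] by linarith
    then show "nabla i x \<in> fastj j t"
      using x' t by (intro fast_invariant i j) (auto simp: pure_part_def)
  qed
  ultimately show ?thesis by (auto simp: invariant_def)
qed

text \<open>The property maximised in \<open>radius_part\<close> amounts to being invariant and
  contained in \<open>part r\<close>. As \<open>part r\<close> itself has it,
  \<open>GREATEST\<close> denotes a genuine greatest element.\<close>

lemma radius_part_eq:
  assumes r: "r \<in> tuples"
  shows "radius_part av smul J nabla r = part r"
proof -
  have iff: "(subspace X \<and> (\<forall>j\<in>J. nabla j ` X \<subseteq> X \<and> (\<forall>s\<in>generic_radii av smul (nabla j) X. s = r j)))
      \<longleftrightarrow> invariant X \<and> X \<subseteq> part r" for X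
  proof -
    have "(\<forall>s\<in>generic_radii av smul (nabla j) X. s = r j) \<longleftrightarrow> X \<subseteq> pure_part av (d j) smul (nabla j) (omega av / r j)"
      if X: "invariant X" and j: "j \<in> J" for j
    proof -
      interpret valued_differential_module av "d j" smul Basis "nabla j" using j by (rule differential_module)
      have "stab X" using X j by (auto simp: invariant_def stable_subspace_def)
      from generic_radii_iff_pure[OF spj_pos[OF j] tuple_bounds(2)[OF r j] this]
      show ?thesis using omega_pos tuple_bounds(1)[OF r j] by simp
    qed
    then show ?thesis unfolding invariant_def part_def by blast
  qed
  show ?thesis
    unfolding radius_part_def iff by (rule Greatest_equality) (auto simp: invariant_part[OF r])
qed

text \<open>Separate \<open>R\<close> at an index \<open>j\<close> where two of its tuples differ.
  The terms of least level \<open>m\<close> sum to a slow vector at \<open>m\<close>, the others to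
  a fast one, so both partial sums vanish and the induction applies to two proper subsets.\<close>

lemma part_disjoint:
  assumes "finite R" "R \<subseteq> tuples" "\<And>r. r \<in> R \<Longrightarrow> v r \<in> part r" "(\<Sum>r\<in>R. v r) = 0"
  shows "\<forall>r\<in>R. v r = 0"
  using assms
proof (induction R rule: finite_psubset_induct)
  case (psubset R)
  show ?case
  proof (cases "\<exists>r\<in>R. \<exists>r'\<in>R. r \<noteq> r'")
    case False
    show ?thesis
    proof
      fix r assume "r \<in> R"
      then have "R = {r}" using False by blast
      then show "v r = 0" using psubset.prems(3) by simp
    qed
  next
    case True
    then obtain r1 r2 where r: "r1 \<in> R" "r2 \<in> R" "r1 \<noteq> r2" by blast
    \<comment> \<open>Tuples are extensional, so distinct ones differ inside
      \<open>J\<close>.\<close>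
    then have "\<exists>j\<in>J. r1 j \<noteq> r2 j"
      using psubset.prems(1) unfolding radius_tuples_def by (meson PiE_ext subsetD)
    then obtain j where j: "j \<in> J" "r1 j \<noteq> r2 j" by blast
    interpret valued_differential_module av "d j" smul Basis "nabla j" using j(1) by (rule differential_module)
    define S where "S r = omega av / r j" for r :: "'j \<Rightarrow> real"
    define m where "m = Min (S ` R)"
    have fin: "finite (S ` R)" "S ` R \<noteq> {}" using psubset.hyps r by auto
    have m: "m \<in> S ` R" "\<And>r. r \<in> R \<Longrightarrow> m \<le> S r"
      unfolding m_def using fin by (auto intro: Min_in)
    define R0 where "R0 = {r \<in> R. S r = m}"
    have R0: "R0 \<subseteq> R" "R0 \<noteq> {}" using m(1) by (auto simp: R0_def)
    have "S r1 \<noteq> S r2"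
      using omega_pos j(2) by (simp add: S_def)
    then have "r1 \<notin> R0 \<or> r2 \<notin> R0" by (auto simp: R0_def)
    then have ne: "R0 \<noteq> R" using r by blast
    have mS: "spj j \<le> m" using m(1) psubset.prems(1) tuple_bounds(2)[OF _ j(1)] by (auto simp: S_def)
    have v_pure: "v r \<in> pure (S r)" if "r \<in> R" for r
      using psubset.prems(2)[OF that] j(1) by (simp add: part_def S_def)
    have slow: "(\<Sum>r\<in>R0. v r) \<in> slow m"
    proof (rule subspace_sum[OF subspace_slow_part[OF mS]])
      fix r assume "r \<in> R0"
      then show "v r \<in> slow m" using v_pure[of r] by (auto simp: R0_def pure_part_def)
    qed
    have fast: "(\<Sum>r\<in>R - R0. v r) \<in> fast m UNIV"
    proof (rule subspace_sum[OF subspace_fast_part[OF subspace_UNIV]])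
      fix r assume "r \<in> R - R0"
      then have "r \<in> R" "m < S r" using m(2)[of r] by (auto simp: R0_def)
      then show "v r \<in> fast m UNIV" using v_pure[of r] mS by (auto simp: pure_part_def)
    qed
    have split: "(\<Sum>r\<in>R. v r) = (\<Sum>r\<in>R - R0. v r) + (\<Sum>r\<in>R0. v r)"
      using R0(1) psubset.hyps by (rule sum.subset_diff)
    then have "(\<Sum>r\<in>R0. v r) = - (\<Sum>r\<in>R - R0. v r)"
      using psubset.prems(3) by (simp add: eq_neg_iff_add_eq_0 add.commute)
    then have "(\<Sum>r\<in>R0. v r) \<in> fast m UNIV"
      using subspace_neg[OF subspace_fast_part[OF subspace_UNIV] fast] by simp
    then have 0: "(\<Sum>r\<in>R0. v r) = 0" using slow_fast_disjoint[OF mS slow] by blast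
    then have 1: "(\<Sum>r\<in>R - R0. v r) = 0" using split psubset.prems(3) by simp
    have "\<forall>r\<in>R0. v r = 0"
      using psubset.IH[of R0] R0 ne psubset.prems(1,2) 0 by blast
    moreover have "\<forall>r\<in>R - R0. v r = 0"
      using psubset.IH[of "R - R0"] R0 psubset.prems(1,2) 1 by blast
    ultimately show ?thesis by blast
  qed
qed

text \<open>Split \<open>X\<close> as long as some level of some derivation gives two proper pieces;
  the dimension drops, so even an infinite \<open>J\<close> needs finitely many splittings. An
  \<open>X\<close> that no level splits lies in a single part.\<close>

lemma part_spanning:
  assumes "invariant X"
  shows "\<exists>R. finite R \<and> R \<subseteq> tuples \<and> (\<forall>x\<in>X. \<exists>v. (\<forall>r\<in>R. v r \<in> part r) \<and> x = (\<Sum>r\<in>R. v r))"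
  using assms
proof (induction "dim X" arbitrary: X rule: less_induct)
  case less
  note X = less.prems
  have subX: "subspace X" using X by (simp add: invariant_def)
  show ?case
  proof (cases "\<exists>j\<in>J. \<exists>s\<ge>spj j. \<not> X \<subseteq> slowj j s \<and> \<not> X \<subseteq> fastj j s")
    case True
    then obtain j s where j: "j \<in> J" and s: "spj j \<le> s" and ns: "\<not> X \<subseteq> slowj j s" "\<not> X \<subseteq> fastj j s" by blast
    interpret valued_differential_module av "d j" smul Basis "nabla j" using j by (rule differential_module)
    have s0: "0 \<le> s" using spj_pos[OF j] s by linarith
    let ?X1 = "X \<inter> slow s" and ?X2 = "X \<inter> fast s UNIV"
    have inter: "invariant (X \<inter> Y)" if "subspace Y" "\<And>i x. i \<in> J \<Longrightarrow> x \<in> Y \<Longrightarrow> nabla i x \<in> Y" for Y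
    proof -
      have "nabla i x \<in> X" if "i \<in> J" "x \<in> X" for i x using X that by (auto simp: invariant_def)
      then show ?thesis using that subspace_inter[OF subX that(1)] by (auto simp: invariant_def)
    qed
    have inv: "invariant ?X1" "invariant ?X2"
      by (rule inter[OF subspace_slowj[OF j s] slow_invariant[OF _ j s0]]; simp)
        (rule inter[OF subspace_fastj[OF j] fast_invariant[OF _ j s0]]; simp)
    have "dim ?X1 < dim X" using inv(1) ns(1) by (intro dim_less subX) (auto simp: invariant_def)
    from less.hyps[OF this inv(1)] obtain R1 where R1: "finite R1" "R1 \<subseteq> tuples"
      "\<And>x. x \<in> ?X1 \<Longrightarrow> \<exists>v. (\<forall>r\<in>R1. v r \<in> part r) \<and> x = (\<Sum>r\<in>R1. v r)" by blast
    have "dim ?X2 < dim X" using inv(2) ns(2) by (intro dim_less subX) (auto simp: invariant_def)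
    from less.hyps[OF this inv(2)] obtain R2 where R2: "finite R2" "R2 \<subseteq> tuples"
      "\<And>x. x \<in> ?X2 \<Longrightarrow> \<exists>v. (\<forall>r\<in>R2. v r \<in> part r) \<and> x = (\<Sum>r\<in>R2. v r)" by blast
    note R = R1(1,2) R2(1,2)
    have "\<exists>v. (\<forall>r\<in>R1 \<union> R2. v r \<in> part r) \<and> x = (\<Sum>r\<in>R1 \<union> R2. v r)" if x: "x \<in> X" for x
    proof -
      have "stab X" using X j by (auto simp: invariant_def stable_subspace_def)
      then obtain f g where fg: "f \<in> slow s" "f \<in> X" "g \<in> fast s X" "x = f + g"
        by (rule slow_fast_decomposition[OF s _ x]) (rule that)
      then have "f \<in> ?X1" "g \<in> ?X2" using fast_part_mono[of X UNIV s] fast_part_subset[of s X] by auto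
      from R1(3)[OF this(1)] R2(3)[OF this(2)]
      obtain v1 v2 where v: "\<And>r. r \<in> R1 \<Longrightarrow> v1 r \<in> part r" "f = (\<Sum>r\<in>R1. v1 r)"
        "\<And>r. r \<in> R2 \<Longrightarrow> v2 r \<in> part r" "g = (\<Sum>r\<in>R2. v2 r)" by blast
      \<comment> \<open>\<open>R1\<close> and \<open>R2\<close> may overlap, in which case the two
        components are added.\<close>
      let ?w = "\<lambda>r. (if r \<in> R1 then v1 r else 0) + (if r \<in> R2 then v2 r else 0)"
      have "?w r \<in> part r" if "r \<in> R1 \<union> R2" for r
      proof -
        have "r \<in> tuples" using R(2,4) that by blast
        then have sub: "subspace (part r)" using invariant_part by (simp add: invariant_def)
        show ?thesis
          by (rule subspace_add[OF sub]) (use v(1,3) subspace_0[OF sub] in simp_all)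
      qed
      moreover have "x = (\<Sum>r\<in>R1 \<union> R2. ?w r)"
      proof -
        have I: "(R1 \<union> R2) \<inter> R1 = R1" "(R1 \<union> R2) \<inter> R2 = R2" "finite (R1 \<union> R2)" using R by auto
        show ?thesis
          unfolding sum.distrib sum.inter_restrict[OF I(3), symmetric] I(1,2) v(2,4)[symmetric] by (rule fg(4))
      qed
      ultimately show ?thesis by (intro exI[of _ ?w] conjI ballI)
    qed
    then show ?thesis using R by (intro exI[of _ "R1 \<union> R2"] conjI ballI finite_UnI Un_least)
  next
    case False
    define A where "A j = {s. spj j \<le> s \<and> X \<subseteq> slowj j s}" for j
    define S where "S j = Inf (A j)" for j
    have A: "A j \<noteq> {}" "bdd_below (A j)" if "j \<in> J" for j
      using valued_differential_module.exists_slow[OF differential_module[OF that]]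
      by (auto simp: A_def intro!: bdd_belowI[of _ "spj j"])
    have S: "spj j \<le> S j" if "j \<in> J" for j
      unfolding S_def using A[OF that] by (intro cInf_greatest) (auto simp: A_def)
    have pure: "X \<subseteq> pure_part av (d j) smul (nabla j) (S j)" if j: "j \<in> J" for j
    proof -
      \<comment> \<open>The infimum of the slow levels is itself a slow level, since growth is only
        required for strictly larger \<open>l\<close>.\<close>
      have "x \<in> slowj j (S j)" if x: "x \<in> X" for x
        unfolding slow_part_def growth_le_def
      proof (intro CollectI allI impI)
        fix \<phi> l assume \<phi>: "fnl \<phi>" and l: "S j < l"
        then obtain s where "s \<in> A j" "s < l" using cInf_lessD[OF A(1)[OF j]] unfolding S_def by blast
        then show "\<exists>C. \<forall>i. av (\<phi> ((nabla j ^^ i) x)) \<le> C * l ^ i"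
          using \<phi> x unfolding A_def slow_part_def growth_le_def by blast
      qed
      \<comment> \<open>Below the infimum \<open>X\<close> is not contained in the slow part, and
        since no level splits it, it must be contained in the fast part.\<close>
      moreover have "x \<in> fastj j t" if x: "x \<in> X" and t: "spj j \<le> t" "t < S j" for x t
      proof -
        have "t \<notin> A j" using cInf_lower[OF _ A(2)[OF j], of t] t(2) unfolding S_def by auto
        then have "\<not> X \<subseteq> slowj j t" using t(1) by (simp add: A_def)
        then show ?thesis using False j t(1) x by blast
      qed
      ultimately show ?thesis unfolding pure_part_def by blast
    qed
    define r where "r = restrict (\<lambda>j. omega av / S j) J"
    have r: "r \<in> tuples"
      unfolding r_def radius_tuples_def field_radius_def
    proof (intro restrict_PiE_iff[THEN iffD2] ballI)
      fix j assume j: "j \<in> J"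
      have "omega av / S j \<le> omega av / spj j"
        using S[OF j] spj_pos[OF j] omega_pos by (intro divide_left_mono mult_pos_pos) auto
      then show "omega av / S j \<in> {0<..omega av / spj j}" using S[OF j] spj_pos[OF j] omega_pos by simp
    qed
    have "omega av / r j = S j" if "j \<in> J" for j using that omega_pos by (simp add: r_def)
    then have "X \<subseteq> part r" using pure by (auto simp: part_def)
    then show ?thesis using r by (intro exI[of _ "{r}"]) auto
  qed
qed

theorem radius_decomposition:
  "finite {r \<in> tuples. radius_part av smul J nabla r \<noteq> {0}} \<and>
   differential_module_iso smul J nabla (direct_sum tuples (radius_part av smul J nabla)) sum_map"
proof
  have "invariant UNIV" by (simp add: invariant_def)
  from part_spanning[OF this] obtain R where R: "finite R" "R \<subseteq> tuples"
    "\<forall>x\<in>UNIV. \<exists>v. (\<forall>r\<in>R. v r \<in> part r) \<and> x = (\<Sum>r\<in>R. v r)" by (elim exE conjE)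
  have sub: "subspace (part r)" if "r \<in> tuples" for r using invariant_part[OF that] by (simp add: invariant_def)
  \<comment> \<open>A vector \<open>x\<close> of a further part is also a sum over \<open>R\<close>;
    this is a relation on \<open>insert r R\<close> with component \<open>- x\<close> at
    \<open>r\<close>.\<close>
  have "radius_part av smul J nabla r = {0}" if r: "r \<in> tuples" "r \<notin> R" for r
  proof -
    have "x = 0" if x: "x \<in> part r" for x
    proof -
      obtain v where v: "\<And>r. r \<in> R \<Longrightarrow> v r \<in> part r" "x = (\<Sum>r\<in>R. v r)" using bspec[OF R(3) UNIV_I, of x] by blast
      let ?w = "v(r := - x)"
      have "(\<Sum>r\<in>R. ?w r) = (\<Sum>r\<in>R. v r)" using r(2) by (intro sum.cong) auto
      then have "(\<Sum>r\<in>insert r R. ?w r) = 0" using R(1) r(2) v(2) by simp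
      moreover have "?w r' \<in> part r'" if "r' \<in> insert r R" for r'
        using that v(1) x subspace_neg[OF sub[OF r(1)]] by auto
      ultimately have "\<forall>r'\<in>insert r R. ?w r' = 0"
        using R(1,2) r(1) by (intro part_disjoint) auto
      then show "x = 0" by simp
    qed
    then show ?thesis using radius_part_eq[OF r(1)] subspace_0[OF sub[OF r(1)]] by auto
  qed
  then have "{r \<in> tuples. radius_part av smul J nabla r \<noteq> {0}} \<subseteq> R" by blast
  then show "finite {r \<in> tuples. radius_part av smul J nabla r \<noteq> {0}}" using R(1) by (rule finite_subset)

  let ?M = "direct_sum tuples (radius_part av smul J nabla)"
  have M: "f \<in> ?M \<longleftrightarrow> (\<forall>r\<in>tuples. f r \<in> part r) \<and> (\<forall>r. r \<notin> tuples \<longrightarrow> f r = 0) \<and> finite {r. f r \<noteq> 0}" for f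
    by (simp add: direct_sum_def radius_part_eq)
  have sum_map: "sum_map f = (\<Sum>r\<in>S. f r)" if "finite S" "{r. f r \<noteq> 0} \<subseteq> S" for f S
    unfolding sum_map_def using that by (intro sum.mono_neutral_left) auto
  show "differential_module_iso smul J nabla ?M sum_map"
    unfolding differential_module_iso_def
  proof (intro conjI ballI allI)
    fix f g assume fg: "f \<in> ?M" "g \<in> ?M"
    let ?S = "{r. f r \<noteq> 0} \<union> {r. g r \<noteq> 0}"
    have S: "finite ?S" using fg by (simp add: M)
    show "sum_map (\<lambda>i. f i + g i) = sum_map f + sum_map g"
    proof -
      have "sum_map (\<lambda>i. f i + g i) = (\<Sum>i\<in>?S. f i + g i)" by (rule sum_map[OF S]) auto
      moreover have "sum_map f = (\<Sum>i\<in>?S. f i)" "sum_map g = (\<Sum>i\<in>?S. g i)" by (rule sum_map[OF S], blast)+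
      ultimately show ?thesis by (simp only: sum.distrib)
    qed
  next
    fix c f assume f: "f \<in> ?M"
    then have S: "finite {r. f r \<noteq> 0}" by (simp add: M)
    have "sum_map (\<lambda>i. smul c (f i)) = (\<Sum>i | f i \<noteq> 0. smul c (f i))" by (rule sum_map[OF S]) auto
    then show "sum_map (\<lambda>i. smul c (f i)) = smul c (sum_map f)"
      by (simp only: sum_map_def[of f] scale_sum_right)
  next
    fix j f assume j: "j \<in> J" and f: "f \<in> ?M"
    interpret valued_differential_module av "d j" smul Basis "nabla j" using j by (rule differential_module)
    have S: "finite {r. f r \<noteq> 0}" using f by (simp add: M)
    have "sum_map (\<lambda>i. nabla j (f i)) = (\<Sum>i | f i \<noteq> 0. nabla j (f i))" by (rule sum_map[OF S]) auto
    then show "sum_map (\<lambda>i. nabla j (f i)) = nabla j (sum_map f)"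
      by (simp only: sum_map_def[of f] D_sum)
  next
    show "bij_betw sum_map ?M UNIV"
      unfolding bij_betw_def
    proof (intro conjI inj_onI equalityI subset_UNIV subsetI)
      fix f g assume fg: "f \<in> ?M" "g \<in> ?M" and eq: "sum_map f = sum_map g"
      let ?S = "{r. f r \<noteq> 0} \<union> {r. g r \<noteq> 0}"
      have S: "finite ?S" using fg by (simp add: M)
      have "r \<in> tuples" if "r \<in> ?S" for r using fg that unfolding M by blast
      then have S': "?S \<subseteq> tuples" by blast
      have e: "sum_map f = (\<Sum>i\<in>?S. f i)" "sum_map g = (\<Sum>i\<in>?S. g i)" by (rule sum_map[OF S], blast)+
      have "(\<Sum>r\<in>?S. f r - g r) = sum_map f - sum_map g" unfolding e by (rule sum_subtractf)
      then have sum0: "(\<Sum>r\<in>?S. f r - g r) = 0" unfolding eq by simp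
      have part: "f r - g r \<in> part r" if "r \<in> ?S" for r
      proof -
        have r: "r \<in> tuples" using S' that by (rule subsetD)
        then have "f r \<in> part r" "g r \<in> part r" using fg by (simp_all add: M)
        then show ?thesis by (rule subspace_diff[OF sub[OF r]])
      qed
      have zero: "\<forall>r\<in>?S. f r - g r = 0" by (rule part_disjoint[OF S S' part sum0])
      show "f = g"
      proof
        fix r
        show "f r = g r"
        proof (cases "r \<in> ?S")
          case True
          from bspec[OF zero this] show ?thesis by simp
        qed simp
      qed
    next
      fix x
      obtain v where v: "\<And>r. r \<in> R \<Longrightarrow> v r \<in> part r" "x = (\<Sum>r\<in>R. v r)" using bspec[OF R(3) UNIV_I, of x] by blast
      let ?f = "\<lambda>r. if r \<in> R then v r else 0"
      have supp: "{r. ?f r \<noteq> 0} \<subseteq> R" by auto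
      have "?f \<in> ?M"
        unfolding M using v(1) R(2) subspace_0[OF sub] finite_subset[OF supp R(1)] by auto
      moreover have "sum_map ?f = x" using sum_map[OF R(1) supp] v(2) by simp
      ultimately show "x \<in> sum_map ` ?M" by blast
    qed
  qed
qed

end

theorem theorem1p1:
  fixes av :: "'k::field_char_0 \<Rightarrow> real"
    and J :: "'j set"
    and d :: "'j \<Rightarrow> 'k \<Rightarrow> 'k"
    and smul :: "'k \<Rightarrow> 'v::ab_group_add \<Rightarrow> 'v"
    and nabla :: "'j \<Rightarrow> 'v \<Rightarrow> 'v"
  assumes "complete_nonarch_field av"
    and "J \<noteq> {}"
    and "\<And>j. j \<in> J \<Longrightarrow> bounded_derivation av (d j)"
    and "\<And>j. j \<in> J \<Longrightarrow> \<exists>x. d j x \<noteq> 0"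
    and "\<And>i j x. i \<in> J \<Longrightarrow> j \<in> J \<Longrightarrow> d i (d j x) = d j (d i x)"
    and "finite_differential_module smul J d nabla"
  shows "finite {r \<in> radius_tuples av J d. radius_part av smul J nabla r \<noteq> {0}} \<and>
         differential_module_iso smul J nabla
           (direct_sum (radius_tuples av J d) (radius_part av smul J nabla)) sum_map"
proof -
  interpret finite_differential_module smul J d nabla by fact
  obtain B where B: "finite B" "span B = UNIV" using finite_dim by blast
  \<comment> \<open>The locale for finite dimension is based on an independent spanning set, so the
    finite spanning set is thinned out.\<close>
  obtain C where C: "C \<subseteq> B" "independent C" "B \<subseteq> span C" by (rule maximal_independent_subset)
  have "span C = UNIV" using span_mono[OF C(3)] B(2) by (simp add: span_span top.extremum_unique)
  then have fin: "finite_dimensional_vector_space smul C"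
    using C finite_subset[OF C(1) B(1)] vector_space_axioms
    by (simp add: finite_dimensional_vector_space_def finite_dimensional_vector_space_axioms_def)
  then have val: "valued_vector_space av smul C" using assms(1) by (simp add: valued_vector_space_def)
  have "valued_differential_module av (d j) smul C (nabla j)" if "j \<in> J" for j
    using that val assms(1,3) nabla_add nabla_scale
    by (simp add: valued_differential_module_def valued_differential_module_axioms_def complete_differential_field_def)
  then interpret commuting_differential_module av smul C J d nabla
    using val assms(4) nabla_commute
    by (simp add: commuting_differential_module_def commuting_differential_module_axioms_def)
  show ?thesis by (rule radius_decomposition)
qed

end
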